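(* Let $P$ be a pseudo-polygon and assign to every invisible pair of $P$ its designated blocker. Let $(p_i,p_j)$ be an invisible pair, and suppose $p_k$ is the blocker assigned to it, where $p_k\in\partial(p_i,p_j)$ (the case $p_k\in\partial(p_j,p_i)$ being the mirror image, obtained by reversing the orientation of the boundary). Then exactly one of the following two cases holds. Case 1: (a) $\{p_j,p_k\}$ is a visible pair. (b) For all $p_s\in\partial(p_i,p_{k-1})$, the blocker assigned to the invisible pair $(p_j,p_s)$ is $p_k$. (c) If $p_t$ is such that $p_i$ is the blocker assigned to the invisible pair $(p_k,p_t)$, then $(p_j,p_t)$ is an invisible pair and is assigned the blocker $p_k$. Case 2: (a) $(p_j,p_k)$ is an invisible pair. Let $p_q$ denote the blocker assigned to $(p_j,p_k)$. (b) $(p_i,p_q)$ is an invisible pair, and $p_k$ is the blocker assigned to it. (c) For all $p_s\in\partial(p_i,p_k)$, the blocker assigned to the invisible pair $(p_j,p_s)$ is $p_q$. (d) If $p_t$ is such that $p_i$ is the blocker assigned to the invisible pair $(p_k,p_t)$, then $(p_j,p_t)$ is an invisible pair and is assigned the blocker $p_q$.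
   Context: **Pseudo-polygons.** An arrangement of pseudo-lines is a collection of simple curves in $\mathbb{R}^2$, each of which separates the plane, such that each pair of them intersects at exactly one point, where they cross. Let $P=\{p_0,\dots,p_{n-1}\}$ ($n\ge 3$) be a set of points in $\mathbb{R}^2$ and $\mathcal{L}$ an arrangement of $\binom n2$ pseudo-lines such that every pair of points $p_i,p_j$ lies on exactly one pseudo-line of $\mathcal{L}$, denoted $L_{i,j}$, and every pseudo-line in $\mathcal{L}$ contains exactly two points of $P$; $(P,\mathcal{L})$ is a pseudo configuration of points in general position. The subsegment of $L_{i,j}$ connecting $p_i$ and $p_j$ is the segment $p_ip_j$; removing it leaves two rays, one starting at $p_i$ and moving away from $p_j$, the other starting at $p_j$ and moving away from $p_i$. Indices are modulo $n$. Let $e_i$ be the segment $p_ip_{i+1}$. The segments $e_0,\dots,e_{n-1}$ form a pseudo-polygon (with boundary edges $e_i$) if $e_i\cap e_{i+1}=\{p_{i+1}\}$ for all $i$ and non-consecutive $e_i,e_j$ are disjoint. Vertices are indexed in counterclockwise order along the boundary. The pseudo-polygon separates the plane into an inside and an outside; two vertices $p_i,p_j$ see each other if the segment $p_ip_j$ does not go outside the pseudo-polygon. **Combinatorial notions.** $\partial(p_i,p_j)$ denotes the vertices and boundary edges encountered when walking counterclockwise along the boundary from $p_i$ to $p_j$ (inclusive). Two vertices that see each other form a visible pair $\{p_i,p_j\}$ (unordered). If distinct $p_i,p_j$ do not see each other, both ordered pairs $(p_i,p_j)$ and $(p_j,p_i)$ are called invisible pairs. **Designated blocker.** Let $(p_i,p_j)$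 be an invisible pair. A vertex $p_k\in\partial(p_i,p_j)$ is a designated blocker for $(p_i,p_j)$ if $p_i$ sees $p_k$ and the ray of $L_{i,k}$ starting at $p_k$ and moving away from $p_i$ first exits the pseudo-polygon through a boundary edge in $\partial(p_j,p_i)$. Similarly, $p_k\in\partial(p_j,p_i)$ is a designated blocker for $(p_i,p_j)$ if $p_i$ sees $p_k$ and the ray of $L_{i,k}$ starting at $p_k$ and moving away from $p_i$ first exits the pseudo-polygon through a boundary edge in $\partial(p_i,p_j)$. (Here $k\neq i,j$.) Every invisible pair in a pseudo-polygon has exactly one designated blocker, so the assignment is well defined. Moreover, if $p_k\in\partial(p_i,p_j)$ is the designated blocker of $(p_i,p_j)$, then $p_k$ is a candidate blocker for $(p_i,p_j)$: no vertex of $\partial(p_i,p_{k-1})$ sees a vertex of $\partial(p_{k+1},p_j)$ (so the pairs $(p_j,p_s)$ in the claim are indeed invisible pairs). *)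

theory Defs
  imports "HOL-Complex_Analysis.Complex_Analysis"
begin

text \<open>
  The plane is the type of complex numbers, so that the library's winding number can express
  the orientation of the boundary. Vertices are given by \<open>p\<close> on the indices \<open>0, \<dots>, n - 1\<close>;
  index arithmetic is modulo \<open>n\<close>.
\<close>

section \<open>Arrangements of pseudo-lines\<close>

text \<open>
  A simple curve is here an embedded copy of the real line; being closed means that
  both of its ends run to infinity.
\<close>

definition pseudo_line :: "complex set \<Rightarrow> bool" where
  "pseudo_line L \<longleftrightarrow>
     (UNIV :: real set) homeomorphic L \<and> closed L \<and> \<not> connected (- L)"

text \<open>
  For pseudo-lines with a single common point, \<open>L\<close> crosses \<open>M\<close> at that point iff
  \<open>L\<close> has points on both sides of \<open>M\<close>.
\<close>

definition crosses :: "complex set \<Rightarrow> complex set \<Rightarrow> bool" where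
  "crosses L M \<longleftrightarrow> (\<exists>a\<in>L - M. \<exists>b\<in>L - M. \<not> connected_component (- M) a b)"

definition pseudo_line_arrangement :: "complex set set \<Rightarrow> bool" where
  "pseudo_line_arrangement \<L> \<longleftrightarrow>
     (\<forall>L\<in>\<L>. pseudo_line L) \<and>
     (\<forall>L\<in>\<L>. \<forall>M\<in>\<L>. L \<noteq> M \<longrightarrow> (\<exists>x. L \<inter> M = {x}) \<and> crosses L M)"

text \<open>
  The part of a pseudo-line between two of its points is the least connected subset
  containing both; the lemma below gives the description by a parametrization.
\<close>

definition subsegment :: "complex set \<Rightarrow> complex \<Rightarrow> complex \<Rightarrow> complex set" where
  "subsegment L x y = \<Inter> {C. C \<subseteq> L \<and> connected C \<and> x \<in> C \<and> y \<in> C}"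

text \<open>The ray on \<open>L\<close> that starts at \<open>y\<close> (included) and moves away from \<open>x\<close>.\<close>

definition ray :: "complex set \<Rightarrow> complex \<Rightarrow> complex \<Rightarrow> complex set" where
  "ray L x y = {z \<in> L. y \<in> subsegment L x z}"

lemma subsegment_parametrization:
  assumes "homeomorphism (UNIV :: real set) L f g" and "x \<in> L" and "y \<in> L"
  shows "subsegment L x y = f ` closed_segment (g x) (g y)"
proof
  have fg: "f (g z) = z" if "z \<in> L" for z using assms(1) that by (simp add: homeomorphism_def)
  have contf: "continuous_on UNIV f" and contg: "continuous_on L g" and im: "f ` UNIV = L"
    using assms(1) by (auto simp: homeomorphism_def)
  have gf: "g (f t) = t" for t using assms(1) by (simp add: homeomorphism_def)
  have "connected (f ` closed_segment (g x) (g y))"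
    by (rule connected_continuous_image[OF continuous_on_subset[OF contf subset_UNIV] connected_segment(1)])
  moreover have "x \<in> f ` closed_segment (g x) (g y)" "y \<in> f ` closed_segment (g x) (g y)"
    using fg[OF assms(2)] fg[OF assms(3)] imageI[OF ends_in_segment(1)] imageI[OF ends_in_segment(2)]
    by metis+
  ultimately show "subsegment L x y \<subseteq> f ` closed_segment (g x) (g y)"
    using im unfolding subsegment_def by (intro Inter_lower) auto
  show "f ` closed_segment (g x) (g y) \<subseteq> subsegment L x y"
    unfolding subsegment_def
  proof (intro Inter_greatest, clarify)
    fix C t
    assume C: "C \<subseteq> L" "connected C" "x \<in> C" "y \<in> C" and t: "t \<in> closed_segment (g x) (g y)"
    have "connected (g ` C)"
      by (rule connected_continuous_image[OF continuous_on_subset[OF contg C(1)] C(2)])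
    then have "convex (g ` C)" by (metis is_interval_connected_1 is_interval_convex_1)
    then have "closed_segment (g x) (g y) \<subseteq> g ` C"
      by (rule closed_segment_subset[OF imageI[OF C(3)] imageI[OF C(4)]])
    then have "t \<in> g ` C" using t by (rule subsetD)
    then show "f t \<in> C" using C fg by auto
  qed
qed

lemma ray_parametrization:
  assumes "homeomorphism (UNIV :: real set) L f g" and "x \<in> L" and "y \<in> L" and "g x < g y"
  shows "ray L x y = f ` {g y..}"
proof -
  have fg: "f (g z) = z" if "z \<in> L" for z using assms(1) that by (simp add: homeomorphism_def)
  have gf: "g (f t) = t" and fL: "f t \<in> L" for t
    using assms(1) by (auto simp: homeomorphism_def)
  have iff: "y \<in> subsegment L x z \<longleftrightarrow> g y \<le> g z" if zL: "z \<in> L" for z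
  proof -
    have "y \<in> subsegment L x z \<longleftrightarrow> g y \<in> closed_segment (g x) (g z)"
    proof
      assume "y \<in> subsegment L x z"
      then obtain t where "t \<in> closed_segment (g x) (g z)" "y = f t"
        unfolding subsegment_parametrization[OF assms(1,2) zL] by (rule imageE)
      then show "g y \<in> closed_segment (g x) (g z)" by (simp only: gf)
    next
      assume "g y \<in> closed_segment (g x) (g z)"
      then have "f (g y) \<in> subsegment L x z"
        unfolding subsegment_parametrization[OF assms(1,2) zL] by (rule imageI)
      then show "y \<in> subsegment L x z" by (simp only: fg[OF assms(3)])
    qed
    also have "\<dots> \<longleftrightarrow> g y \<le> g z"
      using assms(4) unfolding closed_segment_eq_real_ivl by (simp split: if_split)
    finally show ?thesis .
  qed
  show ?thesis
  proof (intro equalityI subsetI)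
    fix z assume "z \<in> ray L x y"
    then have "z \<in> L" "g y \<le> g z" unfolding ray_def using iff by blast+
    then show "z \<in> f ` {g y..}" by (intro image_eqI[of _ _ "g z"]) (simp_all only: fg atLeast_iff)
  next
    fix z assume "z \<in> f ` {g y..}"
    then obtain t where t: "g y \<le> t" "z = f t" by (elim imageE) (simp only: atLeast_iff)
    then have "z \<in> L" "g y \<le> g z" by (simp_all only: fL gf)
    then show "z \<in> ray L x y" unfolding ray_def using iff by blast
  qed
qed


section \<open>Pseudo configurations and pseudo-polygons\<close>

definition pseudo_configuration :: "nat \<Rightarrow> (nat \<Rightarrow> complex) \<Rightarrow> complex set set \<Rightarrow> bool" where
  "pseudo_configuration n p \<L> \<longleftrightarrow>
     n \<ge> 3 \<and> inj_on p {..<n} \<and>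
     pseudo_line_arrangement \<L> \<and> finite \<L> \<and> card \<L> = n choose 2 \<and>
     (\<forall>i<n. \<forall>j<n. i \<noteq> j \<longrightarrow> (\<exists>!L. L \<in> \<L> \<and> p i \<in> L \<and> p j \<in> L)) \<and>
     (\<forall>L\<in>\<L>. card (L \<inter> p ` {..<n}) = 2)"

definition line_through :: "(nat \<Rightarrow> complex) \<Rightarrow> complex set set \<Rightarrow> nat \<Rightarrow> nat \<Rightarrow> complex set" where
  "line_through p \<L> i j = (THE L. L \<in> \<L> \<and> p i \<in> L \<and> p j \<in> L)"

definition seg :: "(nat \<Rightarrow> complex) \<Rightarrow> complex set set \<Rightarrow> nat \<Rightarrow> nat \<Rightarrow> complex set" where
  "seg p \<L> i j = subsegment (line_through p \<L> i j) (p i) (p j)"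

definition bd_edge :: "nat \<Rightarrow> (nat \<Rightarrow> complex) \<Rightarrow> complex set set \<Rightarrow> nat \<Rightarrow> complex set" where
  "bd_edge n p \<L> i = seg p \<L> i (Suc i mod n)"

definition boundary :: "nat \<Rightarrow> (nat \<Rightarrow> complex) \<Rightarrow> complex set set \<Rightarrow> complex set" where
  "boundary n p \<L> = (\<Union>i<n. bd_edge n p \<L> i)"

text \<open>
  The loop \<open>g\<close> traverses the edges in the order of their indices and winds once in the
  positive sense around the inside.
\<close>

definition ccw_indexed :: "nat \<Rightarrow> (nat \<Rightarrow> complex) \<Rightarrow> complex set set \<Rightarrow> bool" where
  "ccw_indexed n p \<L> \<longleftrightarrow>
     (\<exists>g. simple_path g \<and> pathfinish g = pathstart g \<and>
        (\<forall>i<n. g (real i / real n) = p i \<and>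
               g ` {real i / real n .. real (Suc i) / real n} = bd_edge n p \<L> i) \<and>
        (\<forall>z\<in>inside (boundary n p \<L>). winding_number g z = 1))"

definition pseudo_polygon :: "nat \<Rightarrow> (nat \<Rightarrow> complex) \<Rightarrow> complex set set \<Rightarrow> bool" where
  "pseudo_polygon n p \<L> \<longleftrightarrow>
     pseudo_configuration n p \<L> \<and>
     (\<forall>i<n. bd_edge n p \<L> i \<inter> bd_edge n p \<L> (Suc i mod n) = {p (Suc i mod n)}) \<and>
     (\<forall>i<n. \<forall>j<n. i \<noteq> j \<and> j \<noteq> Suc i mod n \<and> i \<noteq> Suc j mod n \<longrightarrow>
        bd_edge n p \<L> i \<inter> bd_edge n p \<L> j = {}) \<and>
     ccw_indexed n p \<L>"


section \<open>Visibility and designated blockers\<close>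

definition visible_pair :: "nat \<Rightarrow> (nat \<Rightarrow> complex) \<Rightarrow> complex set set \<Rightarrow> nat \<Rightarrow> nat \<Rightarrow> bool" where
  "visible_pair n p \<L> i j \<longleftrightarrow>
     i < n \<and> j < n \<and> i \<noteq> j \<and> seg p \<L> i j \<inter> outside (boundary n p \<L>) = {}"

definition invisible_pair :: "nat \<Rightarrow> (nat \<Rightarrow> complex) \<Rightarrow> complex set set \<Rightarrow> nat \<Rightarrow> nat \<Rightarrow> bool" where
  "invisible_pair n p \<L> i j \<longleftrightarrow>
     i < n \<and> j < n \<and> i \<noteq> j \<and> \<not> visible_pair n p \<L> i j"

text \<open>
  Indices of the vertices and of the edges on the counterclockwise boundary walk from vertex
  \<open>i\<close> to vertex \<open>j\<close>, for \<open>i, j < n\<close>. For \<open>i = j\<close> the walk is the single vertex.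
\<close>

definition walk_verts :: "nat \<Rightarrow> nat \<Rightarrow> nat \<Rightarrow> nat set" where
  "walk_verts n i j = {(i + d) mod n | d. d \<le> (j + n - i) mod n}"

definition walk_edges :: "nat \<Rightarrow> nat \<Rightarrow> nat \<Rightarrow> nat set" where
  "walk_edges n i j = {(i + d) mod n | d. d < (j + n - i) mod n}"

text \<open>
  The ray of the pseudo-line through vertices \<open>i\<close> and \<open>k\<close> that starts at \<open>k\<close> and moves away
  from \<open>i\<close> first exits at \<open>x\<close>: up to \<open>x\<close> it avoids the outside, but up to any later point
  it does not. If the ray leaves immediately, then \<open>x = p k\<close>.
\<close>

definition first_exit ::
    "nat \<Rightarrow> (nat \<Rightarrow> complex) \<Rightarrow> complex set set \<Rightarrow> nat \<Rightarrow> nat \<Rightarrow> complex \<Rightarrow> bool" where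
  "first_exit n p \<L> i k x \<longleftrightarrow>
     (let L = line_through p \<L> i k; Out = outside (boundary n p \<L>) in
        x \<in> ray L (p i) (p k) \<and> subsegment L (p k) x \<inter> Out = {} \<and>
        (\<forall>y\<in>ray L (p i) x - {x}. subsegment L (p k) y \<inter> Out \<noteq> {}))"

definition exits_through ::
    "nat \<Rightarrow> (nat \<Rightarrow> complex) \<Rightarrow> complex set set \<Rightarrow> nat \<Rightarrow> nat \<Rightarrow> nat \<Rightarrow> bool" where
  "exits_through n p \<L> i k m \<longleftrightarrow> (\<exists>x. first_exit n p \<L> i k x \<and> x \<in> bd_edge n p \<L> m)"

definition designated_blocker ::
    "nat \<Rightarrow> (nat \<Rightarrow> complex) \<Rightarrow> complex set set \<Rightarrow> nat \<Rightarrow> nat \<Rightarrow> nat \<Rightarrow> bool" where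
  "designated_blocker n p \<L> i j k \<longleftrightarrow>
     k \<noteq> i \<and> k \<noteq> j \<and> visible_pair n p \<L> i k \<and>
     (k \<in> walk_verts n i j \<and> (\<exists>m\<in>walk_edges n j i. exits_through n p \<L> i k m) \<or>
      k \<in> walk_verts n j i \<and> (\<exists>m\<in>walk_edges n i j. exits_through n p \<L> i k m))"

text \<open>
  Meaningful for invisible pairs \<open>(i, j)\<close> of a pseudo-polygon, which have exactly one
  designated blocker.
\<close>

definition blocker :: "nat \<Rightarrow> (nat \<Rightarrow> complex) \<Rightarrow> complex set set \<Rightarrow> nat \<Rightarrow> nat \<Rightarrow> nat" where
  "blocker n p \<L> i j = (THE k. designated_blocker n p \<L> i j k)"

definition assigned ::
    "nat \<Rightarrow> (nat \<Rightarrow> complex) \<Rightarrow> complex set set \<Rightarrow> nat \<Rightarrow> nat \<Rightarrow> nat \<Rightarrow> bool" where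
  "assigned n p \<L> i j k \<longleftrightarrow> invisible_pair n p \<L> i j \<and> blocker n p \<L> i j = k"

end

theory Submission
  imports Defs
begin

text \<open>
  The boundary of the pseudo-polygon is a Jordan curve. A visible segment, and the part of a
  ray behind a visible vertex up to its first exit, are chords of the closed inside, and by
  Janiszewski's theorem two chords meet as soon as their end points interleave on the boundary.
  Two pseudo-lines meet only once, so chords on two lines through a common vertex never
  interleave, and of the chords on two lines with four distinct vertices at most one pair does.
  Uniqueness of designated blockers and all parts of both cases follow from these two
  restrictions on the cyclic order alone, once every invisible pair is known to have a blocker.

  For the existence let \<open>k\<close> be the last vertex before \<open>j\<close> that \<open>i\<close> sees. If \<open>k\<close> is not a
  blocker, then the ray through \<open>k\<close> ends on an edge between \<open>k\<close> and \<open>j\<close>, or it is cut off at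
  \<open>k\<close>; in both cases consider the pseudo-triangle spanned by \<open>i\<close>, the end \<open>X\<close> of the ray, and the
  next vertex \<open>d\<close> on the boundary. Among the vertices inside this triangle take the one whose
  ray from \<open>i\<close> meets the side from \<open>X\<close> to \<open>d\<close> closest to \<open>X\<close>. The triangle that it cuts off is
  free of vertices, hence lies in the polygon; so \<open>i\<close> sees this vertex, which is a blocker because
  its ray exits through the edge containing \<open>X\<close> and \<open>d\<close>.
\<close>

section \<open>Separation on the boundary cycle and the combinatorial core\<close>

text \<open>Pseudo-lines have neither slopes nor angles, so every order must come from points on one
  line or on the boundary. Hence vertices in the pseudo-triangle are compared by where their rays
  from \<open>i\<close> hit the side opposite to \<open>i\<close>: two lines through
  \<open>p i\<close> have no second common point, so different rays have different hits, and a
  vertex inside the smaller triangle would be hit closer to \<open>X\<close>. That an empty triangle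
  lies in the polygon has a similar reason: a boundary edge entering it could touch only the side
  from \<open>p i\<close> to the hit, would do so twice, and would then lie on the line of that
  side, which does not enter. This leaves a local question at the corner \<open>X\<close>, namely
  which side of the wall is the inner one. Two degenerate situations shape the definitions: a ray
  may leave the polygon at its very start, and then has no chord; a visible segment may be a
  boundary edge, and then does not run through the inside. The existence of blockers also feeds the
  combinatorial core: it supplies blockers for \<open>(j, i)\<close> and \<open>(j, k)\<close>, and
  the two restrictions on chords then determine their positions.\<close>

text \<open>
  Positions on the boundary are numbered in the order of the walk: \<open>2 * v\<close> is vertex \<open>v\<close>, and
  \<open>2 * m + 1\<close> is the edge \<open>m\<close>. That \<open>{a, b}\<close> and \<open>{c, d}\<close> interleave does not depend on the starting
  point and the direction of the numbering, so both parts of the theorem become the same statement.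
\<close>

definition sep :: "'a::linorder \<Rightarrow> 'a \<Rightarrow> 'a \<Rightarrow> 'a \<Rightarrow> bool" where
  "sep a b c d \<longleftrightarrow> distinct [a, b, c, d] \<and>
     (a < c \<and> c < b \<or> b < c \<and> c < a) \<noteq> (a < d \<and> d < b \<or> b < d \<and> d < a)"

text \<open>Cuts the line open at \<open>o'\<close>: the points below \<open>o'\<close> are moved above all others.\<close>

definition cut :: "real \<Rightarrow> real \<Rightarrow> real" where
  "cut o' v = (if v < o' then 1 / (o' - v) else - 1 / (1 + v - o'))"

text \<open>Both branches of \<open>cut\<close> increase with \<open>v\<close>; the first takes
  positive values, the second negative ones, with minimum -1 at the cutting point.\<close>

lemma cut_less_iff: "cut u a < cut u b \<longleftrightarrow> (if a < u then b < u \<and> a < b else b < u \<or> a < b)"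
proof -
  have "0 < cut u v" if "v < u" for v using that by (simp add: cut_def)
  moreover have "cut u v < 0" if "\<not> v < u" for v using that by (simp add: cut_def field_simps)
  moreover have "cut u a < cut u b \<longleftrightarrow> a < b" if "a < u" "b < u"
    using that by (auto simp: cut_def frac_less2 divide_less_cancel field_simps)
  moreover have "cut u a < cut u b \<longleftrightarrow> a < b" if "\<not> a < u" "\<not> b < u"
    using that by (auto simp: cut_def field_simps)
  ultimately show ?thesis by (smt (verit))
qed

text \<open>Moving an initial stretch of the order to its end is a rotation of the cycle, which
  preserves interleaving. The case split is on which arguments are moved.\<close>

lemma sep_of_order:
  assumes "inj f" and "\<And>a b. f a < f b \<longleftrightarrow> (if a < u then b < u \<and> a < b else b < u \<or> a < b)"
  shows "sep (f a) (f b) (f c) (f d) \<longleftrightarrow> sep (a :: real) b c d"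
  unfolding sep_def assms(2) using \<open>inj f\<close>[THEN injD]
  apply (cases "a < u"; cases "b < u"; cases "c < u"; cases "d < u"; simp add: inj_eq[OF \<open>inj f\<close>])
  by (smt (verit))+

lemma inj_cut: "inj (cut u)"
  by (rule injI) (metis cut_less_iff linorder_neqE less_irrefl)

lemma sep_uminus: "sep (- a) (- b) (- c) (- d) \<longleftrightarrow> sep (a :: real) b c d"
  unfolding sep_def by auto

lemma sep_of_nat: "sep (real a) (real b) (real c) (real d) \<longleftrightarrow> sep a b c d"
  unfolding sep_def by simp

text \<open>Rotation puts \<open>i\<close> first; interleaving then leaves the orders
  \<open>i, k, j, x\<close> and \<open>i, x, j, k\<close>, and a reflection turns the second into
  the first. Here the two orientations of the boundary merge into one.\<close>

lemma sep_linearize: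
  fixes i j k x :: nat
  assumes "sep i j k x"
  obtains (that') f :: "nat \<Rightarrow> real" where "inj f" "\<And>a b c d. sep a b c d \<longleftrightarrow> sep (f a) (f b) (f c) (f d)"
    "\<And>v. f i \<le> f v" "f i < f k" "f k < f j" "f j < f x"
proof -
  \<comment> \<open>\<open>r\<close> will be the inclusion of the naturals into the reals, or its
    negative.\<close>
  have *: thesis if r: "inj r" "\<And>a b c d. sep a b c d \<longleftrightarrow> sep (r a) (r b) (r c) (r d)"
    and "cut (r i) (r k) < cut (r i) (r j)" for r :: "nat \<Rightarrow> real"
  proof -
    let ?f = "\<lambda>v. cut (r i) (r v)"
    have 1: "inj ?f" using r(1) inj_cut by (metis (mono_tags) inj_def)
    have 2: "sep a b c d \<longleftrightarrow> sep (?f a) (?f b) (?f c) (?f d)" for a b c d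
      using r(2) sep_of_order[OF inj_cut cut_less_iff] by blast
    have 3: "?f i \<le> ?f v" for v using cut_less_iff[of "r i" "r v" "r i"] by (auto simp: not_less split: if_splits)
    have "sep (?f i) (?f j) (?f k) (?f x)" using assms 2 by blast
    then have "?f i < ?f k" "?f j < ?f x"
      using 3[of k] 3[of x] 3[of j] that(3) unfolding sep_def by auto
    then show thesis using that'[of ?f] 1 2 3 that(3) by blast
  qed
  have "j \<noteq> k" "i \<noteq> j" "i \<noteq> k" using assms by (auto simp: sep_def)
  show thesis
  proof (cases "cut (real i) (real k) < cut (real i) (real j)")
    case True
    then show ?thesis by (intro *[of real]) (auto simp: inj_def sep_of_nat)
  next
    case False
    then have "cut (- real i) (- real k) < cut (- real i) (- real j)"
      using \<open>j \<noteq> k\<close> \<open>i \<noteq> j\<close> \<open>i \<noteq> k\<close> unfolding cut_less_iff by (auto split: if_splits)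
    then show ?thesis by (intro *[of "\<lambda>v. - real v"]) (auto simp: inj_def sep_of_nat sep_uminus)
  qed
qed

text \<open>
  The chords on the line through \<open>i\<close> and \<open>k\<close>, given by the positions of their end points;
  \<open>ext i k x\<close> says that the ray behind \<open>k\<close> seen from \<open>i\<close> has its first exit at \<open>x\<close>, away from \<open>k\<close>.
\<close>

inductive piece :: "(nat \<Rightarrow> nat \<Rightarrow> bool) \<Rightarrow> (nat \<Rightarrow> nat \<Rightarrow> nat \<Rightarrow> bool) \<Rightarrow> nat \<Rightarrow> nat \<Rightarrow> nat \<Rightarrow> nat \<Rightarrow> bool"
  for vis ext where
  seg: "vis i k \<Longrightarrow> piece vis ext i k (2 * i) (2 * k)"
| ahead: "ext i k x \<Longrightarrow> piece vis ext i k (2 * k) x"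
| behind: "ext k i z \<Longrightarrow> piece vis ext i k (2 * i) z"

text \<open>All that the combinatorial core uses of the polygon. In \<open>pieces_cross_once\<close>
  each interleaving pair contains the common point of the two lines; distinct pieces of one line
  share at most vertices, so the two pairs coincide. An exit is \<open>odd\<close> because it lies
  in the interior of an edge.\<close>

locale visibility =
  fixes n :: nat and vis :: "nat \<Rightarrow> nat \<Rightarrow> bool" and ext :: "nat \<Rightarrow> nat \<Rightarrow> nat \<Rightarrow> bool"
  assumes vis_sym: "vis i k \<Longrightarrow> vis k i"
    and vis_less: "vis i k \<Longrightarrow> i < n \<and> k < n \<and> i \<noteq> k"
    and ext_vis: "ext i k x \<Longrightarrow> vis i k"
    and ext_odd: "ext i k x \<Longrightarrow> odd x"
    and pieces_at_vertex: "\<lbrakk>piece vis ext i k a b; piece vis ext i l c d; k \<noteq> l\<rbrakk> \<Longrightarrow> \<not> sep a b c d"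
    and pieces_cross_once:
      "\<lbrakk>piece vis ext i k a b; piece vis ext i k a' b'; piece vis ext j l c d; piece vis ext j l c' d';
        distinct [i, k, j, l]; sep a b c d; sep a' b' c' d'\<rbrakk> \<Longrightarrow> {a, b} = {a', b'} \<and> {c, d} = {c', d'}"
    and both_exits: "\<lbrakk>ext i k x; ext k i z\<rbrakk> \<Longrightarrow> x \<noteq> z \<and> \<not> sep (2 * k) x (2 * i) z"
    and blocker_exists: "\<lbrakk>i < n; j < n; i \<noteq> j; \<not> vis i j\<rbrakk> \<Longrightarrow>
      \<exists>k x. ext i k x \<and> sep (2 * i) (2 * j) (2 * k) x"
begin

abbreviation "pc \<equiv> piece vis ext"

lemmas pc_seg = piece.seg[of vis _ _ ext]
lemmas pc_ahead = piece.ahead[of ext _ _ _ vis]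
lemmas pc_behind = piece.behind[of ext _ _ _ vis]

definition blk :: "nat \<Rightarrow> nat \<Rightarrow> nat \<Rightarrow> bool" where
  "blk i j k \<longleftrightarrow> j < n \<and> \<not> vis i j \<and> (\<exists>x. ext i k x \<and> sep (2 * i) (2 * j) (2 * k) x)"

lemma ext_neq: "ext i k x \<Longrightarrow> x \<noteq> 2 * v"
  using ext_odd[of i k x] by auto

text \<open>After cutting at \<open>i\<close>, \<open>K < J < X\<close>, and the segment to
  \<open>K'\<close> forbids \<open>K < K' < X\<close>. If \<open>K' < K\<close>, then
  \<open>X' > J\<close>; if \<open>K' > X\<close>, then \<open>X' < J\<close>. Both times the ray
  behind \<open>K'\<close> interleaves with the segment to \<open>K\<close> or with the ray behind
  \<open>K\<close>.\<close>

lemma blk_unique: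
  assumes "blk i j k" "blk i j k'"
  shows "k = k'"
proof (rule ccontr)
  assume ne: "k \<noteq> k'"
  from assms obtain x x' where e: "ext i k x" "sep (2 * i) (2 * j) (2 * k) x"
    and e': "ext i k' x'" "sep (2 * i) (2 * j) (2 * k') x'"
    unfolding blk_def by blast
  obtain f where f: "inj f" "\<And>a b c d. sep a b c d \<longleftrightarrow> sep (f a) (f b) (f c) (f d :: real)"
    "\<And>v. f (2 * i) \<le> f v" "f (2 * i) < f (2 * k)" "f (2 * k) < f (2 * j)" "f (2 * j) < f x"
    using sep_linearize[OF e(2)] by metis
  define I J K K' X X' where d: "I = f (2 * i)" "J = f (2 * j)" "K = f (2 * k)" "K' = f (2 * k')" "X = f x" "X' = f x'"
  have "\<not> sep I K' K X"
    using pieces_at_vertex[of i k' "2 * i" "2 * k'" k "2 * k" x] ext_vis e e' ne f(2) pc_seg pc_ahead d by metis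
  moreover have "\<not> sep I K K' X'"
    using pieces_at_vertex[of i k "2 * i" "2 * k" k' "2 * k'" x'] ext_vis e e' ne f(2) pc_seg pc_ahead d by metis
  moreover have "\<not> sep K X K' X'"
    using pieces_at_vertex[of i k "2 * k" x k' "2 * k'" x'] pc_ahead e e' ne f(2) d by metis
  moreover have "I < K" "K < J" "J < X" "I < K'" "I < X'" "sep I J K' X'" "K \<noteq> K'" "X \<noteq> K'" "X' \<noteq> K"
    using f(3-6)[folded d] e'(2) ne ext_neq[OF e(1)] ext_neq[OF e'(1)]
    by (auto simp: f(2) d inj_eq[OF f(1)] sep_def less_le)
  ultimately show False
    unfolding sep_def by simp (smt (verit))
qed

end

text \<open>The map \<open>f\<close> cuts the boundary open at \<open>i\<close>, directed such that \<open>i < k < j < x\<close>.\<close>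

locale blocked_pair = visibility +
  fixes i j k x :: nat and f :: "nat \<Rightarrow> real"
  assumes not_vis: "\<not> vis i j" and j_less: "j < n" and exit: "ext i k x"
    and inj: "inj f" and sep_f: "\<And>a b c d. sep a b c d \<longleftrightarrow> sep (f a) (f b) (f c) (f d)"
    and least: "\<And>v. f (2 * i) \<le> f v"
    and order: "f (2 * i) < f (2 * k)" "f (2 * k) < f (2 * j)" "f (2 * j) < f x"
begin

abbreviation "P v \<equiv> f (2 * v)"

lemma P_eq: "P u = P v \<longleftrightarrow> u = v"
  using inj by (auto simp: inj_eq)

lemma P_neq: "ext a b y \<Longrightarrow> f y \<noteq> P v"
  using inj ext_neq by (auto simp: inj_eq)

lemma vis_ik: "vis i k" using exit ext_vis by blast

lemma neqs: "i \<noteq> j" "i \<noteq> k" "j \<noteq> k" "i < n" "k < n"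
  using order vis_ik vis_less by auto

lemma chords_at_vertex: "\<lbrakk>pc u v a b; pc u w c d; v \<noteq> w\<rbrakk> \<Longrightarrow> \<not> sep (f a) (f b) (f c) (f d)"
  using pieces_at_vertex sep_f by blast

lemma chords_cross_once: 
  assumes "pc u v a b" "pc u v a' b'" "pc u' v' c d" "pc u' v' c' d'"
        "distinct [u, v, u', v']" "sep (f a) (f b) (f c) (f d)" "sep (f a') (f b') (f c') (f d')"
  shows "{f a, f b} = {f a', f b'}" "{f c, f d} = {f c', f d'}"
proof -
  have "{a, b} = {a', b'} \<and> {c, d} = {c', d'}"
    using pieces_cross_once[OF assms(1-5)] assms(6,7) by (simp add: sep_f)
  then have "f ` {a, b} = f ` {a', b'}" "f ` {c, d} = f ` {c', d'}" by simp_all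
  then show "{f a, f b} = {f a', f b'}" "{f c, f d} = {f c', f d'}" by simp_all
qed

text \<open>Such a segment would interleave with the segment from \<open>i\<close> to
  \<open>k\<close> and with the ray behind \<open>k\<close>, two different pieces of one line, so
  the lines would meet twice.\<close>

lemma no_vis_across: 
  assumes "P i < P s" "P s < P k"
  shows "\<not> vis j s"
proof
  assume v: "vis j s"
  have ne: "distinct [i, k, j, s]" using assms neqs order by (auto simp: P_eq)
  have "sep (P i) (P k) (P j) (P s)" "sep (P k) (f x) (P j) (P s)"
    using order assms by (auto simp: sep_def)
  then have "{P i, P k} = {P k, f x}"
    using chords_cross_once(1)[OF pc_seg[OF vis_ik] pc_ahead[OF exit] pc_seg[OF v] pc_seg[OF v] ne] by blast
  then show False using order by (auto simp: doubleton_eq_iff)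
qed

lemma blk_iff: "blk u v w \<longleftrightarrow> v < n \<and> \<not> vis u v \<and> (\<exists>y. ext u w y \<and> sep (P u) (P v) (P w) (f y))"
  unfolding blk_def sep_f ..

lemma vis_least: "v \<noteq> i \<Longrightarrow> P i < P v" 
  using least[of "2 * v"] by (auto simp: less_le P_eq)

lemma exit_least: "ext a b y \<Longrightarrow> P i < f y" 
  using least[of y] P_neq[of a b y i] by (auto simp: less_le)

text \<open>The exit comes from \<open>blocker_exists\<close> for \<open>(j, i)\<close>: the blocker
  \<open>b\<close> can only be \<open>k\<close>. Between \<open>i\<close> and \<open>k\<close> it is
  excluded by \<open>no_vis_across\<close>; elsewhere its ray would interleave with the segment from
  \<open>j\<close> to \<open>k\<close>, or its line would meet the line through \<open>i\<close> and
  \<open>k\<close> on both sides of \<open>k\<close>.\<close>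

lemma exit_past_visible:
  assumes vjk: "vis j k"
  obtains y where "ext j k y" "P j < f y"
proof -
  have "\<not> vis j i" using not_vis vis_sym by blast
  then obtain b y where b: "ext j b y" "sep (P j) (P i) (P b) (f y)"
    using blocker_exists[of j i] neqs j_less sep_f by metis
  have vb: "vis j b" using b ext_vis by blast
  note B = P_neq[OF b(1)] exit_least[OF b(1)] P_neq[OF exit]
  have "b = k"
  proof (rule ccontr)
    assume ne: "b \<noteq> k"
    have "b \<noteq> i" "b \<noteq> j" using b(2) by (auto simp: sep_def)
    then have Pb: "P i < P b" "P b \<noteq> P j" "P b \<noteq> P k" using ne by (auto simp: P_eq vis_least)
    have d: "distinct [i, k, j, b]" using \<open>b \<noteq> i\<close> \<open>b \<noteq> j\<close> ne neqs by auto
    have 1: "\<not> (P i < P b \<and> P b < P k)" using no_vis_across vb by blast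
    have 2: "\<not> sep (P j) (P k) (P b) (f y)"
      using chords_at_vertex[OF pc_seg[OF vjk] pc_ahead[OF b(1)]] ne by blast
    have "\<not> (sep (P k) (f x) (P j) (P b) \<and> sep (P i) (P k) (P b) (f y))"
      using chords_cross_once(1)[OF pc_ahead[OF exit] pc_seg[OF vis_ik] pc_seg[OF vb] pc_ahead[OF b(1)] d] order by (auto simp: doubleton_eq_iff)
    moreover have "\<not> (sep (P k) (f x) (P b) (f y) \<and> sep (P i) (P k) (P b) (f y))"
      using chords_cross_once(1)[OF pc_ahead[OF exit] pc_seg[OF vis_ik] pc_ahead[OF b(1)] pc_ahead[OF b(1)] d] order by (auto simp: doubleton_eq_iff)
    ultimately have cr: "\<not> ((sep (P k) (f x) (P j) (P b) \<or> sep (P k) (f x) (P b) (f y)) \<and> sep (P i) (P k) (P b) (f y))"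
      by blast
    consider "P k < P b" "P b < P j" "P j < f y" | "P j < P b" "P k < f y" "f y < P j"
      | "P j < P b" "f y < P k"
      using 1 b(2) Pb order B(1)[of k] B(2) by (fastforce simp: sep_def)
    then show False
    proof cases
      case 3
      then have "sep (P i) (P k) (P b) (f y)" using order B(2) by (auto simp: sep_def)
      moreover have "sep (P k) (f x) (P j) (P b) \<or> sep (P k) (f x) (P b) (f y)"
        using 3 order B(3)[of b] by (auto simp: sep_def)
      ultimately show ?thesis using cr by blast
    qed (use 2 order in \<open>auto simp: sep_def\<close>)
  qed
  moreover have "P j < f y" using b(2) \<open>b = k\<close> order B(2) B(1)[of j] by (auto simp: sep_def)
  ultimately show thesis using b that by blast
qed

text \<open>Either \<open>t\<close> lies in the pocket cut off by the segment from \<open>i\<close> to \<open>k\<close>, or the ray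
  from \<open>k\<close> through \<open>i\<close> separates \<open>t\<close> from \<open>j\<close>.\<close>

lemma blocked_by_i:
  assumes "blk k t i"
  obtains "P i < P t" "P t < P k"
  | z where "ext k i z" "f x < f z" "f z < P t" "\<not> vis j t" "t \<noteq> j"
proof -
  obtain z where z: "ext k i z" "sep (P k) (P t) (P i) (f z)" 
    using assms unfolding blk_iff by blast
  have "f x \<noteq> f z" "\<not> sep (P k) (f x) (P i) (f z)"
    using both_exits[OF exit z(1)] inj sep_f by (auto simp: inj_eq)
  moreover have "P i < P t" "P t \<noteq> P k" using z(2) least[of "2 * t"] by (auto simp: sep_def less_le P_eq)
  ultimately consider "P t < P k" | "f x < f z" "f z < P t" 
    using z(2) order exit_least[OF z(1)] exit_least[OF exit] P_neq[OF z(1), of k]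
    unfolding sep_def by simp (smt (verit))
  then show thesis
  proof cases
    case 1
    then show thesis using that(1) \<open>P i < P t\<close> by blast
  next
    case 2
    have "\<not> vis j t"
    proof
      assume v: "vis j t"
      have d: "distinct [i, k, j, t]" using 2 order neqs by (auto simp: P_eq)
      have "sep (P k) (f x) (P j) (P t)" "sep (P i) (f z) (P j) (P t)"
        using 2 order by (auto simp: sep_def)
      then have "{P k, f x} = {P i, f z}"
        using chords_cross_once(1)[OF pc_ahead[OF exit] pc_behind[OF z(1)] pc_seg[OF v] pc_seg[OF v] d] by blast
      then show False using 2 order by (auto simp: doubleton_eq_iff)
    qed
    moreover have "t \<noteq> j" using 2 order by auto
    ultimately show thesis using that(2) z(1) 2 by blast
  qed
qed

lemma case_visible:
  assumes vjk: "vis j k"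
  shows "P i \<le> P s \<Longrightarrow> P s < P k \<Longrightarrow> s < n \<Longrightarrow> blk j s k"
    and "blk k t i \<Longrightarrow> blk j t k"
proof -
  obtain y where y: "ext j k y" "P j < f y" using exit_past_visible[OF vjk] .
  show *: "blk j s k" if "P i \<le> P s" "P s < P k" "s < n" for s
  proof -
    have "sep (P j) (P s) (P k) (f y)" using y that order by (auto simp: sep_def)
    moreover have "\<not> vis j s" using no_vis_across[of s] that not_vis vis_sym[of j i]
      by (cases "s = i") (auto simp: vis_least)
    ultimately show ?thesis using y that unfolding blk_iff by blast
  qed
  assume t: "blk k t i"
  then have tn: "t < n" "t \<noteq> i" by (auto simp: blk_def sep_def)
  from t show "blk j t k"
  proof (cases rule: blocked_by_i)
    case 1
    then show ?thesis using * tn by auto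
  next
    case (2 z)
    \<comment> \<open>Both rays lie on lines through \<open>k\<close>. As \<open>z\<close> comes
      after \<open>x\<close>, this forces \<open>f y \<le> f z < P t\<close>.\<close>
    have "\<not> sep (P k) (f y) (P i) (f z)"
      using chords_at_vertex[OF pc_behind[OF y(1)] pc_ahead[OF 2(1)]] neqs by blast
    then have "f y < P t" using 2 order y P_neq[OF y(1), of t]
      unfolding sep_def by simp (smt (verit))
    then have "sep (P j) (P t) (P k) (f y)" using 2 order y by (auto simp: sep_def)
    then show ?thesis using y 2 tn unfolding blk_iff by blast
  qed
qed

text \<open>Only two positions of \<open>q\<close> and its exit \<open>y\<close> survive, collected
  in \<open>alt\<close>: \<open>q\<close> between \<open>k\<close> and \<open>j\<close> with
  \<open>y\<close> after \<open>j\<close>, or \<open>q\<close> between \<open>j\<close> and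
  \<open>x\<close> with \<open>y\<close> between \<open>k\<close> and \<open>j\<close>. The others
  allowed by \<open>sep\<close> would make two lines meet twice.\<close>

lemma case_invisible:
  assumes "\<not> vis j k"
  obtains q where "blk j k q" "blk i q k"
    "\<And>s. P i \<le> P s \<Longrightarrow> P s \<le> P k \<Longrightarrow> s < n \<Longrightarrow> blk j s q"
    "\<And>t. blk k t i \<Longrightarrow> blk j t q"
proof -
  obtain q y where q: "ext j q y" "sep (P j) (P k) (P q) (f y)"
    using blocker_exists[of j k] neqs j_less sep_f assms by metis
  have bq: "blk j k q" using q assms neqs unfolding blk_iff by blast
  have v: "vis j q" using q ext_vis by blast
  have "q \<noteq> i" using v not_vis vis_sym by blast
  have "q \<noteq> j" "q \<noteq> k" using q by (auto simp: sep_def)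
  then have d: "distinct [i, k, j, q]" using neqs \<open>q \<noteq> i\<close> by auto
  have Pq: "P i < P q" "P q \<noteq> P k" "P q \<noteq> P j"
    using \<open>q \<noteq> i\<close> \<open>q \<noteq> j\<close> \<open>q \<noteq> k\<close> by (auto simp: vis_least P_eq)
  have side: "\<not> P q < P k" using no_vis_across v Pq by blast
  have cr1: "\<not> (sep (P k) (f x) (P j) (P q) \<and> sep (P k) (f x) (P q) (f y))"
    using chords_cross_once(2)[OF pc_ahead[OF exit] pc_ahead[OF exit] pc_seg[OF v] pc_ahead[OF q(1)] d]
      Pq(3) P_neq[OF q(1), of j] by (metis doubleton_eq_iff)
  have cr2: "\<not> (sep (P k) (f x) (P q) (f y) \<and> sep (P i) (P k) (P q) (f y))"
    using chords_cross_once(1)[OF pc_ahead[OF exit] pc_seg[OF vis_ik] pc_ahead[OF q(1)] pc_ahead[OF q(1)] d] order by (auto simp: doubleton_eq_iff)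
  note N = P_neq[OF q(1)] exit_least[OF q(1)] P_neq[OF exit]
  have alt: "P k < P q \<and> P q < P j \<and> P j < f y \<or> P j < P q \<and> P q < f x \<and> P k < f y \<and> f y < P j"
  proof -
    consider "P k < P q" "P q < P j" "P j < f y" | "P k < P q" "P q < P j" "f y < P k"
      | "P j < P q" "P k < f y" "f y < P j"
    proof -
      have "P k < P q" using side Pq by auto
      then have "P q < P j \<and> (f y < P k \<or> P j < f y) \<or> P j < P q \<and> P k < f y \<and> f y < P j"
        using q(2) order unfolding sep_def by simp (smt (verit))
      then show ?thesis using that \<open>P k < P q\<close> by blast
    qed
    then show ?thesis
    proof cases
      case 2
      then have "sep (P k) (f x) (P q) (f y)" "sep (P i) (P k) (P q) (f y)"
        using order N(2) by (auto simp: sep_def)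
      then show ?thesis using cr2 by blast
    next
      case 3
      then have "\<not> f x < P q" using cr1 order by (auto simp: sep_def)
      then show ?thesis using 3 N(3)[of q] by auto
    qed auto
  qed
  \<comment> \<open>In both alternatives \<open>q\<close> lies between \<open>k\<close> and
    \<open>x\<close>, so the ray behind \<open>k\<close> hides it from \<open>i\<close>.\<close>
  then have s4: "sep (P i) (P q) (P k) (f x)" using order by (auto simp: sep_def)
  have "\<not> vis i q"
    using chords_at_vertex[OF pc_seg pc_ahead[OF exit]] s4 \<open>q \<noteq> k\<close> by blast
  then have bi: "blk i q k" using exit s4 v vis_less unfolding blk_iff by blast
  have bs: "blk j s q" if s: "P i \<le> P s" "P s \<le> P k" "s < n" for s
  proof -
    have "sep (P j) (P s) (P q) (f y)" using alt s order by (auto simp: sep_def)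
    moreover have "\<not> vis j s" using no_vis_across[of s] s not_vis vis_sym[of j i] assms
      by (cases "s = i"; cases "s = k") (auto simp: vis_least less_le P_eq)
    ultimately show ?thesis using q s unfolding blk_iff by blast
  qed
  have "blk j t q" if t: "blk k t i" for t
  proof -
    have tn: "t < n" "t \<noteq> i" using t by (auto simp: blk_def sep_def)
    from t show ?thesis
    proof (cases rule: blocked_by_i)
      case 1
      then show ?thesis using bs tn by auto
    next
      case (2 z)
      \<comment> \<open>This settles the first alternative: an exit \<open>y\<close> after
        \<open>t\<close> would also come after \<open>x\<close> and \<open>z\<close>, and the ray
        behind \<open>q\<close> would meet both rays of the line through \<open>i\<close> and
        \<open>k\<close>.\<close>
      have "\<not> (sep (P k) (f x) (P q) (f y) \<and> sep (P i) (f z) (P q) (f y))"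
        using chords_cross_once(1)[OF pc_ahead[OF exit] pc_behind[OF 2(1)] pc_ahead[OF q(1)] pc_ahead[OF q(1)] d]
          order 2 by (auto simp: doubleton_eq_iff)
      then have "sep (P j) (P t) (P q) (f y)" using alt 2 order N(1)[of t] 
        unfolding sep_def by simp (smt (verit))
      then show ?thesis using q 2 tn unfolding blk_iff by blast
    qed
  qed
  then show thesis using that bq bi bs by blast
qed

end

section \<open>Jordan curves and arcs\<close>

definition jordan :: "complex set \<Rightarrow> bool" where
  "jordan J \<longleftrightarrow> (\<exists>c. simple_path c \<and> pathfinish c = pathstart c \<and> path_image c = J)"

lemma jordanD:
  assumes "jordan J"
  shows "compact J" "closed J" "inside J \<noteq> {}" "open (inside J)" "connected (inside J)" "open (outside J)"
    "connected (outside J)" "bounded (inside J)" "\<not> bounded (outside J)"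
    "inside J \<inter> outside J = {}" "inside J \<union> outside J = - J"
    "closure (inside J) = inside J \<union> J" "closure (outside J) = outside J \<union> J"
proof -
  obtain c where c: "simple_path c" "pathfinish c = pathstart c" "path_image c = J"
    using assms unfolding jordan_def by blast
  note * = Jordan_inside_outside[OF c(1,2), unfolded c(3)]
  show "compact J" using c compact_simple_path_image by blast
  then show "closed J" by (rule compact_imp_closed)
  show "inside J \<noteq> {}" "open (inside J)" "connected (inside J)" "open (outside J)"
    "connected (outside J)" "bounded (inside J)" "\<not> bounded (outside J)"
    "inside J \<inter> outside J = {}" "inside J \<union> outside J = - J"
    using * by blast+
  show "closure (inside J) = inside J \<union> J" "closure (outside J) = outside J \<union> J"
    using * by (metis closure_Un_frontier)+
qed

lemma inside_or_outside:
  assumes "jordan J" "connected C" "C \<inter> J = {}"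
  shows "C \<subseteq> inside J \<or> C \<subseteq> outside J"
  using connectedD[OF assms(2), of "inside J" "outside J"] jordanD(4,6,10,11)[OF assms(1)] assms(3) by blast

lemma unbounded_outside:
  assumes "jordan J" "connected C" "C \<inter> J = {}" "\<not> bounded C"
  shows "C \<subseteq> outside J"
  using inside_or_outside[OF assms(1-3)] jordanD(8)[OF assms(1)] assms(4) bounded_subset by blast

lemma meets_near_closure:
  "\<lbrakk>x \<in> closure S; open U; x \<in> U\<rbrakk> \<Longrightarrow> S \<inter> U \<noteq> {}"
  using open_Int_closure_eq_empty[of U S] by blast

text \<open>The outside of \<open>J\<close> is connected, unbounded and misses \<open>K\<close>, so
  it lies outside \<open>K\<close>. Every point of \<open>J\<close> is a limit of it and hence
  cannot be inside \<open>K\<close>.\<close>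

lemma jordan_nest:
  assumes J: "jordan J" and K: "jordan K" and sub: "K \<subseteq> J \<union> inside J"
  shows "outside J \<subseteq> outside K" "J - K \<subseteq> outside K" "inside K \<subseteq> inside J"
proof -
  show 1: "outside J \<subseteq> outside K"
  proof (rule unbounded_outside[OF K])
    show "outside J \<inter> K = {}" using sub jordanD(10,11)[OF J] by blast
  qed (use jordanD[OF J] in blast)+
  show 2: "J - K \<subseteq> outside K"
  proof
    fix x assume x: "x \<in> J - K"
    have "x \<notin> inside K"
    proof
      assume "x \<in> inside K"
      then have "outside J \<inter> inside K \<noteq> {}"
        using x jordanD(4)[OF K] jordanD(13)[OF J] by (intro meets_near_closure[of x]) auto
      then show False using 1 jordanD(10)[OF K] by blast
    qed
    then show "x \<in> outside K" using x jordanD(11)[OF K] by blast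
  qed
  show "inside K \<subseteq> inside J"
    using 1 2 jordanD(10,11)[OF J] jordanD(10,11)[OF K] by blast
qed

lemma connected_component_inside:
  assumes "jordan J" "a \<in> inside J" "b \<in> inside J" shows "connected_component (- J) a b"
  using assms jordanD[OF assms(1)] unfolding connected_component_def by (metis Un_upper1)

lemma connected_component_outside:
  assumes "jordan J" "a \<in> outside J" "b \<in> outside J" shows "connected_component (- J) a b"
  using assms jordanD[OF assms(1)] unfolding connected_component_def by (metis Un_upper2)

lemma not_connected_component_inside_outside:
  assumes "jordan J" "a \<in> inside J" "b \<in> outside J" shows "\<not> connected_component (- J) a b"
  using inside_or_outside[OF assms(1)] assms jordanD(10)[OF assms(1)] unfolding connected_component_def
  by blast

text \<open>
  In the applications \<open>A\<close> is an arc and \<open>a\<close>, \<open>b\<close> are close to an inner point of it: for such points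
  only \<open>A\<close> matters.
\<close>

lemma separation_transfer:
  fixes A B C :: "complex set"
  assumes "compact A" "compact B" "closed C" "connected B" "A \<inter> C \<subseteq> B"
    and "connected_component (- (B \<union> C)) a b" "\<not> connected_component (- (A \<union> C)) a b"
  shows "\<not> connected_component (- (A \<union> B)) a b"
proof
  assume *: "connected_component (- (A \<union> B)) a b"
  have "(A \<union> B) \<inter> (B \<union> C) = B" using assms(5) by blast
  then have "connected_component (- ((A \<union> B) \<union> (B \<union> C))) a b"
    using Janiszewski[of "A \<union> B" "B \<union> C" a b] assms * by (simp add: compact_Un closed_Un compact_imp_closed)
  then have "connected_component (- (A \<union> C)) a b"
    by (rule connected_component_of_subset) blast
  then show False using assms by blast
qed

text \<open>\<open>c1\<close> and \<open>c2\<close> are the two parts into which the ends of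
  \<open>C\<close> divide \<open>J\<close>. Janiszewski's theorem applies since
  \<open>c1 \<union> C\<close> and \<open>c2 \<union> C\<close> have exactly the connected set
  \<open>C\<close> in common. If \<open>D\<close> missed \<open>C\<close>, then \<open>J\<close>
  would not separate a point of \<open>D\<close> from the outside.\<close>

lemma chord_meets:
  fixes C D :: "complex set"
  assumes J: "jordan J" "J = c1 \<union> c2" and c: "compact c1" "compact c2" "c1 \<inter> c2 \<subseteq> C"
    and C: "compact C" "connected C" "C \<subseteq> J \<union> inside J"
    and D: "connected D" "D \<subseteq> inside J" "D \<noteq> {}"
    and u: "u \<in> closure D" "u \<in> J - c2 - C" and v: "v \<in> closure D" "v \<in> J - c1 - C"
  shows "C \<inter> D \<noteq> {}"
proof
  assume CD: "C \<inter> D = {}"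
  obtain z where z: "z \<in> D" using D by blast
  obtain o' where o': "o' \<in> outside J" using jordanD(9)[OF J(1)] by (metis bounded_empty ex_in_conv)
  \<comment> \<open>From \<open>z\<close> one moves through \<open>D\<close> to its limit point
    \<open>w\<close> on \<open>J\<close>, and from \<open>w\<close> into the outside.\<close>
  have cc: "connected_component (- K) z o'"
    if K: "closed K" "K \<subseteq> J \<union> inside J" "D \<inter> K = {}" and w: "w \<in> J - K" "w \<in> closure D" for K w
  proof -
    have "connected (insert w D)"
      by (rule connected_intermediate_closure[OF D(1)]) (use w(2) closure_subset in auto)
    moreover have "insert w D \<subseteq> - K" using K w by blast
    ultimately have 1: "connected_component (- K) z w"
      using z unfolding connected_component_def by blast
    have "connected (insert w (outside J))"
      by (rule connected_intermediate_closure[OF jordanD(7)[OF J(1)]])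
        (use w(1) jordanD(13)[OF J(1)] in auto)
    moreover have "insert w (outside J) \<subseteq> - K" using K w jordanD(10,11)[OF J(1)] by blast
    ultimately have "connected_component (- K) w o'"
      using o' unfolding connected_component_def by blast
    with 1 show ?thesis by (rule connected_component_trans)
  qed
  have DJ: "D \<inter> J = {}" using D(2) jordanD(11)[OF J(1)] by blast
  \<comment> \<open>\<open>c1 \<union> C\<close> does not separate \<open>D\<close> from the outside because of \<open>v\<close>, nor does \<open>c2 \<union> C\<close> because of \<open>u\<close>.\<close>
  have "connected_component (- ((c1 \<union> C) \<union> (c2 \<union> C))) z o'"
  proof (rule Janiszewski)
    show "compact (c1 \<union> C)" "closed (c2 \<union> C)" using c C by (auto intro: compact_imp_closed)
    have "(c1 \<union> C) \<inter> (c2 \<union> C) = C" using c(3) by blast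
    then show "connected ((c1 \<union> C) \<inter> (c2 \<union> C))" using C by simp
    show "connected_component (- (c1 \<union> C)) z o'"
      using c C J(2) CD DJ v by (intro cc[of _ v]) (auto intro: compact_imp_closed)
    show "connected_component (- (c2 \<union> C)) z o'"
      using c C J(2) CD DJ u by (intro cc[of _ u]) (auto intro: compact_imp_closed)
  qed
  then have "connected_component (- J) z o'"
    by (rule connected_component_of_subset) (use J(2) in blast)
  then show False
    using not_connected_component_inside_outside[OF J(1) _ o', of z] z D(2) by blast
qed

text \<open>Formulated for sets, since chords, triangle sides and boundary parts occur under
  different parametrizations.\<close>

definition is_arc :: "complex set \<Rightarrow> complex \<Rightarrow> complex \<Rightarrow> bool" where
  "is_arc A a b \<longleftrightarrow> (\<exists>c. arc c \<and> path_image c = A \<and> pathstart c = a \<and> pathfinish c = b)"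

lemma is_arcD:
  assumes "is_arc A a b"
  shows "compact A" "connected A" "a \<in> A" "b \<in> A" "a \<noteq> b" "connected (A - {a, b})" "A - {a, b} \<noteq> {}"
    "closure (A - {a, b}) = A" "is_arc A b a"
proof -
  obtain c where c: "arc c" "path_image c = A" "pathstart c = a" "pathfinish c = b"
    using assms unfolding is_arc_def by blast
  show 1: "compact A" "connected A" using c compact_arc_image connected_arc_image by blast+
  show ab: "a \<in> A" "b \<in> A" using c pathstart_in_path_image pathfinish_in_path_image by blast+
  show "a \<noteq> b" using c arc_distinct_ends by blast
  show "connected (A - {a, b})"
    using connected_simple_path_endless[of c] c arc_imp_simple_path by auto
  show ne: "A - {a, b} \<noteq> {}"
    using nonempty_simple_path_endless[of c] c arc_imp_simple_path by auto
  show "is_arc A b a" unfolding is_arc_def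
    by (rule exI[of _ "reversepath c"]) (simp add: c arc_reversepath)
  show "closure (A - {a, b}) = A"
  proof
    show "closure (A - {a, b}) \<subseteq> A" using 1 by (simp add: closure_minimal compact_imp_closed)
    have fin: "finite {a, b}" by simp
    show "A \<subseteq> closure (A - {a, b})"
    proof
      fix x assume x: "x \<in> A"
      have "x islimpt A" using 1 x ab \<open>a \<noteq> b\<close> by (intro connected_imp_perfect) auto
      then have "x islimpt (A - {a, b})"
        using islimpt_Un_finite[OF fin, of x "A - {a, b}"] ab by (simp add: insert_absorb)
      then show "x \<in> closure (A - {a, b})" by (simp add: closure_def)
    qed
  qed
qed

lemma is_arc_join:
  assumes "is_arc A a b" "is_arc B b c" "A \<inter> B \<subseteq> {b}"
  shows "is_arc (A \<union> B) a c"
proof -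
  from assms obtain p q where *: "arc p" "path_image p = A" "pathstart p = a" "pathfinish p = b"
    "arc q" "path_image q = B" "pathstart q = b" "pathfinish q = c" unfolding is_arc_def by auto
  then show ?thesis using assms(3) unfolding is_arc_def
    by (intro exI[of _ "p +++ q"]) (simp add: arc_join path_image_join)
qed

lemma jordan_two_arcs:
  assumes "is_arc A a b" "is_arc B b a" "A \<inter> B \<subseteq> {a, b}"
  shows "jordan (A \<union> B)"
proof -
  from assms obtain p q where *: "arc p" "path_image p = A" "pathstart p = a" "pathfinish p = b"
    "arc q" "path_image q = B" "pathstart q = b" "pathfinish q = a" unfolding is_arc_def by auto
  then show ?thesis using assms(3) unfolding jordan_def
    by (intro exI[of _ "p +++ q"]) (simp add: simple_path_join_loop path_image_join)
qed

section \<open>Parametrized pseudo-lines\<close>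

definition param :: "complex set \<Rightarrow> (real \<Rightarrow> complex) \<Rightarrow> bool" where
  "param L f \<longleftrightarrow> closed L \<and> (\<exists>g. homeomorphism UNIV L f g)"

lemma pseudo_line_param: "pseudo_line L \<Longrightarrow> \<exists>f. param L f"
  unfolding pseudo_line_def param_def homeomorphic_def by blast

lemma param_uminus:
  assumes "param L f" shows "param L (\<lambda>t. f (- t))"
proof -
  obtain g where g: "homeomorphism UNIV L f g" using assms unfolding param_def by blast
  have "homeomorphism UNIV UNIV uminus (uminus :: real \<Rightarrow> real)"
    by (auto simp: homeomorphism_def continuous_on_minus)
  from homeomorphism_compose[OF this g] show ?thesis
    using assms unfolding param_def by (auto simp: o_def)
qed

lemma param_basic:
  assumes "param L f"
  shows "closed L" "continuous_on S f" "inj f" "f t \<in> L" "x \<in> L \<Longrightarrow> \<exists>t. x = f t" "range f = L"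
proof -
  obtain g where g: "homeomorphism UNIV L f g" using assms unfolding param_def by blast
  show "closed L" using assms unfolding param_def by blast
  show "continuous_on S f" using g continuous_on_subset homeomorphism_def by blast
  show "inj f" using g by (metis homeomorphism_apply1 inj_def UNIV_I)
  show "f t \<in> L" using g homeomorphism_image1 by blast
  show "x \<in> L \<Longrightarrow> \<exists>t. x = f t" using g by (metis homeomorphism_apply2)
  show "range f = L" using g homeomorphism_image1 by blast
qed

lemma param_eq_iff: "param L f \<Longrightarrow> f s = f t \<longleftrightarrow> s = t"
  using param_basic(3) by (auto simp: inj_eq)

lemma subsegment_param:
  assumes "param L f" shows "subsegment L (f s) (f t) = f ` closed_segment s t"
proof -
  obtain g where g: "homeomorphism UNIV L f g" using assms unfolding param_def by blast
  show ?thesis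
    using subsegment_parametrization[OF g param_basic(4)[OF assms] param_basic(4)[OF assms]]
      homeomorphism_apply1[OF g] by simp
qed

lemma subsegment_le: "param L f \<Longrightarrow> s \<le> t \<Longrightarrow> subsegment L (f s) (f t) = f ` {s..t}"
  by (simp add: subsegment_param closed_segment_eq_real_ivl)

lemma subsegment_commute: "subsegment L x y = subsegment L y x"
  unfolding subsegment_def by (rule arg_cong[where f=Inter]) auto

lemma ray_param:
  assumes "param L f" "s < t" shows "ray L (f s) (f t) = f ` {t..}"
proof -
  obtain g where g: "homeomorphism UNIV L f g" using assms unfolding param_def by blast
  show ?thesis
    using ray_parametrization[OF g param_basic(4)[OF assms(1)] param_basic(4)[OF assms(1)]]
      homeomorphism_apply1[OF g] assms(2) by simp
qed

lemma param_connected: "param L f \<Longrightarrow> is_interval S \<Longrightarrow> connected (f ` S)"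
  by (simp add: connected_continuous_image is_interval_connected param_basic(2))

lemma param_image_closed:
  assumes "param L f" "closed S" shows "closed (f ` S)"
proof -
  obtain g where g: "homeomorphism UNIV L f g" using assms unfolding param_def by blast
  have "closedin (top_of_set L) (f ` S)"
    using homeomorphism_imp_closed_map[OF g, of S] assms(2) by simp
  then show ?thesis using param_basic(1)[OF assms(1)] closedin_closed_trans by blast
qed

text \<open>A bounded closed half of \<open>L\<close> would be compact, and so would its preimage, a
  half-line of the reals. The other end follows by reversing the parameter.\<close>

lemma param_unbounded:
  assumes "param L f" shows "\<not> bounded (f ` {t<..})" "\<not> bounded (f ` {..<t})"
proof -
  have *: "\<not> bounded (f ` {t<..})" if f: "param L f" for f :: "real \<Rightarrow> complex" and t
  proof
    obtain g where g: "homeomorphism UNIV L f g" using f unfolding param_def by blast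
    assume "bounded (f ` {t<..})"
    then have "bounded (insert (f t) (f ` {t<..}))" by simp
    moreover have "insert (f t) (f ` {t<..}) = f ` {t..}" by (auto simp: image_iff less_le)
    ultimately have "compact (f ` {t..})"
      using param_image_closed[OF f] by (simp add: compact_eq_bounded_closed)
    then have "compact (g ` f ` {t..})"
      using compact_continuous_image[OF continuous_on_subset[OF homeomorphism_cont2[OF g]], of "f ` {t..}"]
        param_basic(4)[OF f] by blast
    moreover have "g ` f ` {t..} = {t..}" using homeomorphism_apply1[OF g] by (simp add: image_comp)
    ultimately have "bounded {t..}" by (simp add: compact_imp_bounded)
    then have "bdd_above {t..}" by (rule bounded_imp_bdd_above)
    then obtain u where u: "\<And>x. t \<le> x \<Longrightarrow> x \<le> u" unfolding bdd_above_def by auto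
    have "\<bar>t\<bar> + \<bar>u\<bar> + 1 \<le> u" by (rule u) linarith
    then show False by linarith
  qed
  show "\<not> bounded (f ` {t<..})" by (rule *[OF assms])
  have "(\<lambda>t. f (- t)) ` {- t<..} = f ` uminus ` {- t<..}" by (rule image_image[symmetric])
  also have "uminus ` {- t<..} = {..<t}" by simp
  finally show "\<not> bounded (f ` {..<t})" using *[OF param_uminus[OF assms], of "- t"] by simp
qed

lemma subsegment_is_arc:
  assumes "param L f" "s \<noteq> t" shows "is_arc (subsegment L (f s) (f t)) (f s) (f t)"
  unfolding is_arc_def
proof (intro exI conjI)
  let ?c = "f \<circ> linepath s t"
  have "inj_on ?c {0..1}"
    by (metis arc_def arc_linepath assms comp_inj_on inj_on_subset param_basic(3) subset_UNIV)
  moreover have "path ?c"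
    by (intro path_continuous_image) (auto intro: param_basic(2)[OF assms(1)])
  ultimately show "arc ?c" by (simp add: arc_def)
  show "path_image ?c = subsegment L (f s) (f t)"
    by (simp add: path_image_compose subsegment_param[OF assms(1)])
qed (simp_all add: pathstart_def pathfinish_def linepath_def)

text \<open>The common point splits \<open>L\<close> into two connected halves that miss
  \<open>M\<close>. The two points provided by \<open>crosses\<close> therefore lie in different
  halves, and each half stays on its own side of \<open>M\<close>.\<close>

lemma crossing:
  assumes A: "pseudo_line_arrangement \<L>" and LM: "L \<in> \<L>" "M \<in> \<L>" "L \<noteq> M"
    and f: "param L f" and w: "f w \<in> M" and st: "s < w" "w < t"
  shows "\<not> connected_component (- M) (f s) (f t)"
proof -
  obtain x where x: "L \<inter> M = {x}" using A LM unfolding pseudo_line_arrangement_def by blast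
  then have x': "L \<inter> M = {f w}" using w param_basic(4)[OF f, of w] by auto
  have out: "f u \<notin> M" if "u \<noteq> w" for u
    using that x' param_basic(4)[OF f] param_eq_iff[OF f] by blast
  have "crosses L M" using A LM unfolding pseudo_line_arrangement_def by blast
  then obtain a b where ab: "a \<in> L" "b \<in> L" "a \<notin> M" "b \<notin> M" "\<not> connected_component (- M) a b"
    unfolding crosses_def by blast
  obtain a' b' where a': "a = f a'" "b = f b'" using ab param_basic(5)[OF f] by metis
  have ne: "a' \<noteq> w" "b' \<noteq> w" using a' ab w by auto
  have L: "connected_component (- M) (f u) (f v)" if "u < w" "v < w" for u v
    unfolding connected_component_def
  proof (intro exI[of _ "f ` {..<w}"] conjI)
    show "connected (f ` {..<w})" by (rule param_connected[OF f is_interval_io])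
  qed (use that out in auto)
  have R: "connected_component (- M) (f u) (f v)" if "w < u" "w < v" for u v
    unfolding connected_component_def
  proof (intro exI[of _ "f ` {w<..}"] conjI)
    show "connected (f ` {w<..})" by (rule param_connected[OF f is_interval_oi])
  qed (use that out in auto)
  show ?thesis
  proof
    assume c: "connected_component (- M) (f s) (f t)"
    note cs = connected_component_sym and ct = connected_component_trans
    from ne consider "a' < w" "b' < w" | "w < a'" "w < b'" | "a' < w" "w < b'" | "w < a'" "b' < w"
      by linarith
    then have "connected_component (- M) (f a') (f b')"
    proof cases
      case 3
      then show ?thesis using ct[OF L[of a' s] ct[OF c R[of t b']]] st by blast
    next
      case 4
      then show ?thesis using cs[OF ct[OF L[of b' s] ct[OF c R[of t a']]]] st by blast
    qed (use L R in auto)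
    then show False using ab a' by simp
  qed
qed

text \<open>A point missing from \<open>C\<close> would split the arc into two closed pieces that
  disconnect \<open>C\<close>.\<close>

lemma arc_minimal:
  assumes "is_arc U a b" "C \<subseteq> U" "connected C" "a \<in> C" "b \<in> C"
  shows "C = U"
proof (rule ccontr)
  assume "C \<noteq> U"
  then obtain z where z: "z \<in> U" "z \<notin> C" using assms(2) by blast
  obtain c where c: "arc c" "path_image c = U" "pathstart c = a" "pathfinish c = b"
    using assms(1) unfolding is_arc_def by blast
  then obtain t where t: "t \<in> {0..1}" "z = c t" using z by (auto simp: path_image_def)
  have inj: "inj_on c {0..1}" and cont: "continuous_on {0..1} c"
    using c(1) by (auto simp: arc_def path_def)
  have cl: "closed (c ` {0..t})" "closed (c ` {t..1})"
    using t(1) by (intro compact_imp_closed compact_continuous_image continuous_on_subset[OF cont]; auto)+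
  have "c ` {0..t} \<inter> c ` {t..1} \<inter> C = {}"
  proof -
    have "c ` {0..t} \<inter> c ` {t..1} = c ` ({0..t} \<inter> {t..1})"
      using t(1) by (intro inj_on_image_Int[OF inj, symmetric]) auto
    also have "{0..t} \<inter> {t..1} = {t}" using t(1) by auto
    finally show ?thesis using t z by auto
  qed
  moreover have "C \<subseteq> c ` {0..t} \<union> c ` {t..1}"
  proof -
    have "{0..1} = {0..t} \<union> {t..1}" using t(1) by auto
    then show ?thesis using assms(2) c(2) unfolding path_image_def by (metis image_Un)
  qed
  ultimately have "c ` {0..t} \<inter> C = {} \<or> c ` {t..1} \<inter> C = {}"
    using connected_closedD[OF assms(3)] cl by blast
  moreover have "a \<in> c ` {0..t}" "b \<in> c ` {t..1}"
    using c t(1) unfolding pathstart_def pathfinish_def by auto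
  ultimately show False using assms by blast
qed

text \<open>The points \<open>a\<close> and \<open>b\<close> divide the curve into two arcs.
  \<open>A\<close> without its ends is connected, so it lies in one of them, and \<open>A\<close>
  equals that arc by \<open>arc_minimal\<close>.\<close>

lemma jordan_complement_arc:
  assumes J: "jordan J" and A: "is_arc A a b" "A \<subseteq> J"
  obtains D where "is_arc D b a" "A \<union> D = J" "A \<inter> D = {a, b}"
proof -
  note AD = is_arcD[OF A(1)]
  obtain c where c: "simple_path c" "pathfinish c = pathstart c" "path_image c = J"
    using J unfolding jordan_def by blast
  obtain u d where ud: "arc u" "arc d" "pathstart u = a" "pathfinish u = b"
     "pathstart d = b" "pathfinish d = a" "path_image u \<inter> path_image d = {a, b}" "path_image u \<union> path_image d = J"
    using exists_double_arc[OF c(1,2), of a b] c(3) AD A(2) by (metis subsetD)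
  have u: "is_arc (path_image u) a b" "is_arc (path_image u) b a" and d: "is_arc (path_image d) a b" "is_arc (path_image d) b a"
    using ud is_arcD(9) unfolding is_arc_def by blast+
  have cl: "closed (path_image u)" "closed (path_image d)" using ud closed_arc_image by blast+
  have "path_image u \<inter> (A - {a, b}) = {} \<or> path_image d \<inter> (A - {a, b}) = {}"
    using ud A(2) by (intro connected_closedD[OF AD(6)] cl) auto
  then have "A - {a, b} \<subseteq> path_image d \<or> A - {a, b} \<subseteq> path_image u" using ud A by blast
  then have "A \<subseteq> path_image d \<or> A \<subseteq> path_image u" using cl AD(8) closure_minimal by metis
  then have "A = path_image d \<or> A = path_image u"
    using arc_minimal[OF u(1) _ AD(2,3,4)] arc_minimal[OF d(1) _ AD(2,3,4)] by blast
  then show thesis using that u d ud by (metis Int_commute Un_commute)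
qed

text \<open>\<open>separation_transfer\<close> turns a crossing of \<open>M\<close> into a crossing
  of \<open>J\<close>: both contain the arc \<open>?A\<close>, and the remaining parts,
  \<open>?C\<close> of \<open>M\<close> and \<open>D\<close> of \<open>J\<close>, keep away from a
  ball around the crossing point.\<close>

lemma crossing_jordan:
  assumes A: "pseudo_line_arrangement \<L>" and LM: "L \<in> \<L>" "M \<in> \<L>" "L \<noteq> M"
    and f: "param L f" and h: "param M h" and J: "jordan J" "h ` {a..b} \<subseteq> J"
    and w: "a < c" "c < b" "f w = h c"
  obtains \<delta> where "\<delta> > 0" "f ` {w - \<delta><..<w} \<subseteq> inside J \<and> f ` {w<..<w + \<delta>} \<subseteq> outside J \<or>
    f ` {w - \<delta><..<w} \<subseteq> outside J \<and> f ` {w<..<w + \<delta>} \<subseteq> inside J"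
proof -
  let ?A = "h ` {a..b}" and ?C = "h ` {..a} \<union> h ` {b..}"
  have A_arc: "is_arc ?A (h a) (h b)" using subsegment_is_arc[OF h, of a b] subsegment_le[OF h, of a b] w by simp
  then obtain D where D: "is_arc D (h b) (h a)" "?A \<union> D = J" "?A \<inter> D = {h a, h b}"
    using jordan_complement_arc J by metis
  note inj = param_eq_iff[OF h]
  have M: "?A \<union> ?C = M"
  proof -
    have "UNIV = {a..b} \<union> ({..a} \<union> {b..})" by auto
    then have "range h = ?A \<union> ?C" by (metis image_Un)
    then show ?thesis using param_basic(6)[OF h] by simp
  qed
  have C: "closed ?C" using param_image_closed[OF h] by (intro closed_Un) auto
  have AC: "?A \<inter> ?C \<subseteq> D"
  proof -
    have "?A \<inter> ?C \<subseteq> {h a, h b}" by (auto simp: inj)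
    then show ?thesis using D(3) by blast
  qed
  have "h c \<notin> D" using D(3) w inj by (metis (no_types, lifting) IntI atLeastAtMost_iff empty_iff image_eqI insert_iff less_eq_real_def less_irrefl)
  moreover have "h c \<notin> ?C" using w by (auto simp: inj)
  moreover have "closed (D \<union> ?C)" using C is_arcD(1)[OF D(1)] compact_imp_closed by blast
  ultimately obtain e where e: "e > 0" "ball (h c) e \<subseteq> - (D \<union> ?C)"
    using open_contains_ball[of "- (D \<union> ?C)"] by (metis ComplI UnE open_Compl)
  have "isCont f w" using param_basic(2)[OF f, of UNIV] by (simp add: continuous_on_eq_continuous_at)
  then obtain \<delta> where \<delta>: "\<delta> > 0" "\<And>t. dist t w < \<delta> \<Longrightarrow> dist (f t) (f w) < e"
    unfolding continuous_at_eps_delta using e(1) by blast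
  have near: "f t \<in> ball (h c) e" if "w - \<delta> < t" "t < w + \<delta>" for t
    using \<delta>(2)[of t] that w(3) by (auto simp: dist_real_def dist_commute)
  obtain x where "L \<inter> M = {x}" using A LM unfolding pseudo_line_arrangement_def by blast
  then have notM: "f t \<notin> M" if "t \<noteq> w" for t
    using that param_eq_iff[OF f] param_basic(4)[OF f] param_basic(4)[OF h, of c] w(3) by (metis IntI singletonD)
  have notJ: "f t \<notin> J" if "t \<noteq> w" "w - \<delta> < t" "t < w + \<delta>" for t
    using notM[OF that(1)] near[OF that(2,3)] e D(2) M by blast
  have side: "f ` S \<subseteq> inside J \<or> f ` S \<subseteq> outside J"
    if "is_interval S" "w \<notin> S" "S \<subseteq> {w - \<delta><..<w + \<delta>}" for S
  proof (rule inside_or_outside[OF J(1) param_connected[OF f that(1)]])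
    show "f ` S \<inter> J = {}" using notJ that(2,3) by fastforce
  qed
  have opp: "\<not> connected_component (- J) (f s) (f t)" if "w - \<delta> < s" "s < w" "w < t" "t < w + \<delta>" for s t
  proof -
    have "connected_component (- (D \<union> ?C)) (f s) (f t)"
      unfolding connected_component_def using e near[of s] near[of t] that
      by (intro exI[of _ "ball (h c) e"]) auto
    then show ?thesis
      using separation_transfer[of ?A D ?C "f s" "f t"] is_arcD[OF A_arc] is_arcD[OF D(1)] C AC M D(2)
        crossing[OF A LM f _ that(2,3)] param_basic(4)[OF h, of c] w(3) by simp
  qed
  define s t where "s = w - \<delta> / 2" and "t = w + \<delta> / 2"
  have st: "w - \<delta> < s" "s < w" "w < t" "t < w + \<delta>" using \<delta>(1) by (auto simp: s_def t_def)
  have "f ` {w - \<delta><..<w} \<subseteq> inside J \<or> f ` {w - \<delta><..<w} \<subseteq> outside J"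
    "f ` {w<..<w + \<delta>} \<subseteq> inside J \<or> f ` {w<..<w + \<delta>} \<subseteq> outside J"
    using \<delta>(1) by (intro side; auto simp: is_interval_oo)+
  moreover have "f s \<in> f ` {w - \<delta><..<w}" "f t \<in> f ` {w<..<w + \<delta>}" using st by auto
  ultimately show thesis
    using opp[OF st] that[OF \<delta>(1)] connected_component_inside[OF J(1), of "f s" "f t"]
      connected_component_outside[OF J(1), of "f s" "f t"] by blast
qed

section \<open>Segments and rays in a pseudo-polygon\<close>

locale ppoly =
  fixes n :: nat and p :: "nat \<Rightarrow> complex" and \<L> :: "complex set set"
  assumes poly: "pseudo_polygon n p \<L>"
begin

abbreviation "lin \<equiv> line_through p \<L>"
abbreviation "bdry \<equiv> boundary n p \<L>"
abbreviation "edge \<equiv> bd_edge n p \<L>"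
abbreviation "verts \<equiv> p ` {..<n}"
abbreviation "nxt m \<equiv> Suc m mod n"
abbreviation "vis \<equiv> visible_pair n p \<L>"

lemma config: "pseudo_configuration n p \<L>"
  using poly unfolding pseudo_polygon_def by blast

lemma arr: "pseudo_line_arrangement \<L>" and n3: "3 \<le> n" and inj_p: "inj_on p {..<n}"
  using config unfolding pseudo_configuration_def by blast+

lemma p_eq: "\<lbrakk>i < n; j < n\<rbrakk> \<Longrightarrow> p i = p j \<longleftrightarrow> i = j"
  using inj_p by (auto simp: inj_on_def)

lemma lin:
  assumes "i < n" "j < n" "i \<noteq> j"
  shows "lin i j \<in> \<L>" "p i \<in> lin i j" "p j \<in> lin i j"
proof -
  have ex1: "\<exists>!L. L \<in> \<L> \<and> p i \<in> L \<and> p j \<in> L"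
    using config assms unfolding pseudo_configuration_def by blast
  from theI'[OF this] show "lin i j \<in> \<L>" "p i \<in> lin i j" "p j \<in> lin i j"
    unfolding line_through_def by auto
qed

lemma lin_commute: "lin i j = lin j i"
  unfolding line_through_def by (rule arg_cong[where f=The]) auto

lemma lin_vertex:
  assumes "i < n" "j < n" "i \<noteq> j" "v < n"
  shows "p v \<in> lin i j \<longleftrightarrow> v = i \<or> v = j"
proof
  assume v: "p v \<in> lin i j"
  have "card (lin i j \<inter> verts) = 2"
    using config lin(1)[OF assms(1-3)] unfolding pseudo_configuration_def by blast
  moreover have "{p i, p j, p v} \<subseteq> lin i j \<inter> verts" using lin(2,3)[OF assms(1-3)] v assms(1,2,4) by blast
  ultimately have "card {p i, p j, p v} \<le> 2"
    by (metis card_mono finite_Int finite_imageI finite_lessThan)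
  then show "v = i \<or> v = j" using assms by (auto simp: p_eq card_insert_if split: if_splits)
qed (use lin(2,3)[OF assms(1-3)] in auto)

lemma lin_eq_iff:
  assumes "i < n" "j < n" "i \<noteq> j" "k < n" "l < n" "k \<noteq> l"
  shows "lin i j = lin k l \<longleftrightarrow> {i, j} = {k, l}"
proof
  assume "lin i j = lin k l"
  then have "p k \<in> lin i j" "p l \<in> lin i j" using lin(2,3)[OF assms(4-6)] by auto
  then show "{i, j} = {k, l}" using lin_vertex[OF assms(1-3)] assms(4-6) by auto
next
  assume "{i, j} = {k, l}"
  then show "lin i j = lin k l" using lin_commute by (auto simp: doubleton_eq_iff)
qed

lemma meet_unique:
  assumes "L \<in> \<L>" "M \<in> \<L>" "L \<noteq> M" "x \<in> L" "x \<in> M" "y \<in> L" "y \<in> M"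
  shows "x = y"
proof -
  obtain z where "L \<inter> M = {z}" using arr assms unfolding pseudo_line_arrangement_def by blast
  then show ?thesis using assms(4-7) by (metis IntI singletonD)
qed

lemma ex_param: "L \<in> \<L> \<Longrightarrow> \<exists>f. param L f"
  using arr pseudo_line_param unfolding pseudo_line_arrangement_def by blast

lemma param_through:
  assumes "L \<in> \<L>" "x \<in> L" "y \<in> L" "x \<noteq> y"
  obtains f s t where "param L f" "f s = x" "f t = y" "s < t"
proof -
  obtain f where f: "param L f" using ex_param assms by blast
  obtain s t where st: "x = f s" "y = f t" using param_basic(5)[OF f] assms by metis
  show thesis
  proof (cases "s < t")
    case True then show ?thesis using that f st by blast
  next
    case False
    then have "- s < - t" using st assms by (cases "s = t") auto
    then show ?thesis using that[OF param_uminus[OF f], of "- s" "- t"] st by simp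
  qed
qed

lemma lin_param:
  assumes "i < n" "j < n" "i \<noteq> j"
  obtains f s t where "param (lin i j) f" "f s = p i" "f t = p j" "s < t"
proof -
  have "p i \<noteq> p j" using p_eq assms by blast
  then show thesis by (rule param_through[OF lin(1-3)[OF assms]]) (rule that)
qed

lemma next_vertex: "m < n \<Longrightarrow> nxt m < n" "m < n \<Longrightarrow> nxt m \<noteq> m" "m < n \<Longrightarrow> m \<noteq> nxt m"
  using n3 by (auto simp: mod_Suc)

lemma edge_eq: "edge m = subsegment (lin m (nxt m)) (p m) (p (nxt m))"
  unfolding bd_edge_def seg_def ..

lemma edge_subset_lin: assumes "m < n" shows "edge m \<subseteq> lin m (nxt m)"
proof -
  obtain f s t where f: "param (lin m (nxt m)) f" "f s = p m" "f t = p (nxt m)" "s < t"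
    using lin_param[OF assms next_vertex(1,3)[OF assms]] by metis
  then show ?thesis using subsegment_le[OF f(1), of s t] param_basic(4)[OF f(1)] unfolding edge_eq by auto
qed

lemma edge_param:
  assumes "m < n"
  obtains f s t where "param (lin m (nxt m)) f" "f s = p m" "f t = p (nxt m)" "s < t" "edge m = f ` {s..t}"
proof -
  obtain f s t where f: "param (lin m (nxt m)) f" "f s = p m" "f t = p (nxt m)" "s < t"
    using lin_param[OF assms next_vertex(1,3)[OF assms]] by metis
  then show ?thesis using that subsegment_le[OF f(1), of s t] unfolding edge_eq by auto
qed

lemma vertex_in_edge:
  assumes "v < n" "m < n"
  shows "p v \<in> edge m \<longleftrightarrow> v = m \<or> v = nxt m"
proof
  show "p v \<in> edge m \<Longrightarrow> v = m \<or> v = nxt m"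
    using edge_subset_lin[OF assms(2)] lin_vertex[OF assms(2) next_vertex(1,3)[OF assms(2)] assms(1)]
    by blast
  obtain f s t where "param (lin m (nxt m)) f" "f s = p m" "f t = p (nxt m)" "s < t" "edge m = f ` {s..t}"
    by (rule edge_param[OF assms(2)])
  then have "p m \<in> edge m" "p (nxt m) \<in> edge m"
    by (metis atLeastAtMost_iff image_eqI less_imp_le order_refl)+
  then show "v = m \<or> v = nxt m \<Longrightarrow> p v \<in> edge m" by blast
qed

lemma edges_meet:
  assumes "l < n" "m < n" "l \<noteq> m" "z \<in> edge l" "z \<in> edge m"
  shows "m = nxt l \<and> z = p m \<or> l = nxt m \<and> z = p l"
proof -
  have "m = nxt l \<or> l = nxt m"
    using poly assms unfolding pseudo_polygon_def by (metis IntI empty_iff)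
  moreover have "edge i \<inter> edge (nxt i) = {p (nxt i)}" if "i < n" for i
    using poly that unfolding pseudo_polygon_def by blast
  ultimately show ?thesis using assms by blast
qed

lemma loop:
  obtains g where "simple_path g" "pathfinish g = pathstart g" "path_image g = bdry"
    "\<And>i. i < n \<Longrightarrow> g (real i / real n) = p i"
    "\<And>i. i < n \<Longrightarrow> g ` {real i / real n .. real (Suc i) / real n} = edge i"
proof -
  obtain g where g: "simple_path g" "pathfinish g = pathstart g"
    "\<And>i. i < n \<Longrightarrow> g (real i / real n) = p i"
    "\<And>i. i < n \<Longrightarrow> g ` {real i / real n .. real (Suc i) / real n} = edge i"
  proof -
    have "ccw_indexed n p \<L>" using poly unfolding pseudo_polygon_def by blast
    then show thesis using that unfolding ccw_indexed_def by auto
  qed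
  have "\<exists>i<n. t \<in> {real i / real n .. real (Suc i) / real n}" if "t \<in> {0..1}" for t
  proof (cases "t = 1")
    case True
    then show ?thesis using n3 by (intro exI[of _ "n - 1"]) (auto simp: field_simps)
  next
    case False
    define i where "i = nat \<lfloor>t * n\<rfloor>"
    have "real i \<le> t * n" using that unfolding i_def by (intro of_nat_floor) auto
    moreover have lt: "t * n < real i + 1" unfolding i_def by linarith
    moreover have "t * n < n" using False that n3 by simp
    ultimately have "i < n" by linarith
    then show ?thesis using \<open>real i \<le> t * n\<close> lt n3
      by (intro exI[of _ i]) (auto simp: field_simps)
  qed
  then have "{0..1} \<subseteq> (\<Union>i<n. {real i / real n .. real (Suc i) / real n})" by fastforce
  moreover have "(\<Union>i<n. {real i / real n .. real (Suc i) / real n}) \<subseteq> {0..1}"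
  proof clarify
    fix i t assume "i < n" "t \<in> {real i / real n .. real (Suc i) / real n}"
    then have "0 \<le> t" "t \<le> real (Suc i) / real n" "real (Suc i) / real n \<le> 1"
      by (auto intro: order_trans[of 0 "real i / real n"])
    then show "t \<in> {0..1}" by auto
  qed
  ultimately have "{0..1} = (\<Union>i<n. {real i / real n .. real (Suc i) / real n})" by (rule equalityI)
  then have "path_image g = (\<Union>i<n. g ` {real i / real n .. real (Suc i) / real n})"
    unfolding path_image_def by (metis image_UN)
  also have "\<dots> = bdry" unfolding boundary_def using g(4) by simp
  finally show thesis using that g by blast
qed

lemma jordan_bdry: "jordan bdry"
  using loop unfolding jordan_def by metis

lemmas bdryD = jordanD[OF jordan_bdry]

lemma edge_subset: "m < n \<Longrightarrow> edge m \<subseteq> bdry"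
  unfolding boundary_def by blast

lemma bdry_edge: "z \<in> bdry \<Longrightarrow> \<exists>m<n. z \<in> edge m"
  unfolding boundary_def by blast

lemma regions: "z \<notin> outside bdry \<Longrightarrow> z \<notin> bdry \<Longrightarrow> z \<in> inside bdry"
  "z \<in> inside bdry \<Longrightarrow> z \<notin> bdry" "z \<in> inside bdry \<Longrightarrow> z \<notin> outside bdry"
  using bdryD(10,11) by blast+

lemma bdry_not_outside: "z \<in> bdry \<Longrightarrow> z \<notin> outside bdry"
  using bdryD(11) by blast

lemma vertex_bdry: "v < n \<Longrightarrow> p v \<in> bdry"
  using edge_subset[of v] vertex_in_edge[of v v] by auto

lemma edge_crossing:
  assumes L: "L \<in> \<L>" "param L f" and m: "m < n" "f w \<in> edge m" "f w \<notin> verts" "L \<noteq> lin m (nxt m)"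
  obtains \<delta> where "\<delta> > 0" "f ` {w - \<delta><..<w} \<subseteq> inside bdry \<and> f ` {w<..<w + \<delta>} \<subseteq> outside bdry \<or>
    f ` {w - \<delta><..<w} \<subseteq> outside bdry \<and> f ` {w<..<w + \<delta>} \<subseteq> inside bdry"
proof -
  obtain h s t where h: "param (lin m (nxt m)) h" "h s = p m" "h t = p (nxt m)" "s < t" "edge m = h ` {s..t}"
    using edge_param[OF m(1)] by metis
  obtain c where c: "f w = h c" "s \<le> c" "c \<le> t" using m(2) h(5) by auto
  have "c \<noteq> s" "c \<noteq> t" using c h m next_vertex[OF m(1)] by auto
  then have "s < c" "c < t" using c by auto
  moreover have "lin m (nxt m) \<in> \<L>" using lin(1) m(1) next_vertex by metis
  ultimately show thesis
    using crossing_jordan[OF arr L(1) _ m(4) L(2) h(1) jordan_bdry, of s t c w] edge_subset[OF m(1)] h(5) c(1) that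
    by metis
qed

text \<open>Any other line would cross the edge at \<open>f u\<close> and so enter the outside on
  one side of it.\<close>

lemma touching_edge:
  assumes L: "L \<in> \<L>" "param L f" and Out: "f ` {s..t} \<inter> outside bdry = {}"
    and u: "s < u" "u < t" "f u \<in> bdry" "f u \<notin> verts"
  obtains m where "m < n" "f u \<in> edge m" "L = lin m (nxt m)"
proof -
  obtain m where m: "m < n" "f u \<in> edge m" using bdry_edge u by blast
  have "L = lin m (nxt m)"
  proof (rule ccontr)
    assume "L \<noteq> lin m (nxt m)"
    then obtain \<delta> where \<delta>: "\<delta> > 0" "f ` {u - \<delta><..<u} \<subseteq> outside bdry \<or> f ` {u<..<u + \<delta>} \<subseteq> outside bdry"
      using edge_crossing[OF L m u(4)] by metis
    define a b where "a = max s (u - \<delta> / 2)" and "b = min t (u + \<delta> / 2)"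
    have "a \<in> {u - \<delta><..<u}" "a \<in> {s..t}" "b \<in> {u<..<u + \<delta>}" "b \<in> {s..t}"
      using \<delta>(1) u unfolding a_def b_def by auto
    then show False using \<delta>(2) Out by blast
  qed
  then show thesis using that m by blast
qed

lemma visD:
  assumes "vis i k"
  shows "i < n" "k < n" "i \<noteq> k" "seg p \<L> i k \<inter> outside bdry = {}"
  using assms unfolding visible_pair_def by auto

lemma seg_commute: "seg p \<L> i k = seg p \<L> k i"
  unfolding seg_def lin_commute[of i k] by (rule subsegment_commute)

lemma vis_commute: "vis i k \<longleftrightarrow> vis k i"
  unfolding visible_pair_def seg_commute[of i k] by auto

lemma seg_param:
  assumes "param (lin i k) f" "f s = p i" "f t = p k" "s < t"
  shows "seg p \<L> i k = f ` {s..t}"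
  using subsegment_le[OF assms(1), of s t] assms unfolding seg_def by simp

lemma param_vertex:
  assumes "i < n" "k < n" "i \<noteq> k" "param (lin i k) f" "f s = p i" "f t = p k"
  shows "f u \<in> verts \<longleftrightarrow> u = s \<or> u = t"
proof
  assume "f u \<in> verts"
  then obtain v where v: "v < n" "f u = p v" by auto
  then have "v = i \<or> v = k" using lin_vertex[OF assms(1-3)] param_basic(4)[OF assms(4), of u] by auto
  then show "u = s \<or> u = t" using v assms param_eq_iff[OF assms(4)] by metis
qed (use assms in auto)

text \<open>An inner point on the boundary is no vertex, so by \<open>touching_edge\<close> the
  segment lies on the line of an edge. A line contains only two vertices, hence the segment is that
  edge.\<close>

lemma vis_interior:
  assumes v: "vis i k" and f: "param (lin i k) f" "f s = p i" "f t = p k" "s < t"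
  shows "f ` {s<..<t} \<subseteq> inside bdry \<or> (\<exists>m<n. {i, k} = {m, nxt m} \<and> edge m = f ` {s..t})"
proof (rule disjCI)
  assume no: "\<not> (\<exists>m<n. {i, k} = {m, nxt m} \<and> edge m = f ` {s..t})"
  note V = visD[OF v]
  have Out: "f ` {s..t} \<inter> outside bdry = {}" using V(4) seg_param[OF f] by simp
  show "f ` {s<..<t} \<subseteq> inside bdry"
  proof clarify
    fix u assume u: "u \<in> {s<..<t}"
    have "f u \<notin> bdry"
    proof
      assume b: "f u \<in> bdry"
      have "f u \<notin> verts" using param_vertex[OF V(1-3) f(1-3)] u by auto
      then obtain m where m: "m < n" "f u \<in> edge m" "lin i k = lin m (nxt m)"
        using touching_edge[OF lin(1)[OF V(1-3)] f(1) Out _ _ b] u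
        by (metis greaterThanLessThan_iff)
      then have e: "{i, k} = {m, nxt m}" using lin_eq_iff V(1-3) next_vertex[OF m(1)] by metis
      have "edge m = seg p \<L> i k"
        using e m(3) subsegment_commute unfolding edge_eq seg_def doubleton_eq_iff by metis
      then show False using no m(1) e seg_param[OF f] by auto
    qed
    moreover have "f u \<in> f ` {s..t}" using u by auto
    ultimately show "f u \<in> inside bdry" using Out regions(1)[of "f u"] by blast
  qed
qed

lemma edge_vis: "m < n \<Longrightarrow> vis m (nxt m)"
  using next_vertex[of m] edge_subset[of m] bdry_not_outside unfolding visible_pair_def bd_edge_def by auto

lemma first_exit_iff:
  assumes f: "param (lin i k) f" "f s = p i" "f t = p k" "s < t"
  shows "first_exit n p \<L> i k x \<longleftrightarrow>
    (\<exists>r\<ge>t. x = f r \<and> f ` {t..r} \<inter> outside bdry = {} \<and> (\<forall>r'>r. f ` {t..r'} \<inter> outside bdry \<noteq> {}))"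
proof -
  have ray: "ray (lin i k) (p i) (p k) = f ` {t..}" using ray_param[OF f(1,4)] f by simp
  have ray': "ray (lin i k) (p i) (f r) - {f r} = f ` {r<..}" if "t \<le> r" for r
    using ray_param[OF f(1), of s r] f that by (auto simp: param_eq_iff[OF f(1)])
  have sub: "subsegment (lin i k) (p k) (f r) = f ` {t..r}" if "t \<le> r" for r
    using subsegment_le[OF f(1) that] f by simp
  show ?thesis
  proof
    assume "first_exit n p \<L> i k x"
    then have x: "x \<in> f ` {t..}" "subsegment (lin i k) (p k) x \<inter> outside bdry = {}"
      "\<forall>y\<in>ray (lin i k) (p i) x - {x}. subsegment (lin i k) (p k) y \<inter> outside bdry \<noteq> {}"
      unfolding first_exit_def Let_def ray by auto
    then obtain r where r: "t \<le> r" "x = f r" by auto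
    have "f ` {t..r'} \<inter> outside bdry \<noteq> {}" if "r' > r" for r'
    proof -
      have "f r' \<in> ray (lin i k) (p i) x - {x}" using that r(2) ray'[OF r(1)] by auto
      then show ?thesis using x(3) sub[of r'] that r(1) by auto
    qed
    then show "\<exists>r\<ge>t. x = f r \<and> f ` {t..r} \<inter> outside bdry = {} \<and> (\<forall>r'>r. f ` {t..r'} \<inter> outside bdry \<noteq> {})"
      using r x(2) sub[OF r(1)] by auto
  next
    assume "\<exists>r\<ge>t. x = f r \<and> f ` {t..r} \<inter> outside bdry = {} \<and> (\<forall>r'>r. f ` {t..r'} \<inter> outside bdry \<noteq> {})"
    then obtain r where r: "t \<le> r" "x = f r" "f ` {t..r} \<inter> outside bdry = {}"
      "\<forall>r'>r. f ` {t..r'} \<inter> outside bdry \<noteq> {}" by blast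
    show "first_exit n p \<L> i k x"
      unfolding first_exit_def Let_def ray
    proof (intro conjI ballI)
      show "x \<in> f ` {t..}" "subsegment (lin i k) (p k) x \<inter> outside bdry = {}" using r sub by auto
      fix y assume "y \<in> ray (lin i k) (p i) x - {x}"
      then obtain r' where "y = f r'" "r' > r" using ray'[OF r(1)] r(2) by auto
      then show "subsegment (lin i k) (p k) y \<inter> outside bdry \<noteq> {}" using r sub[of r'] by auto
    qed
  qed
qed

lemma first_exit_unique:
  assumes "vis i k" "first_exit n p \<L> i k x" "first_exit n p \<L> i k y"
  shows "x = y"
proof -
  obtain f s t where f: "param (lin i k) f" "f s = p i" "f t = p k" "s < t"
    using lin_param visD[OF assms(1)] by metis
  show ?thesis using assms(2,3) unfolding first_exit_iff[OF f] by (metis linorder_neqE)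
qed

text \<open>The exit parameter is the supremum of \<open>S\<close>, which is bounded because the ray
  is unbounded while the closed inside is bounded. As outside and inside are open, the supremum is
  attained on the boundary.\<close>

lemma first_exit_exists:
  assumes v: "vis i k" and f: "param (lin i k) f" "f s = p i" "f t = p k" "s < t"
  obtains r where "t \<le> r" "first_exit n p \<L> i k (f r)" "f r \<in> bdry"
    "f ` {t..r} \<inter> outside bdry = {}" "\<forall>r'>r. f ` {t..r'} \<inter> outside bdry \<noteq> {}"
proof -
  define S where "S = {r. t \<le> r \<and> f ` {t..r} \<inter> outside bdry = {}}"
  have "p k \<in> bdry" using vertex_bdry visD[OF v] by blast
  then have tS: "t \<in> S" unfolding S_def using f(3) bdry_not_outside by auto
  have "bounded (bdry \<union> inside bdry)" using bdryD(1,8) by (simp add: compact_imp_bounded)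
  then have "\<not> f ` {t<..} \<subseteq> bdry \<union> inside bdry" using param_unbounded(1)[OF f(1)] bounded_subset by blast
  then obtain u where u: "t < u" "f u \<in> outside bdry" using regions(1) by blast
  have ub: "r \<le> u" if "r \<in> S" for r
  proof (rule ccontr)
    assume "\<not> r \<le> u"
    then have "f u \<in> f ` {t..r}" using u by auto
    then show False using that u unfolding S_def by blast
  qed
  define r where "r = Sup S"
  have bdd: "bdd_above S" using ub by (auto simp: bdd_above_def)
  have tr: "t \<le> r" unfolding r_def using cSup_upper[OF tS bdd] .
  have below: "f v' \<notin> outside bdry" if v': "t \<le> v'" "v' < r" for v'
  proof -
    obtain w where "w \<in> S" "v' < w" using less_cSupD[of S v'] tS v' unfolding r_def by blast
    then have "f v' \<in> f ` {t..w}" using v' by auto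
    then show ?thesis using \<open>w \<in> S\<close> unfolding S_def by blast
  qed
  have cont: "open (f -` U)" if "open U" for U
    by (rule open_vimage[OF that param_basic(2)[OF f(1)]])
  have fr: "f r \<notin> outside bdry"
  proof
    assume o: "f r \<in> outside bdry"
    then have "t \<noteq> r" using f(3) bdry_not_outside[OF \<open>p k \<in> bdry\<close>] by auto
    obtain e where e: "e > 0" "\<And>y. dist y r < e \<Longrightarrow> f y \<in> outside bdry"
      using cont[OF bdryD(6)] o unfolding open_dist by auto
    have "f (max t (r - e / 2)) \<in> outside bdry"
      using e \<open>t \<noteq> r\<close> tr by (intro e(2)) (auto simp: dist_real_def)
    moreover have "max t (r - e / 2) < r" using e(1) \<open>t \<noteq> r\<close> tr by auto
    ultimately show False using below[of "max t (r - e / 2)"] by auto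
  qed
  have nin: "f r \<notin> inside bdry"
  proof
    assume "f r \<in> inside bdry"
    then obtain e where e: "e > 0" "\<And>y. dist y r < e \<Longrightarrow> f y \<in> inside bdry"
      using cont[OF bdryD(4)] unfolding open_dist by auto
    have "r + e / 2 \<in> S" unfolding S_def
    proof (intro CollectI conjI)
      show "t \<le> r + e / 2" using tr e(1) by auto
      show "f ` {t..r + e / 2} \<inter> outside bdry = {}"
      proof -
        have "f y \<notin> outside bdry" if "t \<le> y" "y \<le> r + e / 2" for y
          using below[of y] e(2)[of y] that e(1) regions(3) by (cases "y < r") (auto simp: dist_real_def)
        then show ?thesis by auto
      qed
    qed
    then have "r + e / 2 \<le> r" unfolding r_def by (rule cSup_upper[OF _ bdd])
    then show False using e(1) by simp
  qed
  have 1: "f ` {t..r} \<inter> outside bdry = {}"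
  proof -
    have "f v' \<notin> outside bdry" if "t \<le> v'" "v' \<le> r" for v'
      using below[of v'] fr that by (cases "v' = r") auto
    then show ?thesis by auto
  qed
  have 2: "f ` {t..r'} \<inter> outside bdry \<noteq> {}" if "r' > r" for r'
  proof
    assume "f ` {t..r'} \<inter> outside bdry = {}"
    then have "r' \<in> S" using that tr unfolding S_def by auto
    then have "r' \<le> r" unfolding r_def by (rule cSup_upper[OF _ bdd])
    then show False using that by simp
  qed
  show thesis
  proof (rule that[OF tr])
    show "first_exit n p \<L> i k (f r)" unfolding first_exit_iff[OF f] using tr 1 2 by blast
    show "f r \<in> bdry" using fr nin regions(1) by blast
  qed (use 1 2 in auto)
qed

end

section \<open>Chords\<close>

context ppoly
begin

text \<open>A ray cut off at \<open>p k\<close> yields no chord and is excluded by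
  \<open>x \<noteq> p k\<close>; \<open>designated_blocker_iff\<close> shows that no blocker is
  lost.\<close>

definition exit_at :: "nat \<Rightarrow> nat \<Rightarrow> nat \<Rightarrow> bool" where
  "exit_at i k m \<longleftrightarrow> m < n \<and> vis i k \<and> (\<exists>x. first_exit n p \<L> i k x \<and> x \<noteq> p k \<and> x \<in> edge m)"

definition ext :: "nat \<Rightarrow> nat \<Rightarrow> nat \<Rightarrow> bool" where
  "ext i k a \<longleftrightarrow> (\<exists>m. a = 2 * m + 1 \<and> exit_at i k m)"

text \<open>Edge positions exclude the vertices, so that each boundary point has a single
  position.\<close>

definition located :: "nat \<Rightarrow> complex \<Rightarrow> bool" where
  "located a x \<longleftrightarrow> (\<exists>v<n. a = 2 * v \<and> x = p v) \<or> (\<exists>m<n. a = 2 * m + 1 \<and> x \<in> edge m \<and> x \<notin> verts)"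

lemma located_bdry: "located a x \<Longrightarrow> x \<in> bdry"
  unfolding located_def using vertex_bdry edge_subset by blast

lemma located_vertex: "v < n \<Longrightarrow> located (2 * v) (p v)"
  unfolding located_def by blast

lemma located_edge: "m < n \<Longrightarrow> located (2 * m + 1) x \<longleftrightarrow> x \<in> edge m \<and> x \<notin> verts"
proof -
  have "2 * m + 1 \<noteq> 2 * v" for v :: nat by presburger
  then show "m < n \<Longrightarrow> located (2 * m + 1) x \<longleftrightarrow> x \<in> edge m \<and> x \<notin> verts" unfolding located_def by auto
qed

text \<open>If the ray touched the boundary before its exit, its line would contain an edge by
  \<open>touching_edge\<close>. That edge would be the segment from \<open>i\<close> to
  \<open>k\<close>, which ends where the ray begins.\<close>

lemma ext_param:
  assumes e: "ext i k a" and f: "param (lin i k) f" "f s = p i" "f t = p k" "s < t"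
  obtains r where "t < r" "located a (f r)" "f ` {t<..<r} \<subseteq> inside bdry" "first_exit n p \<L> i k (f r)"
proof -
  obtain m x where m: "a = 2 * m + 1" "m < n" "vis i k" "first_exit n p \<L> i k x" "x \<noteq> p k" "x \<in> edge m"
    using e unfolding ext_def exit_at_def by blast
  note V = visD[OF m(3)]
  obtain r where r: "t \<le> r" "x = f r" "f ` {t..r} \<inter> outside bdry = {}"
    using m(4) unfolding first_exit_iff[OF f] by blast
  have tr: "t < r" using r m(5) f(3) by (cases "t = r") auto
  have notv: "f u \<notin> verts" if "t < u" for u
    using param_vertex[OF V(1-3) f(1-3), of u] that f(4) by auto
  show thesis
  proof (rule that[OF tr])
    show "located a (f r)" unfolding m(1) located_edge[OF m(2)] using m(6) r(2) notv[OF tr] by simp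
    show "first_exit n p \<L> i k (f r)" using m(4) r(2) by simp
    show "f ` {t<..<r} \<subseteq> inside bdry"
    proof clarify
      fix u assume u: "u \<in> {t<..<r}"
      then have tu: "t < u" "u < r" by auto
      have "f u \<notin> bdry"
      proof
        assume b: "f u \<in> bdry"
        obtain l where l: "l < n" "f u \<in> edge l" "lin i k = lin l (nxt l)"
          using touching_edge[OF lin(1)[OF V(1-3)] f(1) r(3) tu b notv[OF tu(1)]] by metis
        then have "{i, k} = {l, nxt l}" using lin_eq_iff V(1-3) next_vertex[OF l(1)] by metis
        then have "edge l = seg p \<L> i k" using seg_commute unfolding bd_edge_def doubleton_eq_iff by metis
        then show False using l(2) seg_param[OF f] tu(1) by (auto simp: param_eq_iff[OF f(1)])
      qed
      moreover have "f u \<in> f ` {t..r}" using tu by auto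
      ultimately show "f u \<in> inside bdry" using regions(1) r(3) by blast
    qed
  qed
qed

lemma ext_unique: "ext i k a \<Longrightarrow> ext i k b \<Longrightarrow> a = b"
proof -
  assume e: "ext i k a" "ext i k b"
  then have v: "vis i k" unfolding ext_def exit_at_def by blast
  obtain f s t where f: "param (lin i k) f" "f s = p i" "f t = p k" "s < t"
    using lin_param visD[OF v] by metis
  obtain r where r: "t < r" "located a (f r)" "first_exit n p \<L> i k (f r)" using ext_param[OF e(1) f] by metis
  obtain r' where r': "t < r'" "located b (f r')" "first_exit n p \<L> i k (f r')" using ext_param[OF e(2) f] by metis
  have eq: "f r = f r'" using first_exit_unique[OF v] r r' by blast
  obtain l m where "a = 2 * l + 1" "b = 2 * m + 1" "l < n" "m < n"
    using e unfolding ext_def exit_at_def by blast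
  moreover then have "f r \<in> edge l" "f r \<in> edge m" "f r \<notin> verts" using r(2) r'(2) located_edge eq by auto
  moreover then have "l = m" using edges_meet[of l m "f r"] \<open>l < n\<close> \<open>m < n\<close> by auto
  ultimately show "a = b" by simp
qed

text \<open>The second alternative covers visible neighbours, whose segment is a boundary
  edge.\<close>

definition chord :: "complex set \<Rightarrow> nat \<Rightarrow> nat \<Rightarrow> bool" where
  "chord C a b \<longleftrightarrow> (\<exists>x y. located a x \<and> located b y \<and> is_arc C x y \<and>
     (C - {x, y} \<subseteq> inside bdry \<or> (\<exists>m<n. C = edge m \<and> {a, b} = {2 * m, 2 * nxt m})))"

text \<open>The loop reaches vertex \<open>v\<close> at \<open>v / n\<close>, so
  \<open>2 * n * \<tau>\<close> equals the position of a vertex and is within 1 of the position of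
  an edge. With \<open>\<tau> < 1\<close> the base point is counted once, as the start.\<close>

lemma located_loop:
  fixes g :: "real \<Rightarrow> complex"
  assumes g': "\<forall>i<n. g (real i / real n) = p i"
    "\<forall>i<n. g ` {real i / real n .. real (Suc i) / real n} = edge i" "g 1 = g 0"
    and "located a x"
  obtains \<tau> :: real where "0 \<le> \<tau>" "\<tau> < 1" "x = g \<tau>" "even a \<and> 2 * real n * \<tau> = real a \<or> odd a \<and> real a - 1 < 2 * real n * \<tau> \<and> 2 * real n * \<tau> < real a + 1"
proof -
  note g = g'(1,2)[rule_format] g'(3)
  show ?thesis
  proof (cases "even a")
    case True
    then obtain v where v: "v < n" "a = 2 * v" "x = p v" using assms(4) unfolding located_def by auto
    then show ?thesis using that[of "real v / real n"] g(1)[OF v(1)] n3 by simp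
  next
    case False
    then obtain m where m: "m < n" "a = 2 * m + 1" "x \<in> edge m" "x \<notin> verts" using assms(4) unfolding located_def by auto
    then have "x \<in> g ` {real m / real n..real (Suc m) / real n}" using g(2)[OF m(1)] by (simp only:)
    then obtain \<tau> where \<tau>': "x = g \<tau>" "\<tau> \<in> {real m / real n..real (Suc m) / real n}" by (rule imageE)
    then have \<tau>: "x = g \<tau>" "real m / real n \<le> \<tau>" "\<tau> \<le> real (Suc m) / real n" by auto
    have e: "g (real (Suc m) / real n) \<in> verts"
    proof (cases "Suc m < n")
      case True then show ?thesis using g(1)[OF True] by simp
    next
      case False
      then have "Suc m = n" using m(1) by simp
      moreover have "g (real 0 / real n) = p 0" using g(1)[of 0] n3 by simp
      ultimately show ?thesis using g(3) n3 by auto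
    qed
    have "\<tau> \<noteq> real m / real n" "\<tau> \<noteq> real (Suc m) / real n" using m g(1)[OF m(1)] \<tau>(1) e by auto
    then have l: "real m / real n < \<tau>" "\<tau> < real (Suc m) / real n" using \<tau> by auto
    moreover have "0 \<le> real m / real n" by simp
    moreover have "real (Suc m) / real n \<le> 1" using m(1) by simp
    ultimately have "0 \<le> \<tau>" "\<tau> < 1" by linarith+
    then show ?thesis using that[of \<tau>] \<tau>(1) l n3 m(2) by (auto simp: field_simps)
  qed
qed

lemma proper_chords_meet:
  assumes C: "located a x" "located b y" "is_arc C x y" "C - {x, y} \<subseteq> inside bdry"
    and D: "located c u" "located d v" "is_arc D u v" "D - {u, v} \<subseteq> inside bdry"
    and ord: "a < c" "c < b" "d < a \<or> b < d"
  shows "C \<inter> D \<noteq> {}"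
proof -
  obtain g where g: "simple_path g" "pathfinish g = pathstart g" "path_image g = bdry"
    "\<And>i. i < n \<Longrightarrow> g (real i / real n) = p i"
    "\<And>i. i < n \<Longrightarrow> g ` {real i / real n .. real (Suc i) / real n} = edge i"
    using loop by metis
  have g1: "g 1 = g 0" using g(2) by (simp add: pathfinish_def pathstart_def)
  have "\<forall>i<n. g (real i / real n) = p i" "\<forall>i<n. g ` {real i / real n .. real (Suc i) / real n} = edge i"
    using g(4,5) by blast+
  note loc = located_loop[OF this g1]
  define pos where "pos a \<tau> \<longleftrightarrow> even a \<and> 2 * real n * \<tau> = real a \<or> odd a \<and> real a - 1 < 2 * real n * \<tau> \<and> 2 * real n * \<tau> < real a + 1"
    for a :: nat and \<tau> :: real
  \<comment> \<open>Distinct odd positions differ by at least 2, so their open parameter ranges do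
    not overlap.\<close>
  have mono: "\<tau> < \<tau>'" if "pos a \<tau>" "pos b \<tau>'" "a < b" for a b \<tau> \<tau>'
  proof -
    have "2 * real n * \<tau> < 2 * real n * \<tau>'"
    proof (cases "odd a \<and> odd b")
      case True
      then have "a + 2 \<le> b" using that(3) by (metis Suc_leI add_2_eq_Suc' even_Suc le_neq_implies_less not_less_eq_eq)
      then show ?thesis using True that by (auto simp: pos_def)
    next
      case False
      then show ?thesis using that by (auto simp: pos_def)
    qed
    then show ?thesis using n3 by simp
  qed
  obtain ta where ta: "0 \<le> ta" "ta < 1" "x = g ta" "pos a ta" using loc[OF C(1)] unfolding pos_def by metis
  obtain tb where tb: "0 \<le> tb" "tb < 1" "y = g tb" "pos b tb" using loc[OF C(2)] unfolding pos_def by metis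
  obtain tc where tc: "0 \<le> tc" "tc < 1" "u = g tc" "pos c tc" using loc[OF D(1)] unfolding pos_def by metis
  obtain td where td: "0 \<le> td" "td < 1" "v = g td" "pos d td" using loc[OF D(2)] unfolding pos_def by metis
  note t = ta tb tc td
  have o: "ta < tc" "tc < tb" "td < ta \<or> tb < td" using mono t ord by metis+
  have inj: "s = s' \<or> {s, s'} = {0, 1}" if "g s = g s'" "s \<in> {0..1}" "s' \<in> {0..1}" for s s'
    using g(1) that unfolding simple_path_def loop_free_def by blast
  \<comment> \<open>\<open>c2\<close> passes through the base point of the loop and is therefore
    made from two intervals.\<close>
  define c1 c2 where "c1 = g ` {ta..tb}" and "c2 = g ` {0..ta} \<union> g ` {tb..1}"
  have cont: "continuous_on {0..1} g" using g(1) by (simp add: simple_path_def path_def)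
  have J: "bdry = c1 \<union> c2"
  proof -
    have "{0..1} = {ta..tb} \<union> ({0..ta} \<union> {tb..1})" using t o by auto
    then show ?thesis unfolding c1_def c2_def using g(3) unfolding path_image_def by (metis image_Un)
  qed
  have cc: "compact c1" "compact c2" unfolding c1_def c2_def using t o
    by (intro compact_Un compact_continuous_image continuous_on_subset[OF cont]; auto)+
  have xy: "x \<in> C" "y \<in> C" using is_arcD[OF C(3)] by auto
  have c12: "c1 \<inter> c2 \<subseteq> C"
  proof
    fix z assume "z \<in> c1 \<inter> c2"
    then have "z \<in> g ` {ta..tb}" "z \<in> g ` ({0..ta} \<union> {tb..1})" unfolding c1_def c2_def by auto
    then obtain s s' where s: "z = g s" "s \<in> {ta..tb}" "z = g s'" "s' \<in> {0..ta} \<union> {tb..1}"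
      by (elim imageE)
    then have "s = s' \<or> {s, s'} = {0, 1}" using t o by (intro inj) auto
    then have "s = ta \<or> s = tb" using s(2,4) t o by (auto simp: doubleton_eq_iff)
    then show "z \<in> C" using s(1) xy t by auto
  qed
  have uC: "u \<notin> C"
  proof
    assume "u \<in> C"
    then have "u = x \<or> u = y" using C(4) located_bdry[OF D(1)] regions(2) by auto
    then have "tc = ta \<or> {tc, ta} = {0, 1} \<or> tc = tb \<or> {tc, tb} = {0, 1}"
      using inj[of tc ta] inj[of tc tb] t by auto
    then show False using o t by (auto simp: doubleton_eq_iff)
  qed
  have vC: "v \<notin> C"
  proof
    assume "v \<in> C"
    then have "v = x \<or> v = y" using C(4) located_bdry[OF D(2)] regions(2) by auto
    then have "td = ta \<or> {td, ta} = {0, 1} \<or> td = tb \<or> {td, tb} = {0, 1}"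
      using inj[of td ta] inj[of td tb] t by auto
    then show False using o t by (auto simp: doubleton_eq_iff)
  qed
  have u2: "u \<notin> c2"
  proof
    assume "u \<in> c2"
    then obtain s' where s: "g tc = g s'" "s' \<in> {0..ta} \<union> {tb..1}" using t unfolding c2_def by auto
    then have "tc = s' \<or> {tc, s'} = {0, 1}" using t o by (intro inj) auto
    then show False using s(2) t o by (auto simp: doubleton_eq_iff)
  qed
  have v1: "v \<notin> c1"
  proof
    assume "v \<in> c1"
    then obtain s' where s: "g td = g s'" "s' \<in> {ta..tb}" using t unfolding c1_def by auto
    then have "td = s' \<or> {td, s'} = {0, 1}" using t o by (intro inj) auto
    then show False using s(2) t o by (auto simp: doubleton_eq_iff)
  qed
  note DD = is_arcD[OF D(3)]
  have "C \<inter> (D - {u, v}) \<noteq> {}"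
  proof (rule chord_meets[OF jordan_bdry J cc c12 _ _ _ DD(6) D(4) DD(7), of u v])
    show "compact C" "connected C" using is_arcD[OF C(3)] by auto
    show "C \<subseteq> bdry \<union> inside bdry" using C(4) located_bdry[OF C(1)] located_bdry[OF C(2)] by blast
    show "u \<in> closure (D - {u, v})" "v \<in> closure (D - {u, v})" using DD by auto
    show "u \<in> bdry - c2 - C" "v \<in> bdry - c1 - C"
      using uC vC u2 v1 located_bdry[OF D(1)] located_bdry[OF D(2)] by auto
  qed
  then show ?thesis by blast
qed

text \<open>The ends of an edge have only the position \<open>2 * m + 1\<close> between them, so an
  interleaving chord ends on the edge itself. For the last edge \<open>nxt m = 0\<close>, and
  \<open>2 * m + 1\<close> is the only position above \<open>2 * m\<close>.\<close>

lemma edge_chord_meets: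
  assumes m: "m < n" "{a, b} = {2 * m, 2 * nxt m}" and D: "located c u" "located d v" "u \<in> D" "v \<in> D"
    and s: "sep a b c d"
  shows "edge m \<inter> D \<noteq> {}"
proof -
  have lt: "c < 2 * n" "d < 2 * n" using D unfolding located_def by auto
  have s': "sep (2 * m) (2 * nxt m) c d" using m(2) s unfolding doubleton_eq_iff sep_def by auto
  have "c = 2 * m + 1 \<or> d = 2 * m + 1"
  proof (cases "Suc m = n")
    case True
    then have "nxt m = 0" by simp
    then show ?thesis using s' lt True unfolding sep_def by auto
  next
    case False
    then have "nxt m = Suc m" using m(1) by simp
    then show ?thesis using s' unfolding sep_def by auto
  qed
  then show ?thesis using D located_edge[OF m(1)] by blast
qed

text \<open>Swapping the ends of either arc brings two interleaving proper chords into the order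
  required by \<open>proper_chords_meet\<close>.\<close>

lemma chords_meet:
  assumes C: "chord C a b" and D: "chord D c d" and s: "sep a b c d"
  shows "C \<inter> D \<noteq> {}"
proof -
  obtain x y where C: "located a x" "located b y" "is_arc C x y"
     "C - {x, y} \<subseteq> inside bdry \<or> (\<exists>m<n. C = edge m \<and> {a, b} = {2 * m, 2 * nxt m})"
    using C unfolding chord_def by blast
  obtain u v where D: "located c u" "located d v" "is_arc D u v"
     "D - {u, v} \<subseteq> inside bdry \<or> (\<exists>m<n. D = edge m \<and> {c, d} = {2 * m, 2 * nxt m})"
    using D unfolding chord_def by blast
  note ends = is_arcD(3,4)[OF C(3)] is_arcD(3,4)[OF D(3)]
  have s2: "sep c d a b" using s unfolding sep_def by auto
  consider m where "m < n" "C = edge m" "{a, b} = {2 * m, 2 * nxt m}"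
    | m where "m < n" "D = edge m" "{c, d} = {2 * m, 2 * nxt m}"
    | "C - {x, y} \<subseteq> inside bdry" "D - {u, v} \<subseteq> inside bdry" using C(4) D(4) by blast
  then show ?thesis
  proof cases
    case 1
    then show ?thesis using edge_chord_meets[OF 1(1,3) D(1,2) ends(3,4) s] by simp
  next
    case 2
    then show ?thesis using edge_chord_meets[OF 2(1,3) C(1,2) ends(1,2) s2] by (simp add: Int_commute)
  next
    case 3
    have C': "is_arc C y x" "C - {y, x} \<subseteq> inside bdry" using is_arcD(9)[OF C(3)] 3 by (auto simp: insert_commute)
    have D': "is_arc D v u" "D - {v, u} \<subseteq> inside bdry" using is_arcD(9)[OF D(3)] 3 by (auto simp: insert_commute)
    have ne: "a \<noteq> b" "a \<noteq> c" "a \<noteq> d" "b \<noteq> c" "b \<noteq> d" using s by (auto simp: sep_def)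
    have xor: "(a < c \<and> c < b \<or> b < c \<and> c < a) \<noteq> (a < d \<and> d < b \<or> b < d \<and> d < a)"
      using s by (simp add: sep_def)
    show ?thesis
    proof (cases "a < c \<and> c < b \<or> b < c \<and> c < a")
      case True
      then have nd: "\<not> (a < d \<and> d < b \<or> b < d \<and> d < a)" using xor by blast
      from True show ?thesis
      proof (elim disjE conjE)
        assume "a < c" "c < b"
        then show ?thesis using nd ne by (intro proper_chords_meet[OF C(1-3) 3(1) D(1-3) 3(2)]) auto
      next
        assume "b < c" "c < a"
        then show ?thesis using nd ne by (intro proper_chords_meet[OF C(2,1) C' D(1-3) 3(2)]) auto
      qed
    next
      case False
      then have "a < d \<and> d < b \<or> b < d \<and> d < a" using xor by blast
      then show ?thesis
      proof (elim disjE conjE)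
        assume "a < d" "d < b"
        then show ?thesis using False ne by (intro proper_chords_meet[OF C(1-3) 3(1) D(2,1) D']) auto
      next
        assume "b < d" "d < a"
        then show ?thesis using False ne by (intro proper_chords_meet[OF C(2,1) C' D(2,1) D']) auto
      qed
    qed
  qed
qed

end

lemma image_endpoints: "f ` {s..t} - {f s, f t} \<subseteq> f ` {s<..<t :: real}"
proof -
  have "{s..t} \<subseteq> insert s (insert t {s<..<t})" by auto
  from image_mono[OF this, of f] show ?thesis by auto
qed

lemma sep_walk: fixes i j k m :: nat assumes "i < j"
  shows "k \<noteq> i \<and> k \<noteq> j \<and> (i \<le> k \<and> k \<le> j \<and> (j \<le> m \<or> m < i) \<or> (j \<le> k \<or> k \<le> i) \<and> i \<le> m \<and> m < j) \<longleftrightarrow> sep (2*i) (2*j) (2*k) (2*m+1)"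
proof -
  have e: "2 * v < 2 * m + 1 \<longleftrightarrow> v \<le> m" "2 * m + 1 < 2 * v \<longleftrightarrow> m < v" "2 * v < 2 * w \<longleftrightarrow> v < w" "2 * v \<noteq> 2 * m + 1" for v w :: nat
    by presburger+
  have d: "2 * m + 1 \<noteq> 2 * v" for v :: nat by presburger
  show ?thesis unfolding sep_def using assms
    by (cases rule: linorder_cases[of k i]; cases rule: linorder_cases[of k j]; cases "m < i"; cases "m < j"; 
      simp add: e d not_less del: One_nat_def; linarith?)
qed

lemma sep_swap: "sep b a c d \<longleftrightarrow> sep a b c d"
  unfolding sep_def by auto

lemma mod_less_twice: "a < 2 * n \<Longrightarrow> a mod n = (if a < n then a else a - n)" for a n :: nat
  by (auto simp: le_mod_geq)

section \<open>Segments and rays of the polygon satisfy the axioms of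
  \<open>visibility\<close>\<close>

context ppoly
begin

lemma ext_vis: "ext i k a \<Longrightarrow> vis i k" and ext_odd: "ext i k a \<Longrightarrow> odd a"
  unfolding ext_def exit_at_def by auto

lemma segment_chord:
  assumes v: "vis i k" and f: "param (lin i k) f" "f s = p i" "f t = p k" "s < t"
  shows "chord (f ` {s..t}) (2 * i) (2 * k)"
proof -
  have arc: "is_arc (f ` {s..t}) (p i) (p k)"
    using subsegment_is_arc[OF f(1), of s t] subsegment_le[OF f(1), of s t] f by simp
  have "f ` {s..t} - {p i, p k} \<subseteq> f ` {s<..<t}"
    using image_endpoints[of f s t] f(2,3) by simp
  note * = this
  have "f ` {s..t} - {p i, p k} \<subseteq> inside bdry \<or> (\<exists>m<n. f ` {s..t} = edge m \<and> {2 * i, 2 * k} = {2 * m, 2 * nxt m})"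
  proof -
    have "{2 * i, 2 * k} = {2 * m, 2 * nxt m}" if "{i, k} = {m, nxt m}" for m
      using that by (metis image_empty image_insert)
    then show ?thesis using vis_interior[OF v f] * by blast
  qed
  then show ?thesis using arc visD(1,2)[OF v] located_vertex unfolding chord_def by blast
qed

lemma exit_chord:
  assumes e: "ext i k a" and f: "param (lin i k) f" "f s = p i" "f t = p k" "s < t"
  obtains r where "t < r" "chord (f ` {t..r}) (2 * k) a" "located a (f r)"
proof -
  obtain r where r: "t < r" "located a (f r)" "f ` {t<..<r} \<subseteq> inside bdry"
    using ext_param[OF e f] by metis
  have arc: "is_arc (f ` {t..r}) (p k) (f r)"
    using subsegment_is_arc[OF f(1), of t r] subsegment_le[OF f(1), of t r] f r(1) by simp
  have "f ` {t..r} - {p k, f r} \<subseteq> f ` {t<..<r}"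
    using image_endpoints[of f t r] f(3) by simp
  then have "f ` {t..r} - {p k, f r} \<subseteq> inside bdry" using r(3) by blast
  then have "chord (f ` {t..r}) (2 * k) a"
    using arc r(2) located_vertex[OF visD(2)[OF ext_vis[OF e]]] unfolding chord_def by blast
  then show thesis using that r by blast
qed

lemma piece_vis: "piece vis ext i k a b \<Longrightarrow> vis i k"
  by (erule piece.cases) (auto dest: ext_vis simp: vis_commute[of k i])

lemma exit_chord_back:
  assumes e: "ext k i a" and f: "param (lin i k) f" "f s = p i" "f t = p k" "s < t"
  obtains r where "r < s" "chord (f ` {r..s}) (2 * i) a" "located a (f r)"
proof -
  have f': "param (lin k i) (\<lambda>u. f (- u))" using param_uminus[OF f(1)] lin_commute[of i k] by simp
  have ends: "f (- (- t)) = p k" "f (- (- s)) = p i" "- t < - s" using f by auto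
  obtain r where r: "- s < r" "chord ((\<lambda>u. f (- u)) ` {- s..r}) (2 * i) a" "located a (f (- r))"
    by (rule exit_chord[OF e f' ends])
  have "(\<lambda>u. f (- u)) ` {- s..r} = f ` uminus ` {- s..r}" by (rule image_image[symmetric])
  also have "uminus ` {- s..r} = {- r..s}" by simp
  finally show thesis using that[of "- r"] r by simp
qed

lemma piece_chord:
  assumes e: "piece vis ext i k a b" and f: "param (lin i k) f" "f s = p i" "f t = p k" "s < t"
  obtains lo hi where "chord (f ` {lo..hi}) a b" "lo < hi"
    "lo = s \<and> hi = t \<and> a = 2 * i \<and> b = 2 * k \<or> lo = t \<and> a = 2 * k \<and> ext i k b \<or> hi = s \<and> a = 2 * i \<and> ext k i b"
  using e
proof cases
  case seg
  then show ?thesis using that[of s t] segment_chord[OF _ f] f(4) by blast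
next
  case ahead
  obtain r where "t < r" "chord (f ` {t..r}) (2 * k) b" using exit_chord[OF ahead(2) f] by metis
  then show ?thesis using that[of t r] ahead by blast
next
  case behind
  obtain r where "r < s" "chord (f ` {r..s}) (2 * i) b" using exit_chord_back[OF behind(2) f] by metis
  then show ?thesis using that[of r s] behind by blast
qed

text \<open>In a parametrization of the line the three pieces are consecutive intervals with the two
  vertices as common ends; by \<open>ext_unique\<close> two pieces of the same kind agree.\<close>

lemma pieces_disjoint:
  assumes e: "piece vis ext i k a b" "piece vis ext i k a' b'"
  obtains C C' where "chord C a b" "chord C' a' b'" "C \<subseteq> lin i k" "C' \<subseteq> lin i k"
    "C \<inter> C' \<subseteq> verts \<or> {a, b} = {a', b'}" "p i \<in> C \<longrightarrow> a = 2 * i"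
proof -
  note V = visD[OF piece_vis[OF e(1)]]
  obtain f s t where f: "param (lin i k) f" "f s = p i" "f t = p k" "s < t"
    using lin_param[OF V(1-3)] by metis
  note inj = param_eq_iff[OF f(1)]
  obtain lo hi where 1: "chord (f ` {lo..hi}) a b" "lo < hi"
    "lo = s \<and> hi = t \<and> a = 2 * i \<and> b = 2 * k \<or> lo = t \<and> a = 2 * k \<and> ext i k b \<or> hi = s \<and> a = 2 * i \<and> ext k i b"
    using piece_chord[OF e(1) f] by metis
  obtain lo' hi' where 2: "chord (f ` {lo'..hi'}) a' b'" "lo' < hi'"
    "lo' = s \<and> hi' = t \<and> a' = 2 * i \<and> b' = 2 * k \<or> lo' = t \<and> a' = 2 * k \<and> ext i k b' \<or> hi' = s \<and> a' = 2 * i \<and> ext k i b'"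
    using piece_chord[OF e(2) f] by metis
  have "f ` {lo..hi} \<inter> f ` {lo'..hi'} \<subseteq> f ` {s, t}" if ne: "{a, b} \<noteq> {a', b'}"
  proof -
    have "{lo..hi} \<inter> {lo'..hi'} \<subseteq> {s, t}"
      using 1(2,3) 2(2,3) ne f(4) ext_unique[of i k b b'] ext_unique[of k i b b'] by auto
    then show ?thesis using param_basic(3)[OF f(1)] by (metis image_Int image_mono)
  qed
  then have "f ` {lo..hi} \<inter> f ` {lo'..hi'} \<subseteq> verts \<or> {a, b} = {a', b'}" using f(2,3) V by auto
  moreover have "p i \<in> f ` {lo..hi} \<longrightarrow> a = 2 * i"
    using f(2,4) inj 1(3) by (auto simp: f(2)[symmetric])
  ultimately show thesis using that[OF 1(1) 2(1)] param_basic(4)[OF f(1)] by blast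
qed

text \<open>The chords could only meet in \<open>p i\<close>, which would then be an end of both,
  contrary to the distinctness in \<open>sep\<close>.\<close>

lemma pieces_at_vertex:
  assumes e: "piece vis ext i k a b" "piece vis ext i l c d" and "k \<noteq> l"
  shows "\<not> sep a b c d"
proof
  assume s: "sep a b c d"
  obtain C where C: "chord C a b" "C \<subseteq> lin i k" "p i \<in> C \<longrightarrow> a = 2 * i" using pieces_disjoint[OF e(1,1)] by metis
  obtain D where D: "chord D c d" "D \<subseteq> lin i l" "p i \<in> D \<longrightarrow> c = 2 * i" using pieces_disjoint[OF e(2,2)] by metis
  obtain w where w: "w \<in> C" "w \<in> D" using chords_meet[OF C(1) D(1) s] by blast
  note V = visD(1-3)[OF piece_vis[OF e(1)]] and U = visD(1-3)[OF piece_vis[OF e(2)]]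
  have "lin i k \<noteq> lin i l" using lin_eq_iff[OF V U] \<open>k \<noteq> l\<close> by (auto simp: doubleton_eq_iff)
  then have "w = p i" using meet_unique[OF lin(1)[OF V] lin(1)[OF U]] w C(2) D(2) lin(2)[OF V] lin(2)[OF U] by blast
  then show False using w C(3) D(3) s by (simp add: sep_def)
qed

lemma pieces_cross_once:
  assumes e: "piece vis ext i k a b" "piece vis ext i k a' b'" "piece vis ext j l c d" "piece vis ext j l c' d'"
    and dist: "distinct [i, k, j, l]" and s: "sep a b c d" "sep a' b' c' d'"
  shows "{a, b} = {a', b'} \<and> {c, d} = {c', d'}"
proof -
  obtain C C' where C: "chord C a b" "chord C' a' b'" "C \<subseteq> lin i k" "C' \<subseteq> lin i k"
    "C \<inter> C' \<subseteq> verts \<or> {a, b} = {a', b'}" using pieces_disjoint[OF e(1,2)] by metis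
  obtain D D' where D: "chord D c d" "chord D' c' d'" "D \<subseteq> lin j l" "D' \<subseteq> lin j l"
    "D \<inter> D' \<subseteq> verts \<or> {c, d} = {c', d'}" using pieces_disjoint[OF e(3,4)] by metis
  obtain w where w: "w \<in> C" "w \<in> D" using chords_meet[OF C(1) D(1) s(1)] by blast
  obtain w' where w': "w' \<in> C'" "w' \<in> D'" using chords_meet[OF C(2) D(2) s(2)] by blast
  note V = visD(1-3)[OF piece_vis[OF e(1)]] and U = visD(1-3)[OF piece_vis[OF e(3)]]
  have "lin i k \<noteq> lin j l" using lin_eq_iff[OF V U] dist by (auto simp: doubleton_eq_iff)
  then have "w' = w" using meet_unique[OF lin(1)[OF V] lin(1)[OF U]] w w' C(3,4) D(3,4) by blast
  moreover have "w \<notin> verts"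
  proof
    assume "w \<in> verts"
    then obtain v where "v < n" "w = p v" by auto
    then have "v = i \<or> v = k" "v = j \<or> v = l" using lin_vertex[OF V, of v] lin_vertex[OF U, of v] w C(3) D(3) by auto
    then show False using dist by auto
  qed
  ultimately show ?thesis using w w' C(5) D(5) by blast
qed

text \<open>The two rays of a line are disjoint. If both ended on one edge, the line would contain
  this edge, which would then be the segment between the rays.\<close>

lemma both_exits:
  assumes e: "ext i k x" "ext k i z"
  shows "x \<noteq> z \<and> \<not> sep (2 * k) x (2 * i) z"
proof -
  note V = visD[OF ext_vis[OF e(1)]]
  obtain f s t where f: "param (lin i k) f" "f s = p i" "f t = p k" "s < t"
    using lin_param[OF V(1-3)] by metis
  obtain r where r: "t < r" "chord (f ` {t..r}) (2 * k) x" "located x (f r)" using exit_chord[OF e(1) f] by metis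
  obtain q where q: "q < s" "chord (f ` {q..s}) (2 * i) z" "located z (f q)" using exit_chord_back[OF e(2) f] by metis
  have "{t..r} \<inter> {q..s} = {}" using f(4) by auto
  then have "f ` {t..r} \<inter> f ` {q..s} = {}" using param_basic(3)[OF f(1)] by (metis image_Int image_empty)
  then have 1: "\<not> sep (2 * k) x (2 * i) z" using chords_meet[OF r(2) q(2)] by blast
  have "x \<noteq> z"
  proof
    assume "x = z"
    obtain m where m: "x = 2 * m + 1" "m < n" using e(1) unfolding ext_def exit_at_def by blast
    have in_e: "f r \<in> edge m" "f q \<in> edge m" using r(3) q(3) \<open>x = z\<close> m located_edge by auto
    have "lin m (nxt m) = lin i k"
    proof (rule ccontr)
      assume ne: "lin m (nxt m) \<noteq> lin i k"
      have "f r = f q"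
        using meet_unique[OF lin(1)[OF m(2) next_vertex(1,3)[OF m(2)]] lin(1)[OF V(1-3)] ne]
          in_e edge_subset_lin[OF m(2)] param_basic(4)[OF f(1)] by blast
      then show False using param_eq_iff[OF f(1)] f(4) r(1) q(1) by auto
    qed
    then have "{m, nxt m} = {i, k}" using lin_eq_iff[OF m(2) next_vertex(1,3)[OF m(2)] V(1-3)] by blast
    then have "edge m = seg p \<L> i k" using seg_commute unfolding bd_edge_def doubleton_eq_iff by metis
    then show False using in_e(1) seg_param[OF f] r(1) by (auto simp: param_eq_iff[OF f(1)])
  qed
  with 1 show ?thesis by blast
qed

section \<open>Boundary walks expressed by \<open>sep\<close>\<close>

lemma walk_verts_iff:
  assumes "i < n" "j < n" "i \<noteq> j"
  shows "k \<in> walk_verts n i j \<longleftrightarrow> k < n \<and> (if i < j then i \<le> k \<and> k \<le> j else i \<le> k \<or> k \<le> j)"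
proof -
  define w where "w = (j + n - i) mod n"
  have w: "w = (if i < j then j - i else j + n - i)"
    using assms unfolding w_def by (auto simp: mod_if)
  have "k \<in> walk_verts n i j \<longleftrightarrow> (\<exists>d\<le>w. k = (i + d) mod n)" unfolding walk_verts_def w_def by auto
  also have "\<dots> \<longleftrightarrow> k < n \<and> (if i < j then i \<le> k \<and> k \<le> j else i \<le> k \<or> k \<le> j)"
  proof
    assume "\<exists>d\<le>w. k = (i + d) mod n"
    then obtain d where "d \<le> w" "k = (i + d) mod n" by blast
    then show "k < n \<and> (if i < j then i \<le> k \<and> k \<le> j else i \<le> k \<or> k \<le> j)"
      using assms w by (auto simp: mod_less_twice split: if_splits)
  next
    assume k: "k < n \<and> (if i < j then i \<le> k \<and> k \<le> j else i \<le> k \<or> k \<le> j)"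
    show "\<exists>d\<le>w. k = (i + d) mod n"
    proof (cases "i \<le> k")
      case True
      then show ?thesis using k assms w by (intro exI[of _ "k - i"]) (auto split: if_splits)
    next
      case False
      then show ?thesis using k assms w by (intro exI[of _ "k + n - i"]) (auto simp: mod_less_twice split: if_splits)
    qed
  qed
  finally show ?thesis .
qed

lemma walk_edges_iff:
  assumes "i < n" "j < n" "i \<noteq> j"
  shows "k \<in> walk_edges n i j \<longleftrightarrow> k < n \<and> (if i < j then i \<le> k \<and> k < j else i \<le> k \<or> k < j)"
proof -
  define w where "w = (j + n - i) mod n"
  have w: "w = (if i < j then j - i else j + n - i)"
    using assms unfolding w_def by (auto simp: mod_if)
  have "k \<in> walk_edges n i j \<longleftrightarrow> (\<exists>d<w. k = (i + d) mod n)" unfolding walk_edges_def w_def by auto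
  also have "\<dots> \<longleftrightarrow> k < n \<and> (if i < j then i \<le> k \<and> k < j else i \<le> k \<or> k < j)"
  proof
    assume "\<exists>d<w. k = (i + d) mod n"
    then obtain d where "d < w" "k = (i + d) mod n" by blast
    then show "k < n \<and> (if i < j then i \<le> k \<and> k < j else i \<le> k \<or> k < j)"
      using assms w by (auto simp: mod_less_twice split: if_splits)
  next
    assume k: "k < n \<and> (if i < j then i \<le> k \<and> k < j else i \<le> k \<or> k < j)"
    show "\<exists>d<w. k = (i + d) mod n"
    proof (cases "i \<le> k")
      case True
      then show ?thesis using k assms w by (intro exI[of _ "k - i"]) (auto split: if_splits)
    next
      case False
      then show ?thesis using k assms w by (intro exI[of _ "k + n - i"]) (auto simp: mod_less_twice split: if_splits)
    qed
  qed
  finally show ?thesis .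
qed

lemma sep_iff_walk:
  assumes "k < n" "m < n" "i < n" "j < n" "i \<noteq> j"
  shows "sep (2 * i) (2 * j) (2 * k) (2 * m + 1) \<longleftrightarrow> k \<noteq> i \<and> k \<noteq> j \<and>
  (k \<in> walk_verts n i j \<and> m \<in> walk_edges n j i \<or> k \<in> walk_verts n j i \<and> m \<in> walk_edges n i j)"
proof (cases "i < j")
  case True
  then show ?thesis using assms sep_walk[OF True, of k m] by (auto simp: walk_verts_iff walk_edges_iff)
next
  case False
  then have "j < i" using assms(5) by simp
  then show ?thesis using assms sep_walk[OF \<open>j < i\<close>, of k m] sep_swap[of "2 * i" "2 * j"]
    by (auto simp: walk_verts_iff walk_edges_iff)
qed

lemma designated_blocker_iff:
  assumes "i < n" "j < n" "i \<noteq> j"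
  shows "designated_blocker n p \<L> i j k \<longleftrightarrow> (\<exists>x. ext i k x \<and> sep (2 * i) (2 * j) (2 * k) x)"
proof -
  have ext: "exits_through n p \<L> i k m \<longleftrightarrow> ext i k (2 * m + 1)"
    if m: "m < n" "vis i k" and "m \<noteq> k" "k \<noteq> nxt m" for m
  proof -
    have "p k \<notin> edge m" using vertex_in_edge[OF visD(2)[OF m(2)] m(1)] that by auto
    then show ?thesis using m unfolding ext_def exit_at_def exits_through_def by auto
  qed
  note ar = sep_iff_walk[OF _ _ assms, symmetric]
  \<comment> \<open>A separating edge is not incident to \<open>k\<close>, so an exit through it
    differs from \<open>p k\<close>, and \<open>exits_through\<close> agrees with
    \<open>ext\<close>.\<close>
  have nb: "m \<noteq> k \<and> k \<noteq> nxt m" if "sep (2 * i) (2 * j) (2 * k) (2 * m + 1)" "m < n" for m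
  proof -
    have nx: "nxt m = (if Suc m = n then 0 else Suc m)" using that(2) by (simp add: mod_Suc)
    show ?thesis
    proof (cases "i < j")
      case True
      then show ?thesis using that assms sep_walk[OF True, of k m] nx by auto
    next
      case False
      then have "j < i" using assms(3) by simp
      then show ?thesis using that assms sep_walk[OF \<open>j < i\<close>, of k m] sep_swap[of "2 * i" "2 * j"] nx by auto
    qed
  qed
  show ?thesis
  proof
    assume "designated_blocker n p \<L> i j k"
    then obtain m where m: "k \<noteq> i" "k \<noteq> j" "vis i k" "exits_through n p \<L> i k m"
      "k \<in> walk_verts n i j \<and> m \<in> walk_edges n j i \<or> k \<in> walk_verts n j i \<and> m \<in> walk_edges n i j"
      unfolding designated_blocker_def by blast
    have mn: "m < n" using m(5) walk_edges_iff assms by auto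
    have "sep (2 * i) (2 * j) (2 * k) (2 * m + 1)" using ar[OF visD(2)[OF m(3)] mn] m by blast
    then show "\<exists>x. ext i k x \<and> sep (2 * i) (2 * j) (2 * k) x" using ext[OF mn m(3)] m(4) nb mn by blast
  next
    assume "\<exists>x. ext i k x \<and> sep (2 * i) (2 * j) (2 * k) x"
    then obtain m where m: "ext i k (2 * m + 1)" "m < n" "vis i k" "sep (2 * i) (2 * j) (2 * k) (2 * m + 1)"
      unfolding ext_def exit_at_def by blast
    then have "exits_through n p \<L> i k m" using ext nb by blast
    then show "designated_blocker n p \<L> i j k"
      using ar[OF visD(2)[OF m(3)] m(2)] m unfolding designated_blocker_def by blast
  qed
qed

end

section \<open>The next visible vertex along a wall\<close>

lemma param_ray_outside:
  assumes "jordan J" "param L k"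
  shows "(\<And>v. t < v \<Longrightarrow> k v \<notin> J) \<Longrightarrow> k ` {t<..} \<subseteq> outside J"
    and "(\<And>v. v < t \<Longrightarrow> k v \<notin> J) \<Longrightarrow> k ` {..<t} \<subseteq> outside J"
proof -
  assume "\<And>v. t < v \<Longrightarrow> k v \<notin> J"
  then have "k ` {t<..} \<inter> J = {}" by auto
  then show "k ` {t<..} \<subseteq> outside J"
    by (rule unbounded_outside[OF assms(1) param_connected[OF assms(2) is_interval_oi] _ param_unbounded(1)[OF assms(2)]])
next
  assume "\<And>v. v < t \<Longrightarrow> k v \<notin> J"
  then have "k ` {..<t} \<inter> J = {}" by auto
  then show "k ` {..<t} \<subseteq> outside J"
    by (rule unbounded_outside[OF assms(1) param_connected[OF assms(2) is_interval_io] _ param_unbounded(2)[OF assms(2)]])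
qed

text \<open>
  The wall \<open>f ` {s..r}\<close> leads from \<open>p i\<close> through the polygon to a point \<open>f r = h c\<close> of the edge \<open>m\<close>,
  which may be \<open>p m\<close>. \<open>Ch\<close> is the part of the boundary from there on to \<open>p i\<close>; it consists of the
  rest \<open>h ` {c..d}\<close> of that edge and of the edges in \<open>\<Lambda>\<close>. The set \<open>Z\<close> shows which of the two
  sides of the wall is outside the curve \<open>Q\<close> formed by the wall and \<open>Ch\<close>.
\<close>

locale wall = ppoly n p \<L> for n p \<L> +
  fixes i m :: nat and Lw :: "complex set" and f h :: "real \<Rightarrow> complex" and s r c d :: real
    and Ch :: "complex set" and \<Lambda> :: "nat set" and Z :: "complex set"
  assumes i_less: "i < n" and m_less: "m < n"
    and Lw: "Lw \<in> \<L>" "param Lw f" "f s = p i" "s < r" "f ` {s..r} \<inter> outside bdry = {}"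
    and h: "param (lin m (nxt m)) h" "h c = f r" "h d = p (nxt m)" "c < d" "h ` {c..d} \<subseteq> edge m"
    and pm: "p m \<in> h ` {..c}" and pi: "p i \<notin> lin m (nxt m)"
    and Ch: "is_arc Ch (f r) (p i)" "Ch \<subseteq> bdry" "f ` {s..r} \<inter> Ch \<subseteq> {f r, p i}"
      "Ch = h ` {c..d} \<union> \<Union> (edge ` \<Lambda>)"
    and \<Lambda>: "\<Lambda> \<subseteq> {..<n} - {m}" "\<And>l. l \<in> \<Lambda> \<Longrightarrow> edge l \<inter> f ` {s..r} \<subseteq> {p i}"
    and Z: "f r \<in> closure Z" "Z \<subseteq> f ` {r<..} \<union> h ` {..<c}" "Z \<subseteq> outside (f ` {s..r} \<union> Ch)"
begin

abbreviation "M \<equiv> lin m (nxt m)"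
definition "Q = f ` {s..r} \<union> Ch"
definition "tri e q a b = f ` {s..r} \<union> h ` {c..e} \<union> q ` {a..b :: real}"

lemma M: "M \<in> \<L>" "M \<noteq> Lw"
  using lin(1)[OF m_less next_vertex(1,3)[OF m_less]] pi param_basic(4)[OF Lw(2), of s] Lw(3) by auto

lemma f_eq: "f u = f v \<longleftrightarrow> u = v" and h_eq: "h u = h v \<longleftrightarrow> u = v"
  using param_eq_iff Lw(2) h(1) by blast+

lemma f_on: "f u \<in> Lw" and h_on: "h u \<in> M"
  using param_basic(4) Lw(2) h(1) by blast+

lemma f_h: "f u = h v \<longleftrightarrow> u = r \<and> v = c"
proof
  assume e: "f u = h v"
  have "f u = f r" using meet_unique[OF Lw(1) M(1) M(2)[symmetric] f_on _ f_on] e h_on h(2) by metis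
  then show "u = r \<and> v = c" using e h(2) f_eq h_eq by metis
qed (use h(2) in simp)

lemma h_f: "h v = f u \<longleftrightarrow> u = r \<and> v = c"
  using f_h by metis

lemma f_arc: "u < v \<Longrightarrow> is_arc (f ` {u..v}) (f u) (f v)"
  using subsegment_is_arc[OF Lw(2), of u v] subsegment_le[OF Lw(2), of u v] by simp

lemma h_arc: "u < v \<Longrightarrow> is_arc (h ` {u..v}) (h u) (h v)"
  using subsegment_is_arc[OF h(1), of u v] subsegment_le[OF h(1), of u v] by simp

lemma jordan_Q: "jordan Q"
  unfolding Q_def
  by (rule jordan_two_arcs[of _ "p i" "f r"]) (use f_arc[OF Lw(4)] Lw(3) Ch in auto)

lemma Q_nest: "outside bdry \<subseteq> outside Q" "bdry - Q \<subseteq> outside Q" "inside Q \<subseteq> inside bdry"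
proof -
  have "Q \<subseteq> bdry \<union> inside bdry" using Lw(5) Ch(2) regions(1) unfolding Q_def by blast
  from jordan_nest[OF jordan_bdry jordan_Q this]
  show "outside bdry \<subseteq> outside Q" "bdry - Q \<subseteq> outside Q" "inside Q \<subseteq> inside bdry" .
qed

text \<open>Distinct edges share only vertices. If the shared one is \<open>p m\<close>, it must be
  \<open>f r\<close>; but edges of \<open>\<Lambda>\<close> meet the wall at most in
  \<open>p i\<close>, which is not on the line of edge \<open>m\<close>.\<close>

lemma edge_h:
  assumes "l \<in> \<Lambda>" "z \<in> edge l" "z \<in> h ` {c..d}"
  shows "z = h d"
proof -
  have l: "l < n" "l \<noteq> m" using assms(1) \<Lambda>(1) by auto
  have zm: "z \<in> edge m" using assms(3) h(5) by blast
  from edges_meet[OF l(1) m_less l(2) assms(2) zm] show ?thesis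
  proof (elim disjE conjE)
    assume "m = nxt l" and z: "z = p m"
    obtain v where v: "v \<le> c" "p m = h v" using pm by auto
    obtain w where w: "c \<le> w" "z = h w" using assms(3) by auto
    have "v = w" using v(2) w(2) z h_eq by metis
    then have "z = f r" using v(1) w h(2) by simp
    then have "z = p i" using \<Lambda>(2)[OF assms(1)] assms(2) Lw(4) by auto
    then show ?thesis using zm edge_subset_lin[OF m_less] pi by blast
  next
    assume "l = nxt m" "z = p l"
    then show ?thesis using h(3) by simp
  qed
qed

end

text \<open>The pseudo-triangle with corners \<open>p i\<close>, \<open>f r = h c\<close> and
  \<open>h e = q b\<close>. Its sides lie on three distinct lines, which meet in the corners
  only.\<close>

locale triangle = wall +
  fixes N :: "complex set" and q :: "real \<Rightarrow> complex" and a b e :: real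
  assumes N: "N \<in> \<L>" "N \<noteq> Lw" "param N q" "q a = p i" "a < b" "q b = h e" and e: "c < e" "e \<le> d"
begin

abbreviation "T \<equiv> tri e q a b"

lemma q_eq: "q u = q v \<longleftrightarrow> u = v" and q_on: "q u \<in> N"
  using param_eq_iff param_basic(4) N(3) by blast+

lemma M_N: "M \<noteq> N" using pi N(4) q_on by metis

lemma f_q: "f u = q v \<longleftrightarrow> u = s \<and> v = a"
proof
  assume e: "f u = q v"
  have "f u = f s" using meet_unique[OF Lw(1) N(1) N(2)[symmetric] f_on _ f_on] e q_on N(4) Lw(3) by metis
  then show "u = s \<and> v = a" using e N(4) Lw(3) f_eq q_eq by metis
qed (use N(4) Lw(3) in simp)

lemma h_q: "h u = q v \<longleftrightarrow> u = e \<and> v = b"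
proof
  assume e: "h u = q v"
  have "h u = h e" using meet_unique[OF M(1) N(1) M_N h_on _ h_on] e q_on N(6) by metis
  then show "u = e \<and> v = b" using e N(6) h_eq q_eq by metis
qed (use N(6) in simp)

lemma q_f: "q v = f u \<longleftrightarrow> u = s \<and> v = a" and q_h: "q v = h u \<longleftrightarrow> u = e \<and> v = b"
  using f_q h_q by metis+

lemma q_arc: "u < v \<Longrightarrow> is_arc (q ` {u..v}) (q u) (q v)"
  using subsegment_is_arc[OF N(3), of u v] subsegment_le[OF N(3), of u v] by simp

lemma jordan_T: "jordan T"
proof -
  have 1: "is_arc (f ` {s..r} \<union> h ` {c..e}) (p i) (h e)"
    by (rule is_arc_join[of _ _ "f r"]) (use f_arc[OF Lw(4)] h_arc[OF e(1)] Lw(3) h(2) f_h in auto)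
  show ?thesis unfolding tri_def
    by (rule jordan_two_arcs[OF 1]) (use is_arcD(9)[OF q_arc[OF N(5)]] N(4,6) Lw(3) q_f q_h in auto)
qed

lemma mem_T_iff:
  shows "f u \<in> T \<longleftrightarrow> s \<le> u \<and> u \<le> r" and "h u \<in> T \<longleftrightarrow> c \<le> u \<and> u \<le> e"
    and "q u \<in> T \<longleftrightarrow> a \<le> u \<and> u \<le> b"
  unfolding tri_def Un_iff image_iff Bex_def atLeastAtMost_iff f_eq h_eq q_eq f_h h_f f_q q_f h_q q_h
  using Lw(4) N(5) e(1) by auto

lemma f_beyond: "f ` {r<..} \<subseteq> outside T" "f ` {..<s} \<subseteq> outside T"
  using param_ray_outside[OF jordan_T Lw(2)] mem_T_iff by auto

lemma h_beyond: "h ` {e<..} \<subseteq> outside T" "h ` {..<c} \<subseteq> outside T"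
  using param_ray_outside[OF jordan_T h(1)] mem_T_iff by auto

lemma q_beyond: "q ` {b<..} \<subseteq> outside T" "q ` {..<a} \<subseteq> outside T"
  using param_ray_outside[OF jordan_T N(3)] mem_T_iff by auto

text \<open>Beyond its side each line continues in two unbounded rays that miss \<open>T\<close> and
  hence lie outside.\<close>

lemma lines_not_inside: "Lw \<inter> inside T = {}" "N \<inter> inside T = {}"
proof -
  have T: "z \<notin> inside T" if "z \<in> T \<or> z \<in> outside T" for z using that jordanD(10,11)[OF jordan_T] by blast
  show "Lw \<inter> inside T = {}"
  proof -
    have "f u \<in> T \<or> f u \<in> outside T" for u
      using mem_T_iff(1)[of u] f_beyond by (metis greaterThan_iff image_subset_iff lessThan_iff not_le)
    then show ?thesis using T param_basic(6)[OF Lw(2)] by blast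
  qed
  show "N \<inter> inside T = {}"
  proof -
    have "q u \<in> T \<or> q u \<in> outside T" for u
      using mem_T_iff(3)[of u] q_beyond by (metis greaterThan_iff image_subset_iff lessThan_iff not_le)
    then show ?thesis using T param_basic(6)[OF N(3)] by blast
  qed
qed

lemma edge_T:
  assumes "l \<in> \<Lambda>" "z \<in> edge l" "z \<in> T"
  shows "z \<in> N"
proof -
  from assms(3) consider "z \<in> f ` {s..r}" | "z \<in> h ` {c..e}" | "z \<in> q ` {a..b}" unfolding tri_def by blast
  then show ?thesis
  proof cases
    case 1
    then have "z = p i" using \<Lambda>(2)[OF assms(1)] assms(2) by blast
    then show ?thesis using q_on[of a] N(4) by simp
  next
    case 2
    then have "z = h d" using edge_h[OF assms(1,2)] e by auto
    then have "e = d" using 2 e h_eq by auto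
    then show ?thesis using \<open>z = h d\<close> q_on[of b] N(6) by simp
  next
    case 3
    then show ?thesis using q_on by auto
  qed
qed

text \<open>The wall and edge \<open>m\<close> stay out of the inside, so only an edge of
  \<open>\<Lambda>\<close> could enter. With no end there, it would meet \<open>T\<close> before and
  after; by \<open>edge_T\<close> both times on \<open>N\<close>, so it would lie on
  \<open>N\<close>, which does not enter.\<close>

lemma Q_not_inside:
  assumes nov: "\<And>v. v < n \<Longrightarrow> p v \<notin> inside T"
  shows "Q \<inter> inside T = {}"
proof (rule ccontr)
  assume "Q \<inter> inside T \<noteq> {}"
  then obtain z where z: "z \<in> Q" "z \<in> inside T" by blast
  have T: "z \<notin> T" "z \<notin> outside T" using z(2) jordanD(10,11)[OF jordan_T] by blast+
  have "z \<notin> f ` {s..r}" using T(1) unfolding tri_def by blast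
  moreover have "z \<notin> h ` {c..d}"
  proof
    assume "z \<in> h ` {c..d}"
    then obtain v where v: "z = h v" "c \<le> v" by auto
    then have "v \<le> e \<or> h v \<in> h ` {e<..}" by auto
    then show False using v T mem_T_iff(2)[of v] h_beyond(1) by blast
  qed
  ultimately obtain l where l: "l \<in> \<Lambda>" "z \<in> edge l" using z(1) Ch(4) unfolding Q_def by auto
  then have ln: "l < n" using \<Lambda>(1) by auto
  obtain k s2 t2 where k: "param (lin l (nxt l)) k" "k s2 = p l" "k t2 = p (nxt l)" "s2 < t2" "edge l = k ` {s2..t2}"
    using edge_param[OF ln] by metis
  obtain w where w: "s2 \<le> w" "w \<le> t2" "z = k w" using l(2) k(5) by auto
  have lin: "lin l (nxt l) \<in> \<L>" using lin(1)[OF ln next_vertex(1,3)[OF ln]] .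
  have meets: "\<exists>v\<in>S. k v \<in> T" if "is_interval S" "w \<in> S" "w' \<in> S" "k w' \<notin> inside T" for S w'
  proof (rule ccontr)
    assume "\<not> (\<exists>v\<in>S. k v \<in> T)"
    then have "k ` S \<inter> T = {}" by auto
    then have "k ` S \<subseteq> inside T \<or> k ` S \<subseteq> outside T"
      by (rule inside_or_outside[OF jordan_T param_connected[OF k(1) that(1)]])
    then show False using that T(2) w(3) by blast
  qed
  obtain u1 where u1: "s2 \<le> u1" "u1 \<le> w" "k u1 \<in> T"
    using meets[of "{s2..w}" s2] nov[OF ln] k(2) w by (auto simp: is_interval_cc)
  obtain u2 where u2: "w \<le> u2" "u2 \<le> t2" "k u2 \<in> T"
    using meets[of "{w..t2}" t2] nov[OF next_vertex(1)[OF ln]] k(3) w by (auto simp: is_interval_cc)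
  have "u1 \<noteq> w" "u2 \<noteq> w" using u1 u2 T(1) w(3) by auto
  then have "u1 < u2" using u1 u2 by simp
  have "k u1 \<in> edge l" "k u2 \<in> edge l" using k(5) u1 u2 w by auto
  then have uN: "k u1 \<in> N" "k u2 \<in> N" using edge_T[OF l(1)] u1 u2 by blast+
  have "lin l (nxt l) = N"
  proof (rule ccontr)
    assume "lin l (nxt l) \<noteq> N"
    then have "k u1 = k u2" using meet_unique[OF lin N(1)] uN param_basic(4)[OF k(1)] by blast
    then show False using param_eq_iff[OF k(1)] \<open>u1 < u2\<close> by simp
  qed
  then have "z \<in> N" using w(3) param_basic(4)[OF k(1)] by simp
  then show False using z(2) lines_not_inside(2) by blast
qed

text \<open>Close to the end \<open>f r\<close> of the wall the curves \<open>T\<close> and \<open>Q\<close> agree, and they have the points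
  of \<open>Z\<close> in their common outside; hence their insides agree there as well.\<close>

lemma T_subset_Q:
  assumes nov: "\<And>v. v < n \<Longrightarrow> p v \<notin> inside T"
  shows "T \<subseteq> Q \<union> inside Q"
proof -
  \<comment> \<open>\<open>A\<close> is the corner at \<open>f r\<close> shared by \<open>T\<close>
    and \<open>Q\<close>, cut off at inner points of its two sides; \<open>B\<close> and
    \<open>C\<close> are the remaining parts of \<open>T\<close> and of \<open>Q\<close>.\<close>
  define x1 e1 where "x1 = (s + r) / 2" and "e1 = (c + e) / 2"
  have x1: "s < x1" "x1 < r" and e1: "c < e1" "e1 < e" using Lw(4) e(1) unfolding x1_def e1_def by auto
  define A B C where "A = f ` {x1..r} \<union> h ` {c..e1}" and "B = f ` {s..x1} \<union> q ` {a..b} \<union> h ` {e1..e}"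
    and "C = f ` {s..x1} \<union> (h ` {e1..d} \<union> \<Union> (edge ` \<Lambda>))"
  have split: "k ` {u..w} = k ` {u..v} \<union> k ` {v..w}" if "u \<le> v" "v \<le> w" for k :: "real \<Rightarrow> complex" and u v w
    using that by (metis image_Un ivl_disj_un_two_touch(4))
  have AB: "A \<union> B = T" unfolding A_def B_def tri_def
    using split[of s x1 r f] split[of c e1 e h] x1 e1 by auto
  have "A \<union> C = f ` {s..r} \<union> (h ` {c..d} \<union> \<Union> (edge ` \<Lambda>))" unfolding A_def C_def
    using split[of s x1 r f] split[of c e1 d h] x1 e1 e(2) by auto
  then have AC: "A \<union> C = Q" unfolding Q_def using Ch(4) by simp
  have comp: "compact (k ` {u..v})" if "param L k" for L k and u v :: real
    using param_basic(2)[OF that] by (rule compact_continuous_image) simp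
  note comps = comp[OF Lw(2)] comp[OF h(1)] comp[OF N(3)]
  have "compact A" "compact B" unfolding A_def B_def using comps by (intro compact_Un; blast)+
  have edge_comp: "compact (edge l)" if "l \<in> \<Lambda>" for l
  proof -
    have "l < n" using that \<Lambda>(1) by auto
    then show ?thesis by (metis edge_param comp)
  qed
  have "finite \<Lambda>" using \<Lambda>(1) finite_subset by blast
  then have "compact C" unfolding C_def using comps edge_comp by (intro compact_Un compact_Union) auto
  have "connected B" unfolding B_def
  proof (intro connected_Un)
    show "connected (f ` {s..x1})" "connected (q ` {a..b})" "connected (h ` {e1..e})"
      using param_connected[OF Lw(2)] param_connected[OF N(3)] param_connected[OF h(1)] is_interval_cc by blast+
    show "f ` {s..x1} \<inter> q ` {a..b} \<noteq> {}" using x1 N(4,5) Lw(3) by (auto intro!: image_eqI[of _ q a] image_eqI[of _ f s])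
    have "h e \<in> q ` {a..b}" using N(5,6) by (metis atLeastAtMost_iff image_eqI less_imp_le order_refl)
    moreover have "h e \<in> h ` {e1..e}" using e1 by auto
    ultimately show "(f ` {s..x1} \<union> q ` {a..b}) \<inter> h ` {e1..e} \<noteq> {}" by blast
  qed
  have "A \<inter> C \<subseteq> B"
  proof
    fix z assume z: "z \<in> A \<inter> C"
    consider u where "z = f u" "x1 \<le> u" "u \<le> r" | u where "z = h u" "c \<le> u" "u \<le> e1" using z unfolding A_def by auto
    then show "z \<in> B"
    proof cases
      case 1
      then have "z \<notin> h ` {e1..d}" using e1(1) f_h by auto
      then consider "z \<in> f ` {s..x1}" | l where "l \<in> \<Lambda>" "z \<in> edge l" using z unfolding C_def by auto
      then show ?thesis
      proof cases
        case 2
        then have "z = p i" using \<Lambda>(2)[OF 2(1)] 1 x1(1) by auto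
        then show ?thesis unfolding B_def using x1 Lw(3) by (metis UnI1 atLeastAtMost_iff image_eqI less_imp_le order_refl)
      qed (simp add: B_def)
    next
      case 2
      consider "z \<in> f ` {s..x1}" | "z \<in> h ` {e1..d}" | l where "l \<in> \<Lambda>" "z \<in> edge l" using z unfolding C_def by auto
      then show ?thesis
      proof cases
        case 1 then show ?thesis by (simp add: B_def)
      next
        case hd: 2
        then have "z = h e1" using 2 h_eq by auto
        then show ?thesis unfolding B_def using e1 by auto
      next
        case 3
        then have "z = h d" using edge_h[OF 3] 2 e1 e(2) by auto
        then show ?thesis using 2 h_eq e1 e(2) by auto
      qed
    qed
  qed
  have rB: "f r \<notin> B" unfolding B_def using x1 f_eq f_h f_q Lw(4) e1(1) by auto
  have rC: "f r \<notin> C"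
  proof
    assume "f r \<in> C"
    then have "f r \<in> \<Union> (edge ` \<Lambda>)" unfolding C_def using x1 f_eq f_h e1(1) by auto
    moreover have "f r \<in> f ` {s..r}" using Lw(4) by auto
    ultimately have "f r = p i" using \<Lambda>(2) by blast
    then show False using Lw(3,4) f_eq[of r s] by simp
  qed
  have "open (- (B \<union> C))"
    by (intro open_Compl closed_Un compact_imp_closed \<open>compact B\<close> \<open>compact C\<close>)
  then obtain \<epsilon> where \<epsilon>: "\<epsilon> > 0" "ball (f r) \<epsilon> \<subseteq> - (B \<union> C)" using rB rC open_contains_ball by blast
  obtain z where z: "z \<in> Z" "z \<in> ball (f r) \<epsilon>" using meets_near_closure[OF Z(1), of "ball (f r) \<epsilon>"] \<epsilon>(1) by auto
  have "f r \<in> Q" unfolding Q_def using Lw(4) by auto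
  then have "f r \<in> closure (inside Q)" using jordanD(12)[OF jordan_Q] by blast
  then obtain y where y: "y \<in> inside Q" "y \<in> ball (f r) \<epsilon>"
    using meets_near_closure[of "f r" "inside Q" "ball (f r) \<epsilon>"] \<epsilon>(1) by auto
  have zo: "z \<in> outside Q" "z \<in> outside T"
    using z(1) Z(3) unfolding Q_def by (blast, use z(1) Z(2) f_beyond(1) h_beyond(2) in blast)
  have "connected_component (- (B \<union> C)) y z"
    unfolding connected_component_def using y z \<epsilon> by (intro exI[of _ "ball (f r) \<epsilon>"]) auto
  moreover have "\<not> connected_component (- (A \<union> C)) y z"
    unfolding AC using not_connected_component_inside_outside[OF jordan_Q y(1) zo(1)] .
  ultimately have "\<not> connected_component (- T) y z"
    using separation_transfer[OF \<open>compact A\<close> \<open>compact B\<close> compact_imp_closed[OF \<open>compact C\<close>] \<open>connected B\<close> \<open>A \<inter> C \<subseteq> B\<close>]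
    unfolding AB by blast
  then have "y \<notin> outside T" using connected_component_outside[OF jordan_T _ zo(2)] by blast
  moreover have "y \<notin> T"
  proof
    assume "y \<in> T"
    then have "y \<in> A" using AB y(2) \<epsilon>(2) by blast
    then show False using AC y(1) jordanD(11)[OF jordan_Q] by blast
  qed
  ultimately have "y \<in> inside T" using jordanD(11)[OF jordan_T] by blast
  moreover have "inside T \<subseteq> inside Q \<or> inside T \<subseteq> outside Q"
    using Q_not_inside[OF nov] by (intro inside_or_outside[OF jordan_Q jordanD(5)[OF jordan_T]]) auto
  ultimately have "inside T \<subseteq> inside Q" using y(1) jordanD(10)[OF jordan_Q] by blast
  then have "closure (inside T) \<subseteq> closure (inside Q)" by (rule closure_mono)
  then show ?thesis using jordanD(12)[OF jordan_T] jordanD(12)[OF jordan_Q] by blast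
qed

end

context wall
begin

text \<open>The triangle \<open>T0\<close> contains a vertex because \<open>nxt m\<close> is
  invisible: an empty \<open>T0\<close> would lie in the polygon together with its side to
  \<open>p (nxt m)\<close>. The vertex found lies on \<open>Ch\<close> because boundary points off
  \<open>Q\<close> are outside \<open>Q\<close>.\<close>

lemma next_visible:
  assumes nv: "\<not> vis i (nxt m)"
  obtains v where "v < n" "p v \<in> Ch" "p v \<notin> f ` {s..r}" "ext i v (2 * m + 1)"
proof -
  note nx = next_vertex[OF m_less]
  have i_nx: "i \<noteq> nxt m" using pi lin(3)[OF m_less nx(1,3)] by auto
  define N0 where "N0 = lin i (nxt m)"
  have N0: "N0 \<in> \<L>" "p (nxt m) \<in> N0" using lin[OF i_less nx(1) i_nx] unfolding N0_def by blast+
  have dLw: "h u \<notin> Lw" if "c < u" for u using that param_basic(5)[OF Lw(2), of "h u"] h_f by auto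
  have N0_Lw: "N0 \<noteq> Lw" using N0(2) dLw[OF h(4)] h(3) by auto
  obtain q0 a0 b0 where q0: "param N0 q0" "q0 a0 = p i" "q0 b0 = p (nxt m)" "a0 < b0"
    using lin_param[OF i_less nx(1) i_nx] unfolding N0_def by metis
  interpret T0: triangle n p \<L> i m Lw f h s r c d Ch \<Lambda> Z N0 q0 a0 b0 d
    by unfold_locales (use N0(1) N0_Lw q0 h(3,4) in auto)
  define S where "S = {v. v < n \<and> p v \<in> inside T0.T}"
  have "S \<noteq> {}"
  proof
    assume "S = {}"
    then have "T0.T \<subseteq> Q \<union> inside Q" by (intro T0.T_subset_Q) (auto simp: S_def)
    then have "T0.T \<inter> outside bdry = {}" using Q_nest(1) jordanD(10,11)[OF jordan_Q] by blast
    then have "q0 ` {a0..b0} \<inter> outside bdry = {}" unfolding tri_def by blast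
    then have "vis i (nxt m)"
      using seg_param[OF q0[unfolded N0_def]] i_less nx(1) i_nx unfolding visible_pair_def by simp
    then show False using nv by blast
  qed
  define R where "R v e \<longleftrightarrow> (\<exists>q a b' b. param (lin i v) q \<and> q a = p i \<and> q b' = p v \<and> a < b' \<and> b' < b \<and>
      q b = h e \<and> c < e \<and> e < d)" for v e
  have hit: "v \<noteq> i \<and> lin i v \<noteq> Lw \<and> (\<exists>e. R v e)" if "v \<in> S" for v
  proof -
    have v: "v < n" "p v \<in> inside T0.T" using that unfolding S_def by auto
    have nT: "p v \<notin> T0.T" "p v \<notin> outside T0.T" using v(2) jordanD(10,11)[OF T0.jordan_T] by blast+
    have vi: "v \<noteq> i" using nT(1) T0.mem_T_iff(1)[of s] Lw(3,4) by auto
    note l = lin[OF i_less v(1) vi[symmetric]]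
    have ne: "lin i v \<noteq> Lw" "lin i v \<noteq> N0" using T0.lines_not_inside l(3) v(2) by blast+
    obtain q a b' where q: "param (lin i v) q" "q a = p i" "q b' = p v" "a < b'"
      using lin_param[OF i_less v(1) vi[symmetric]] by metis
    \<comment> \<open>The ray behind \<open>p v\<close> is unbounded and starts inside
      \<open>T0\<close>, so it must hit \<open>T0\<close>. It cannot do so on \<open>Lw\<close> or
      \<open>N0\<close>, whose only common point with it would be \<open>p i\<close>.\<close>
    have "\<not> q ` {b'..} \<inter> T0.T = {}"
    proof
      assume d: "q ` {b'..} \<inter> T0.T = {}"
      have "\<not> bounded (q ` {b'..})"
      proof -
        have "q ` {b'<..} \<subseteq> q ` {b'..}" by (intro image_mono) auto
        then show ?thesis using param_unbounded(1)[OF q(1), of b'] bounded_subset by blast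
      qed
      then have "q ` {b'..} \<subseteq> outside T0.T"
        using param_connected[OF q(1) is_interval_ci] by (intro unbounded_outside[OF T0.jordan_T _ d]) auto
      then show False using nT(2) q(3) by auto
    qed
    then obtain b where b: "b' \<le> b" "q b \<in> T0.T" by auto
    have "b' \<noteq> b" using nT(1) b q(3) by auto
    have pi_only: "q b \<notin> L" if "L \<in> \<L>" "L \<noteq> lin i v" "p i \<in> L" for L
    proof
      assume "q b \<in> L"
      then have "q b = q a"
        using meet_unique[OF that(1) l(1) that(2) _ param_basic(4)[OF q(1)] that(3) l(2)] q(2) by simp
      then show False using param_eq_iff[OF q(1)] q(4) b(1) by simp
    qed
    have "q b \<notin> Lw" "q b \<notin> N0"
      using pi_only[OF Lw(1) ne(1)[symmetric]] pi_only[OF N0(1) ne(2)[symmetric]] f_on[of s] T0.q_on[of a0] Lw(3) q0(2)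
      by auto
    then obtain e where e: "c \<le> e" "e \<le> d" "q b = h e" using b(2) f_on T0.q_on unfolding tri_def by auto
    have "e \<noteq> c" using e(3) h(2) f_on[of r] \<open>q b \<notin> Lw\<close> by auto
    moreover have "e \<noteq> d" using e(3) h(3) N0(2) \<open>q b \<notin> N0\<close> by auto
    ultimately have "R v e" unfolding R_def using q b(1) \<open>b' \<noteq> b\<close> e by (metis le_neq_trans)
    then show ?thesis using vi ne by blast
  qed
  obtain E where E: "\<And>v. v \<in> S \<Longrightarrow> R v (E v)" using hit by metis
  have "finite S" unfolding S_def by simp
  then obtain v where v: "v \<in> S" "\<And>w. w \<in> S \<Longrightarrow> E v \<le> E w"
    using \<open>S \<noteq> {}\<close> arg_min_if_finite[of S E] by (metis linorder_not_less)
  have vn: "v < n" "p v \<in> inside T0.T" using v(1) unfolding S_def by auto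
  define e where "e = E v"
  obtain q a b' b where q: "param (lin i v) q" "q a = p i" "q b' = p v" "a < b'" "b' < b" "q b = h e" "c < e" "e < d"
    using E[OF v(1)] unfolding R_def e_def by blast
  have vi: "v \<noteq> i" "lin i v \<noteq> Lw" using hit[OF v(1)] by auto
  note l = lin[OF i_less vn(1) vi(1)[symmetric]]
  interpret T: triangle n p \<L> i m Lw f h s r c d Ch \<Lambda> Z "lin i v" q a b e
    by unfold_locales (use l(1) vi q in auto)
  have pvT: "p v \<in> T.T" using T.mem_T_iff(3)[of b'] q by simp
  have sub: "T.T \<subseteq> T0.T \<union> inside T0.T"
  proof -
    have q0N: "q0 ` {a0..b0} \<subseteq> N0" using T0.q_on by auto
    have N: "lin i v \<noteq> N0" using T0.lines_not_inside(2) l(3) vn(2) by blast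
    \<comment> \<open>The new side meets \<open>T0\<close> only in its two ends; between them it
      stays in one region, which is the inside because of \<open>p v\<close>.\<close>
    have "q u \<notin> T0.T" if "a < u" "u < b" for u
    proof
      assume "q u \<in> T0.T"
      then consider "q u \<in> f ` {s..r}" | "q u \<in> h ` {c..d}" | "q u \<in> N0"
        using q0N unfolding tri_def by blast
      then show False
      proof cases
        case 3
        then have "q u = q a"
          using meet_unique[OF N0(1) l(1) N[symmetric] _ T.q_on _ l(2)] T0.q_on[of a0] q0(2) q(2) by simp
        then show False using T.q_eq that by simp
      qed (use T.q_f T.q_h that in auto)
    qed
    then have "q ` {a<..<b} \<inter> T0.T = {}" by auto
    then have "q ` {a<..<b} \<subseteq> inside T0.T \<or> q ` {a<..<b} \<subseteq> outside T0.T"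
      by (rule inside_or_outside[OF T0.jordan_T param_connected[OF q(1) is_interval_oo]])
    moreover have ends: "q ` {a..b} \<subseteq> {q a, q b} \<union> q ` {a<..<b}" using image_endpoints[of q a b] by (simp add: Diff_subset_conv)
    moreover have "p v \<in> q ` {a<..<b}" using q by (metis greaterThanLessThan_iff image_eqI)
    ultimately have "q ` {a<..<b} \<subseteq> inside T0.T" using vn(2) jordanD(10)[OF T0.jordan_T] by blast
    moreover have "q a \<in> T0.T" "q b \<in> T0.T" using T0.mem_T_iff(1)[of s] T0.mem_T_iff(2)[of e] q Lw(3,4) by auto
    ultimately have "{q a, q b} \<union> q ` {a<..<b} \<subseteq> T0.T \<union> inside T0.T" by (intro Un_least) auto
    with ends have "q ` {a..b} \<subseteq> T0.T \<union> inside T0.T" by (rule subset_trans)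
    moreover have "h ` {c..e} \<subseteq> h ` {c..d}" using q(8) by auto
    then have "f ` {s..r} \<union> h ` {c..e} \<subseteq> T0.T" unfolding tri_def[of d] by (intro Un_mono le_supI1) auto
    then have "f ` {s..r} \<union> h ` {c..e} \<subseteq> T0.T \<union> inside T0.T" by (rule le_supI1)
    ultimately show ?thesis unfolding tri_def[of e] by (rule Un_least[rotated])
  qed
  note nest = jordan_nest[OF T0.jordan_T T.jordan_T sub]
  \<comment> \<open>The ray to a vertex inside the smaller triangle would hit the edge no later than
    \<open>h e\<close>. Minimality makes the hit \<open>h e\<close> itself, which two distinct lines
    through \<open>p i\<close> cannot share.\<close>
  have nov: "p w \<notin> inside T.T" if "w < n" for w
  proof
    assume w: "p w \<in> inside T.T"
    then have "p w \<in> inside T0.T" using nest(3) by blast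
    then have wS: "w \<in> S" using that unfolding S_def by simp
    obtain k u1 u2 u3 where k: "param (lin i w) k" "k u1 = p i" "k u2 = p w" "u1 < u2" "u2 < u3" "k u3 = h (E w)"
      "c < E w" "E w < d" using E[OF wS] unfolding R_def by blast
    have wi: "w \<noteq> i" "lin i w \<noteq> Lw" using hit[OF wS] by auto
    note lw = lin[OF i_less that wi(1)[symmetric]]
    have ne: "lin i w \<noteq> lin i v" using T.lines_not_inside(2) lw(3) w by blast
    interpret K: triangle n p \<L> i m Lw f h s r c d Ch \<Lambda> Z "lin i w" k u1 u3 "E w"
      by unfold_locales (use lw(1) wi k in auto)
    have k_q: "k x = q y \<Longrightarrow> x = u1" for x y
      using meet_unique[OF lw(1) l(1) ne K.q_on _ lw(2) l(2), of x] T.q_on[of y] k(2) K.q_eq by metis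
    have "k x \<notin> T.T" if "u1 < x" "x < u3" for x
      using that k_q K.q_f K.q_h unfolding tri_def by auto
    then have "k ` {u1<..<u3} \<inter> T.T = {}" by auto
    then have "k ` {u1<..<u3} \<subseteq> inside T.T \<or> k ` {u1<..<u3} \<subseteq> outside T.T"
      by (rule inside_or_outside[OF T.jordan_T param_connected[OF k(1) is_interval_oo]])
    moreover have "p w \<in> k ` {u1<..<u3}" using k by (metis greaterThanLessThan_iff image_eqI)
    ultimately have "k ` {u1<..<u3} \<subseteq> inside T.T" using w jordanD(10)[OF T.jordan_T] by blast
    then have "closure (k ` {u1<..<u3}) \<subseteq> inside T.T \<union> T.T"
      using jordanD(12)[OF T.jordan_T] closure_mono[of "k ` {u1<..<u3}" "inside T.T"] by simp
    moreover have "k u3 \<in> closure (k ` {u1<..<u3})"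
    proof -
      have arc: "is_arc (k ` {u1..u3}) (k u1) (k u3)" by (rule K.q_arc) (use k(4,5) in linarith)
      have "k ` {u1..u3} - {k u1, k u3} \<subseteq> k ` {u1<..<u3}" by (rule image_endpoints)
      then have "k ` {u1..u3} \<subseteq> closure (k ` {u1<..<u3})"
        using is_arcD(8)[OF arc] closure_mono[of "k ` {u1..u3} - {k u1, k u3}" "k ` {u1<..<u3}"] by simp
      moreover have "k u3 \<in> k ` {u1..u3}" using k(4,5) by simp
      ultimately show ?thesis by blast
    qed
    ultimately have 1: "h (E w) \<in> inside T.T \<union> T.T" using k(6) by auto
    have "h (E w) \<in> T0.T" using T0.mem_T_iff(2) k(7,8) by simp
    then have "h (E w) \<in> T.T" using 1 nest(2) jordanD(10)[OF T.jordan_T] by blast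
    then have "E w \<le> e" using T.mem_T_iff(2) by simp
    then have "E w = e" using v(2)[OF wS] e_def by simp
    then have "k u3 = q b" using k(6) q(6) by simp
    then show False using k_q[of u3 b] k(4,5) by simp
  qed
  have TQ: "T.T \<subseteq> Q \<union> inside Q" using T.T_subset_Q nov by blast
  then have TOut: "T.T \<inter> outside bdry = {}" using Q_nest(1) jordanD(10,11)[OF jordan_Q] by blast
  then have qOut: "q ` {a..b} \<inter> outside bdry = {}" unfolding tri_def by blast
  have "q ` {a..b'} \<subseteq> q ` {a..b}" "q ` {b'..b} \<subseteq> q ` {a..b}" using q(4,5) by (intro image_mono; auto)+
  then have parts: "q ` {a..b'} \<inter> outside bdry = {}" "q ` {b'..b} \<inter> outside bdry = {}" using qOut by blast+
  then have "seg p \<L> i v \<inter> outside bdry = {}" using seg_param[OF q(1-4)] by (simp only:)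
  then have vis: "vis i v" using i_less vn(1) vi(1) unfolding visible_pair_def by blast
  have "p v \<in> Q" using pvT TQ Q_nest(2) vertex_bdry[OF vn(1)] jordanD(10)[OF jordan_Q] by blast
  moreover have "f ` {s..r} \<subseteq> Lw" using f_on by auto
  then have pvf: "p v \<notin> f ` {s..r}" using vn(2) T0.lines_not_inside(1) by blast
  with \<open>p v \<in> Q\<close> have pv: "p v \<in> Ch" unfolding Q_def by blast
  have "h e \<in> h ` {c..d}" using q(7,8) by auto
  then have he: "h e \<in> edge m" using h(5) by blast
  have hv: "h e \<notin> verts"
  proof
    assume "h e \<in> verts"
    then obtain w where w: "w < n" "h e = p w" by auto
    then have "w = m \<or> w = nxt m" using vertex_in_edge[OF w(1) m_less] he by simp
    then show False
    proof
      assume "w = m"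
      then obtain x where "x \<le> c" "h e = h x" using pm w(2) by auto
      then show False using h_eq[of e x] q(7) by simp
    next
      assume "w = nxt m"
      then show False using h(3) w(2) h_eq[of e d] q(8) by simp
    qed
  qed
  \<comment> \<open>The line crosses the edge at \<open>h e\<close>; it arrives there from points
    that are not outside, so it continues into the outside.\<close>
  have exit: "q ` {b'..r'} \<inter> outside bdry \<noteq> {}" if r': "r' > b" for r'
  proof -
    obtain \<delta> where \<delta>: "\<delta> > 0" "q ` {b - \<delta><..<b} \<subseteq> inside bdry \<and> q ` {b<..<b + \<delta>} \<subseteq> outside bdry \<or>
      q ` {b - \<delta><..<b} \<subseteq> outside bdry \<and> q ` {b<..<b + \<delta>} \<subseteq> inside bdry"
      using edge_crossing[OF l(1) q(1) m_less, of b] he hv q(6) T.M_N by metis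
    define u where "u = max a (b - \<delta> / 2)"
    have "u \<in> {b - \<delta><..<b}" "u \<in> {a..b}" using \<delta>(1) q(4,5) unfolding u_def by auto
    then have "q u \<in> q ` {b - \<delta><..<b}" "q u \<notin> outside bdry" using qOut by blast+
    then have o: "q ` {b<..<b + \<delta>} \<subseteq> outside bdry" using \<delta>(2) by blast
    define x where "x = min r' (b + \<delta> / 2)"
    have "x \<in> {b<..<b + \<delta>}" "x \<in> {b'..r'}" using \<delta>(1) q(5) r' unfolding x_def by auto
    then show ?thesis using o by blast
  qed
  have "first_exit n p \<L> i v (h e)"
    unfolding first_exit_iff[OF q(1-4)]
  proof (intro exI[of _ b] conjI allI impI)
    show "q ` {b'..b} \<inter> outside bdry = {}" by (rule parts)
  qed (use q exit in auto)
  moreover have "h e \<noteq> p v" using hv vn(1) by auto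
  ultimately have "ext i v (2 * m + 1)"
    unfolding ext_def exit_at_def using m_less vis he by blast
  then show thesis using that vn(1) pv pvf by blast
qed

end

section \<open>Existence of designated blockers\<close>

lemma image_intervalE:
  fixes w :: "real \<Rightarrow> 'a"
  assumes "z \<in> w ` {x..y}" obtains a where "z = w a" "x \<le> a" "a \<le> y"
  using assms by auto

context ppoly
begin

text \<open>Counting vertices from \<open>i\<close> on turns walks starting at \<open>i\<close> into
  intervals of step numbers.\<close>

definition idx :: "nat \<Rightarrow> nat \<Rightarrow> nat" where "idx i s = (i + s) mod n"

lemma idx_less: "idx i s < n"
  using n3 unfolding idx_def by simp

lemma idx_eq: "i < n \<Longrightarrow> s \<le> n \<Longrightarrow> idx i s = (if i + s < n then i + s else i + s - n)"
  unfolding idx_def using mod_less_twice[of "i + s" n] by (auto simp: le_mod_geq)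

lemma idx_inj: "\<lbrakk>i < n; s < n; s' < n; idx i s = idx i s'\<rbrakk> \<Longrightarrow> s = s'"
  by (auto simp: idx_eq split: if_splits)

lemma idx_0: "i < n \<Longrightarrow> idx i 0 = i" and idx_n: "i < n \<Longrightarrow> idx i n = i"
  by (auto simp: idx_def)

lemma nxt_idx: "nxt (idx i s) = idx i (Suc s)"
  unfolding idx_def by (metis add_Suc_right mod_Suc_eq)

lemma idx_surj: "i < n \<Longrightarrow> v < n \<Longrightarrow> \<exists>s<n. v = idx i s"
  by (rule exI[of _ "if i \<le> v then v - i else v + n - i"]) (auto simp: idx_eq)

text \<open>Restarted at \<open>p i\<close>, the loop runs through the boundary from any point on to
  \<open>p i\<close> over a single interval ending at 1.\<close>

lemma rotated_loop:
  assumes i: "i < n"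
  obtains w where "simple_path w" "pathfinish w = pathstart w" "path_image w = bdry"
    "\<And>s. s \<le> n \<Longrightarrow> w (real s / real n) = p (idx i s)"
    "\<And>s. s < n \<Longrightarrow> w ` {real s / real n .. real (Suc s) / real n} = edge (idx i s)"
proof -
  obtain g where g: "simple_path g" "pathfinish g = pathstart g" "path_image g = bdry"
    "\<And>i. i < n \<Longrightarrow> g (real i / real n) = p i"
    "\<And>i. i < n \<Longrightarrow> g ` {real i / real n .. real (Suc i) / real n} = edge i"
    using loop by metis
  have g1: "g 1 = g 0" using g(2) by (simp add: pathfinish_def pathstart_def)
  have n0: "real n > 0" using n3 by simp
  define \<alpha> where "\<alpha> = real i / real n"
  have \<alpha>: "0 \<le> \<alpha>" "\<alpha> \<le> 1" unfolding \<alpha>_def using i by auto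
  define w where "w = shiftpath \<alpha> g"
  have low: "w x = g (\<alpha> + x)" if "\<alpha> + x \<le> 1" for x using that unfolding w_def shiftpath_def by simp
  have high: "w x = g (\<alpha> + x - 1)" if "1 \<le> \<alpha> + x" for x
    using that g1 unfolding w_def shiftpath_def by (cases "\<alpha> + x = 1") auto
  have ax: "\<alpha> + real s / real n = real (i + s) / real n" for s unfolding \<alpha>_def by (simp add: add_divide_distrib)
  have pts: "w (real s / real n) = p (idx i s)" if "s \<le> n" for s
  proof (cases "i + s < n")
    case True
    then have "\<alpha> + real s / real n \<le> 1" unfolding ax by simp
    then have "w (real s / real n) = g (real (i + s) / real n)" using low ax by metis
    then show ?thesis using g(4)[OF True] True i that by (simp add: idx_eq)
  next
    case False
    then have "1 \<le> \<alpha> + real s / real n" unfolding ax using n0 by simp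
    moreover have "\<alpha> + real s / real n - 1 = real (i + s - n) / real n" unfolding ax using False n0 by (simp add: field_simps)
    ultimately have "w (real s / real n) = g (real (i + s - n) / real n)" using high by metis
    then show ?thesis using g(4)[of "i + s - n"] False i that by (simp add: idx_eq)
  qed
  have edges: "w ` {real s / real n .. real (Suc s) / real n} = edge (idx i s)" if s: "s < n" for s
  proof (cases "i + s < n")
    case True
    have "w x = g (\<alpha> + x)" if "x \<in> {real s / real n .. real (Suc s) / real n}" for x
    proof (rule low)
      have "\<alpha> + real (Suc s) / real n \<le> 1" unfolding ax using True n0 by simp
      then show "\<alpha> + x \<le> 1" using that by simp
    qed
    then have "w ` {real s / real n .. real (Suc s) / real n} = (\<lambda>x. g (\<alpha> + x)) ` {real s / real n .. real (Suc s) / real n}"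
      by (intro image_cong) auto
    also have "\<dots> = g ` ((+) \<alpha> ` {real s / real n .. real (Suc s) / real n})" by (rule image_image[symmetric])
    also have "\<dots> = g ` {real (i + s) / real n .. real (Suc (i + s)) / real n}"
      unfolding image_add_atLeastAtMost using ax[of s] ax[of "Suc s"]
      by (simp only: add.commute[of _ \<alpha>] add_Suc_right)
    also have "\<dots> = edge (i + s)" by (rule g(5)[OF True])
    finally show ?thesis using True i s by (simp add: idx_eq)
  next
    case False
    have "w x = g (\<alpha> - 1 + x)" if "x \<in> {real s / real n .. real (Suc s) / real n}" for x
    proof -
      have "1 \<le> \<alpha> + real s / real n" unfolding ax using False n0 by simp
      then have "1 \<le> \<alpha> + x" using that by simp
      then show ?thesis using high by (simp add: algebra_simps)
    qed
    then have "w ` {real s / real n .. real (Suc s) / real n} = (\<lambda>x. g (\<alpha> - 1 + x)) ` {real s / real n .. real (Suc s) / real n}"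
      by (intro image_cong) auto
    also have "\<dots> = g ` ((+) (\<alpha> - 1) ` {real s / real n .. real (Suc s) / real n})" by (rule image_image[symmetric])
    also have "(+) (\<alpha> - 1) ` {real s / real n .. real (Suc s) / real n} = {real (i + s - n) / real n .. real (Suc (i + s - n)) / real n}"
      unfolding image_add_atLeastAtMost \<alpha>_def using False n0 by (simp add: field_simps of_nat_diff)
    also have "g ` \<dots> = edge (i + s - n)" using g(5)[of "i + s - n"] i s by simp
    finally show ?thesis using False i s by (simp add: idx_eq)
  qed
  show thesis
  proof (rule that[of w])
    show "simple_path w" "pathfinish w = pathstart w" "path_image w = bdry"
      unfolding w_def using g(1-3) \<alpha> by (auto simp: simple_path_shiftpath path_image_shiftpath pathfinish_shiftpath pathstart_shiftpath)
  qed (use pts edges in auto)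
qed

text \<open>\<open>subsegment\<close> is the least connected subset of the line, which gives one
  inclusion; \<open>arc_minimal\<close> turns it into equality.\<close>

lemma interval_subset_part:
  assumes "param L h" "c < d" "A \<subseteq> L" "is_arc A (h c) (h d)"
  shows "h ` {c..d} = A"
proof (rule arc_minimal[OF assms(4)])
  show "h ` {c..d} \<subseteq> A"
    using subsegment_le[OF assms(1), of c d] assms(2,3) is_arcD(2-4)[OF assms(4)]
    unfolding subsegment_def by auto
qed (use assms(2) param_connected[OF assms(1) is_interval_cc] in auto)

lemma limit_of_open_interval:
  assumes "param L k" "u < v"
  shows "k u \<in> closure (k ` {u<..<v})" "k v \<in> closure (k ` {u<..<v})"
proof -
  have arc: "is_arc (k ` {u..v}) (k u) (k v)"
    using subsegment_is_arc[OF assms(1), of u v] subsegment_le[OF assms(1), of u v] assms(2) by simp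
  have "closure (k ` {u..v} - {k u, k v}) \<subseteq> closure (k ` {u<..<v})"
    by (rule closure_mono[OF image_endpoints])
  then show "k u \<in> closure (k ` {u<..<v})" "k v \<in> closure (k ` {u<..<v})"
    using is_arcD(3,4,8)[OF arc] by auto
qed

lemma blocker_exists:
  assumes i: "i < n" and j: "j < n" "i \<noteq> j" and nv: "\<not> vis i j"
  shows "\<exists>k x. ext i k x \<and> sep (2 * i) (2 * j) (2 * k) x"
proof -
  obtain w where w: "simple_path w" "pathfinish w = pathstart w" "path_image w = bdry"
    and wp: "\<And>s. s \<le> n \<Longrightarrow> w (real s / real n) = p (idx i s)"
    and we: "\<And>s. s < n \<Longrightarrow> w ` {real s / real n .. real (Suc s) / real n} = edge (idx i s)"
    using rotated_loop[OF i] by metis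
  have n0: "real n > 0" using n3 by simp
  have inj: "a = b \<or> {a, b} = {0, 1}" if "w a = w b" "a \<in> {0..1}" "b \<in> {0..1}" for a b
    using w(1) that unfolding simple_path_def loop_free_def by blast
  obtain J where J: "J < n" "j = idx i J" using idx_surj[OF i j(1)] by blast
  have J0: "0 < J" using J(2) j(2) i idx_0 by (cases J) auto
  have Jw: "J = (j + n - i) mod n" "n - J = (i + n - j) mod n"
    using J J0 i j by (auto simp: idx_eq mod_less_twice)
  have sepI: "sep (2 * i) (2 * j) (2 * idx i U) (2 * idx i m + 1)"
    if "0 < U" "U < n" "m < n" "U < J \<and> J \<le> m \<or> J < U \<and> m < J" for U m
  proof -
    have ne: "idx i U \<noteq> i" "idx i U \<noteq> j"
      using that idx_inj[OF i, of U 0] idx_inj[OF i, of U J] idx_0[OF i] J by auto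
    have ji: "idx i s = (j + (s - J)) mod n" if "J \<le> s" for s
    proof -
      have "i + s = (i + J) + (s - J)" using that by simp
      then show ?thesis using J(2) unfolding idx_def by (metis mod_add_left_eq)
    qed
    have V: "idx i s \<in> walk_verts n i j" if "s \<le> J" for s
      unfolding walk_verts_def idx_def using that Jw(1) by auto
    have V': "idx i s \<in> walk_verts n j i" if "J \<le> s" "s < n" for s
      unfolding walk_verts_def using that Jw(2) ji[OF that(1)] by (auto intro!: exI[of _ "s - J"])
    have E: "idx i s \<in> walk_edges n i j" if "s < J" for s
      unfolding walk_edges_def idx_def using that Jw(1) by auto
    have E': "idx i s \<in> walk_edges n j i" if "J \<le> s" "s < n" for s
      unfolding walk_edges_def using that Jw(2) ji[OF that(1)] by (auto intro!: exI[of _ "s - J"])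
    show ?thesis
      unfolding sep_iff_walk[OF idx_less idx_less i j] using ne that V[of U] V'[of U] E[of m] E'[of m] by auto
  qed
  \<comment> \<open>The set is nonempty: \<open>i\<close> sees its successor along an edge, and
    \<open>J \<noteq> 1\<close> since \<open>j\<close> is invisible.\<close>
  define K where "K = Max {s. 0 < s \<and> s < J \<and> vis i (idx i s)}"
  have vis1: "vis i (idx i 1)" using edge_vis[OF i] nxt_idx[of i 0] idx_0[OF i] by simp
  then have "J \<noteq> 1" using nv J(2) by auto
  then have "1 \<in> {s. 0 < s \<and> s < J \<and> vis i (idx i s)}" using vis1 J0 by auto
  then have KS: "K \<in> {s. 0 < s \<and> s < J \<and> vis i (idx i s)}" unfolding K_def by (intro Max_in) auto
  have Kmax: "s \<le> K" if "0 < s" "s < J" "vis i (idx i s)" for s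
    unfolding K_def using that by (intro Max_ge) auto
  have K: "0 < K" "K < J" "vis i (idx i K)" using KS by auto
  define k where "k = idx i K"
  have vik: "vis i k" using K(3) unfolding k_def .
  note V = visD[OF vik]
  obtain f s t where f: "param (lin i k) f" "f s = p i" "f t = p k" "s < t"
    using lin_param[OF V(1-3)] by metis
  obtain rr where rr: "t \<le> rr" "first_exit n p \<L> i k (f rr)" "f rr \<in> bdry"
    "f ` {t..rr} \<inter> outside bdry = {}" "\<forall>r'>rr. f ` {t..r'} \<inter> outside bdry \<noteq> {}"
    using first_exit_exists[OF vik f] by metis
  have f_eq: "f u = f v \<longleftrightarrow> u = v" for u v using param_eq_iff[OF f(1)] .
  obtain m0 where m0: "m0 < n" "f rr \<in> edge m0" using bdry_edge[OF rr(3)] by blast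
  obtain M0 where M0: "M0 < n" "m0 = idx i M0" using idx_surj[OF i m0(1)] by blast
  have notv: "f u \<notin> verts" if "t < u" for u
    using param_vertex[OF V(1-3) f(1-3), of u] that f(4) by auto
  have exit_in: "f ` {t<..<rr} \<subseteq> inside bdry" if "t < rr"
  proof -
    have "ext i k (2 * m0 + 1)"
      unfolding ext_def exit_at_def using m0 vik rr(2) f(3) f_eq that by (metis less_irrefl)
    then obtain r1 where r1: "f ` {t<..<r1} \<subseteq> inside bdry" "first_exit n p \<L> i k (f r1)"
      using ext_param[OF _ f] by metis
    have "r1 = rr" using first_exit_unique[OF vik r1(2) rr(2)] f_eq by simp
    then show ?thesis using r1(1) by simp
  qed
  show ?thesis
  \<comment> \<open>In the first case the ray exits through an edge after \<open>j\<close>, and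
    \<open>k\<close> itself is the blocker.\<close>
  proof (cases "t < rr \<and> J \<le> M0")
    case True
    then have "ext i k (2 * m0 + 1)"
      unfolding ext_def exit_at_def using m0 vik rr(2) f(3) f_eq by (metis less_irrefl)
    moreover have "sep (2 * i) (2 * j) (2 * k) (2 * m0 + 1)"
      unfolding k_def M0(2) using True K M0(1) J(1) by (intro sepI) auto
    ultimately show ?thesis by blast
  next
    case False
    \<comment> \<open>If the ray exits between \<open>k\<close> and \<open>j\<close>, the wall
      follows it to its exit. If it is cut off at \<open>k\<close> or exits before \<open>k\<close>,
      the wall is just the segment from \<open>i\<close> to \<open>k\<close>, and the edge starting
      at \<open>k\<close> replaces the exit edge.\<close>
    define M where "M = (if t < rr \<and> K \<le> M0 then M0 else K)"
    define r where "r = (if t < rr \<and> K \<le> M0 then rr else t)"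
    define m where "m = idx i M"
    have Mbd: "K \<le> M" "M < J" unfolding M_def using False K by auto
    have Mn: "M < n" "Suc M < n" using Mbd J by auto
    have m_less: "m < n" unfolding m_def by (rule idx_less)
    have nm: "nxt m = idx i (Suc M)" unfolding m_def by (rule nxt_idx)
    note nx = next_vertex[OF m_less]
    have tr: "t \<le> r" "r \<le> rr" unfolding r_def using rr(1) by auto
    have sr: "s < r" using f(4) tr by simp
    have fOut: "f ` {s..r} \<inter> outside bdry = {}"
    proof -
      have "{s..r} \<subseteq> {s..t} \<union> {t..rr}" using tr by auto
      then have "f ` {s..r} \<subseteq> f ` {s..t} \<union> f ` {t..rr}" by (metis image_Un image_mono)
      moreover have "f ` {s..t} \<inter> outside bdry = {}" using V(4) seg_param[OF f] by simp
      ultimately show ?thesis using rr(4) by blast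
    qed
    have m_ne: "m \<noteq> i" "nxt m \<noteq> i"
      using idx_inj[OF i, of M 0] idx_inj[OF i, of "Suc M" 0] idx_0[OF i] Mn Mbd K(1) nm unfolding m_def by auto
    note l = lin[OF m_less nx(1,3)] and lw = lin[OF V(1-3)]
    have pi: "p i \<notin> lin m (nxt m)" using lin_vertex[OF m_less nx(1,3) i] m_ne by auto
    have Mne: "lin m (nxt m) \<noteq> lin i k" using pi lw(2) by auto
    obtain \<tau> where \<tau>: "f r = w \<tau>" "real M / real n \<le> \<tau>" "\<tau> < real (Suc M) / real n"
      "M0 < K \<or> rr = t \<Longrightarrow> \<tau> = real K / real n"
      "t < rr \<Longrightarrow> K \<le> M0 \<Longrightarrow> real K / real n < \<tau>" 
    proof (cases "t < rr \<and> K \<le> M0")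
      case True
      then have "f r \<in> w ` {real M / real n .. real (Suc M) / real n}"
        using m0(2) we[OF Mn(1)] M0(2) unfolding r_def M_def by simp
      then obtain \<tau> where t1: "f r = w \<tau>" "real M / real n \<le> \<tau>" "\<tau> \<le> real (Suc M) / real n" by auto
      have "f r \<notin> verts" using notv True unfolding r_def by simp
      then have "\<tau> \<noteq> real M / real n" "\<tau> \<noteq> real (Suc M) / real n"
        using t1(1) wp[of M] wp[of "Suc M"] Mn idx_less by auto
      moreover have "real K / real n \<le> real M / real n" using Mbd(1) n0 by (simp add: divide_right_mono)
      ultimately show ?thesis using that[of \<tau>] t1 True by auto
    next
      case False
      then have "r = t" "M = K" unfolding r_def M_def by auto
      then show ?thesis using that[of "real K / real n"] f(3) wp[of K] K J n0 k_def False
        by (auto simp: divide_strict_right_mono)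
    qed
    have Kn: "0 < real K / real n" "real K / real n \<le> real M / real n" "real (Suc M) / real n < 1"
      using K Mbd Mn n0 by (auto simp: divide_right_mono)
    have \<tau>01: "0 < \<tau>" "\<tau> < 1" "real K / real n \<le> \<tau>" using \<tau>(2,3) Kn by linarith+
    define Ch where "Ch = w ` {\<tau>..1}"
    have w1: "w 1 = p i" "w 0 = p i" using wp[of n] wp[of 0] idx_n[OF i] idx_0[OF i] n0 by auto
    have pw: "path w" using w(1) by (simp add: simple_path_def)
    have sub_arc: "is_arc (w ` {x..y}) (w x) (w y)" if "0 < x" "x < y" "y \<le> 1" for x y
    proof -
      have "w x \<noteq> w y" using inj[of x y] that by (auto simp: doubleton_eq_iff)
      then have "arc (subpath x y w)" using arc_simple_path_subpath[OF w(1), of x y] that by auto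
      then show ?thesis unfolding is_arc_def using that
        by (intro exI[of _ "subpath x y w"]) (auto simp: path_image_subpath)
    qed
    have Ch_arc: "is_arc Ch (f r) (p i)" unfolding Ch_def using sub_arc[of \<tau> 1] \<tau>01 \<tau>(1) w1 by simp
    have Ch_bdry: "Ch \<subseteq> bdry" unfolding Ch_def w(3)[symmetric] path_image_def using \<tau>01 by auto
    obtain h s2 t2 where h: "param (lin m (nxt m)) h" "h s2 = p m" "h t2 = p (nxt m)" "s2 < t2" "edge m = h ` {s2..t2}"
      using edge_param[OF m_less] by metis
    have wm: "w ` {real M / real n .. real (Suc M) / real n} = edge m" using we[OF Mn(1)] unfolding m_def .
    have "f r \<in> edge m" using \<tau>(1-3) wm by (metis atLeastAtMost_iff image_eqI less_imp_le)
    then obtain c where c: "f r = h c" "s2 \<le> c" "c \<le> t2" using h(5) by auto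
    have wS: "w (real (Suc M) / real n) = h t2" using wp[of "Suc M"] Mn nm h(3) by simp
    have "c \<noteq> t2"
    proof
      assume "c = t2"
      then have "w \<tau> = w (real (Suc M) / real n)" using c(1) \<tau>(1) wS by simp
      then show False using inj[of \<tau> "real (Suc M) / real n"] \<tau>01 \<tau>(3) Kn by (auto simp: doubleton_eq_iff)
    qed
    then have ct: "c < t2" using c by simp
    have part: "h ` {c..t2} = w ` {\<tau>..real (Suc M) / real n}"
    proof (rule interval_subset_part[OF h(1) ct])
      have "w ` {\<tau>..real (Suc M) / real n} \<subseteq> edge m" unfolding wm[symmetric] using \<tau>(2) by (intro image_mono) auto
      then show "w ` {\<tau>..real (Suc M) / real n} \<subseteq> lin m (nxt m)" using edge_subset_lin[OF m_less] by blast
      show "is_arc (w ` {\<tau>..real (Suc M) / real n}) (h c) (h t2)"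
        using sub_arc[of \<tau> "real (Suc M) / real n"] \<tau>01 \<tau>(1,3) Kn wS c(1) by simp
    qed
    define \<Lambda> where "\<Lambda> = idx i ` {Suc M..<n}"
    have Ch_split: "Ch = h ` {c..t2} \<union> \<Union> (edge ` \<Lambda>)"
    proof -
      have tail: "w ` {real L / real n .. 1} = \<Union> (edge ` idx i ` {L..<n})" if "L < n" for L
        using that
      proof (induction "n - L" arbitrary: L)
        case (Suc x)
        have ivl: "{real L / real n .. 1} = {real L / real n .. real (Suc L) / real n} \<union> {real (Suc L) / real n .. 1}"
          using Suc.prems n0 by (intro ivl_disj_un_two_touch(4)[symmetric]) (auto simp: divide_right_mono)
        have e: "w ` {real L / real n .. 1} = edge (idx i L) \<union> w ` {real (Suc L) / real n .. 1}"
          unfolding ivl image_Un we[OF Suc.prems] ..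
        show ?case
        proof (cases "Suc L < n")
          case True
          have "{L..<n} = insert L {Suc L..<n}" using True by auto
          then show ?thesis using Suc.hyps(1)[of "Suc L"] Suc.hyps(2) True e by auto
        next
          case False
          then have L: "Suc L = n" using Suc.prems by simp
          then have "real (Suc L) / real n = 1" using n0 by simp
          moreover have "w 1 \<in> edge (idx i L)"
            using we[OF Suc.prems] calculation by (metis atLeastAtMost_iff divide_right_mono image_eqI le_add_same_cancel1 less_imp_le n0 of_nat_0_le_iff of_nat_mono order_refl plus_1_eq_Suc le_Suc_eq)
          moreover have "{L..<n} = {L}" using L by auto
          ultimately show ?thesis using e by auto
        qed
      qed simp
      have "w ` {real (Suc M) / real n .. 1} = \<Union> (edge ` \<Lambda>)" unfolding \<Lambda>_def by (rule tail[OF Mn(2)])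
      moreover have "{\<tau>..1} = {\<tau>..real (Suc M) / real n} \<union> {real (Suc M) / real n..1}"
        using \<tau>(3) Kn by (intro ivl_disj_un_two_touch(4)[symmetric]) auto
      ultimately show ?thesis unfolding Ch_def part by (simp only: image_Un)
    qed
    have wCh: "w a \<notin> Ch" if "0 < a" "a < \<tau>" for a
      using inj[of a] that \<tau>01 unfolding Ch_def by (fastforce simp: doubleton_eq_iff)
    \<comment> \<open>Before its end the wall touches the boundary only up to step \<open>K\<close>:
      at its vertices, or along the first edge if the segment is an edge. It cannot be the last
      edge, because \<open>K < J < n\<close>.\<close>
    have f_low: "z \<in> inside bdry \<or> z \<in> w ` {0..real K / real n}" if z: "z \<in> f ` {s..r}" "z \<noteq> f r" for z
    proof -
      obtain u where u0: "z = f u" "u \<in> {s..r}" using z(1) by blast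
      then have "u \<noteq> r" using z(2) by blast
      then have u: "z = f u" "s \<le> u" "u < r" using u0 by auto
      have pk: "p k \<in> w ` {0..real K / real n}" using wp[of K] K J k_def Kn(1) by (metis atLeastAtMost_iff image_eqI less_imp_le order_refl less_trans)
      have pi': "p i \<in> w ` {0..real K / real n}" using w1(2) Kn(1) by (metis atLeastAtMost_iff image_eqI less_imp_le order_refl)
      consider "u = s" | "u = t" | "s < u" "u < t" | "t < u" using u(2) by linarith
      then show ?thesis
      proof cases
        case 3
        show ?thesis
        proof (cases "f ` {s<..<t} \<subseteq> inside bdry")
          case True then show ?thesis using 3 u(1) by auto
        next
          case False
          then obtain l where l: "l < n" "{i, k} = {l, nxt l}" "edge l = f ` {s..t}" using vis_interior[OF vik f] by blast
          have "l = i"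
          proof (rule ccontr)
            assume "l \<noteq> i"
            then have "l = k" "nxt k = i" using l(2) by (auto simp: doubleton_eq_iff)
            then have "idx i (Suc K) = idx i 0" using nxt_idx[of i K] idx_0[OF i] k_def by simp
            then show False using idx_inj[OF i, of "Suc K" 0] K J by auto
          qed
          then have "k = idx i 1" using l(2) nxt_idx[of i 0] idx_0[OF i] by (auto simp: doubleton_eq_iff)
          then have "K = 1" using idx_inj[OF i, of K 1] K J n3 k_def by auto
          moreover have "edge i = w ` {0..1 / real n}" using we[of 0] idx_0[OF i] n3 by simp
          moreover have "z \<in> edge l" unfolding l(3) using 3 u(1) by auto
          ultimately show ?thesis using \<open>l = i\<close> by simp
        qed
      next
        case 4
        then have "f u \<notin> bdry"
        proof -
          have "t < rr" using 4 u(3) tr by simp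
          have "f u \<in> f ` {t<..<rr}" using 4 u(3) tr by auto
          then have "f u \<in> inside bdry" using exit_in[OF \<open>t < rr\<close>] by blast
          then show ?thesis using regions(2) by blast
        qed
        moreover have "f u \<notin> outside bdry" using fOut u by fastforce
        ultimately show ?thesis using regions(1) u(1) by blast
      qed (use u pk pi' f in auto)
    qed
    have fCh: "f ` {s..r} \<inter> Ch \<subseteq> {f r, p i}"
    proof
      fix z assume z: "z \<in> f ` {s..r} \<inter> Ch"
      show "z \<in> {f r, p i}"
      proof (rule ccontr)
        assume ne: "z \<notin> {f r, p i}"
        have "z \<notin> inside bdry" using z Ch_bdry regions(2) by blast
        then have "z \<in> w ` {0..real K / real n}" using f_low[of z] z ne by blast
        then obtain a where a: "z = w a" "0 \<le> a" "a \<le> real K / real n" by (rule image_intervalE)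
        have "a \<noteq> 0" using a(1) w1 ne by auto
        moreover have "a \<noteq> \<tau>" using a(1) \<tau>(1) ne by auto
        ultimately show False using wCh[of a] a \<tau>01(3) z by auto
      qed
    qed
    have \<Lambda>: "\<Lambda> \<subseteq> {..<n} - {m}"
    proof -
      have "idx i L \<noteq> m" if "L \<in> {Suc M..<n}" for L using idx_inj[OF i _ Mn(1), of L] that unfolding m_def by auto
      then show ?thesis unfolding \<Lambda>_def using idx_less by (simp add: image_subset_iff)
    qed
    have \<Lambda>f: "edge l \<inter> f ` {s..r} \<subseteq> {p i}" if "l \<in> \<Lambda>" for l
    proof -
      obtain L where L: "l = idx i L" "Suc M \<le> L" "L < n" using \<open>l \<in> \<Lambda>\<close> unfolding \<Lambda>_def by auto
      have "edge l \<subseteq> Ch" unfolding Ch_split using \<open>l \<in> \<Lambda>\<close> by blast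
      moreover have "f r \<notin> edge l"
      proof
        assume "f r \<in> edge l"
        then have "w \<tau> \<in> w ` {real L / real n .. real (Suc L) / real n}" unfolding we[OF L(3)] \<tau>(1) L(1) .
        then obtain a where a: "w \<tau> = w a" "real L / real n \<le> a" "a \<le> real (Suc L) / real n"
          by (rule image_intervalE)
        have "real (Suc M) / real n \<le> real L / real n" using L(2) by (intro divide_right_mono) auto
        moreover have "real (Suc L) / real n \<le> 1" using L(3) n0 by simp
        ultimately show False using inj[OF a(1)] a \<tau>01 \<tau>(3) by (auto simp: doubleton_eq_iff)
      qed
      moreover have "A \<inter> F \<subseteq> {y}" if "A \<subseteq> C" "x \<notin> A" "F \<inter> C \<subseteq> {x, y}" for A C F :: "complex set" and x y
        using that by blast
      ultimately show ?thesis using fCh by metis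
    qed
    define Q where "Q = f ` {s..r} \<union> Ch"
    have jQ: "jordan Q"
    proof -
      have "is_arc (f ` {s..r}) (p i) (f r)"
        using subsegment_is_arc[OF f(1), of s r] subsegment_le[OF f(1), of s r] sr f(2) by simp
      then show ?thesis unfolding Q_def by (rule jordan_two_arcs) (use Ch_arc fCh in auto)
    qed
    have QB: "Q \<subseteq> bdry \<union> inside bdry" unfolding Q_def using fOut Ch_bdry regions(1) by blast
    note nest = jordan_nest[OF jordan_bdry jQ QB]
    \<comment> \<open>If the ray is cut off at \<open>k\<close>, \<open>Z\<close> consists of its
      points outside the polygon. If it exits before \<open>k\<close>, \<open>Z\<close> is the open
      ray up to the exit, which is a boundary point off \<open>Q\<close>. Otherwise \<open>Z\<close>
      is the part of the exit edge before \<open>f r\<close>, made of boundary points off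
      \<open>Q\<close>.\<close>
    have "\<exists>Z. f r \<in> closure Z \<and> Z \<subseteq> f ` {r<..} \<union> h ` {..<c} \<and> Z \<subseteq> outside Q"
    proof -
      consider "rr = t" | "t < rr" "M0 < K" | "t < rr" "K \<le> M0" using rr(1) by linarith
      then show ?thesis
      proof cases
        case 1
        then have rt: "r = rr" "r = t" unfolding r_def by auto
        define Z where "Z = f ` {r<..} \<inter> outside bdry"
        have "f r \<in> closure Z"
          unfolding closure_approachable
        proof (intro allI impI)
          fix e :: real assume "0 < e"
          have "isCont f r" using param_basic(2)[OF f(1), of UNIV] by (simp add: continuous_on_eq_continuous_at)
          then obtain \<delta> where \<delta>: "\<delta> > 0" "\<And>x. dist x r < \<delta> \<Longrightarrow> dist (f x) (f r) < e"
            using \<open>0 < e\<close> unfolding continuous_at_eps_delta by blast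
          obtain x where x: "r \<le> x" "x \<le> r + \<delta> / 2" "f x \<in> outside bdry"
          proof -
            have "f ` {r..r + \<delta> / 2} \<inter> outside bdry \<noteq> {}" using rr(5) \<delta>(1) rt by simp
            then show thesis using that by auto
          qed
          have "x \<noteq> r" using x(3) rr(3) rt bdry_not_outside by auto
          then have "f x \<in> Z" unfolding Z_def using x by auto
          moreover have "dist (f x) (f r) < e" using x \<delta> by (auto simp: dist_real_def)
          ultimately show "\<exists>y\<in>Z. dist y (f r) < e" by blast
        qed
        then show ?thesis using nest(1) unfolding Z_def by blast
      next
        case 2
        then have rt: "r = t" unfolding r_def by auto
        have C: "f ` {t<..rr} \<inter> Q = {}"
        proof -
          have "f u \<notin> Q" if u: "t < u" "u \<le> rr" for u
          proof
            assume "f u \<in> Q"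
            moreover have "f u \<notin> f ` {s..r}" using u rt f_eq by auto
            ultimately have uC: "f u \<in> Ch" unfolding Q_def by blast
            have "u = rr"
            proof (rule ccontr)
              assume "u \<noteq> rr"
              then have "f u \<in> f ` {t<..<rr}" using u by auto
              then have "f u \<in> inside bdry" using exit_in[OF \<open>t < rr\<close>] by blast
              then show False using uC Ch_bdry regions(2) by blast
            qed
            then have "f u \<in> w ` {real M0 / real n .. real (Suc M0) / real n}" using m0(2) M0 we[OF M0(1)] by simp
            then obtain a where a: "f u = w a" "real M0 / real n \<le> a" "a \<le> real (Suc M0) / real n"
              by (rule image_intervalE)
            have "f u \<notin> verts" using notv u by simp
            moreover have "w 0 \<in> verts" using w1 i by simp
            moreover have "w (real K / real n) \<in> verts" using wp[of K] K J idx_less by auto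
            ultimately have "a \<noteq> 0" "a \<noteq> real K / real n" using a(1) by auto
            moreover have "real (Suc M0) / real n \<le> real K / real n" using 2 by (intro divide_right_mono) auto
            moreover have "0 \<le> real M0 / real n" by simp
            ultimately have "0 < a" "a < \<tau>" using a \<tau>01(3) by linarith+
            then show False using wCh uC a(1) by simp
          qed
          then show ?thesis by auto
        qed
        have "f ` {t<..rr} \<subseteq> inside Q \<or> f ` {t<..rr} \<subseteq> outside Q"
          by (rule inside_or_outside[OF jQ param_connected[OF f(1) is_interval_oc] C])
        moreover have "f rr \<in> f ` {t<..rr}" using 2 by auto
        moreover then have "f rr \<in> outside Q" using nest(2) rr(3) C by blast
        ultimately have "f ` {t<..rr} \<subseteq> outside Q" using jordanD(10)[OF jQ] by blast
        moreover have "f ` {t<..<rr} \<subseteq> f ` {t<..rr}" by auto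
        ultimately have "f ` {t<..<rr} \<subseteq> outside Q" by blast
        moreover have "f ` {t<..<rr} \<subseteq> f ` {r<..}" using rt by auto
        ultimately show ?thesis using limit_of_open_interval(1)[OF f(1) 2(1)] rt by blast
      next
        case 3
        then have "f r \<notin> verts" using notv unfolding r_def by simp
        then have "s2 < c" using c h(2) m_less by (cases "s2 = c") auto
        have "h u \<in> outside Q" if u: "s2 < u" "u < c" for u
        proof -
          have hm: "h u \<in> edge m" unfolding h(5) using u c by auto
          have nh: "h u \<notin> verts"
            using param_vertex[OF m_less nx(1,3) h(1-3), of u] u c by auto
          have "h u \<notin> f ` {s..r}"
          proof
            assume "h u \<in> f ` {s..r}"
            then have "h u \<in> lin i k" using param_basic(4)[OF f(1)] by auto
            then have "h u = h c" using meet_unique[OF l(1) lw(1) Mne] param_basic(4)[OF h(1)] param_basic(4)[OF f(1), of r] c(1) by metis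
            then show False using param_eq_iff[OF h(1)] u by simp
          qed
          moreover have "h u \<notin> h ` {c..t2}" using param_eq_iff[OF h(1)] u by auto
          moreover have "h u \<notin> edge l" if "l \<in> \<Lambda>" for l
          proof
            assume hl: "h u \<in> edge l"
            have "l < n" "l \<noteq> m" using that \<Lambda> by auto
            then have "h u \<in> verts" using edges_meet[OF _ m_less _ hl hm] m_less by auto
            then show False using nh by blast
          qed
          ultimately have "h u \<notin> Q" unfolding Q_def Ch_split by blast
          then show ?thesis using nest(2) hm edge_subset[OF m_less] by blast
        qed
        then have "h ` {s2<..<c} \<subseteq> outside Q" by auto
        moreover have "h ` {s2<..<c} \<subseteq> h ` {..<c}" by auto
        ultimately show ?thesis using limit_of_open_interval(2)[OF h(1) \<open>s2 < c\<close>] c(1) by (metis le_supI2)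
      qed
    qed
    then obtain Z where Z: "f r \<in> closure Z" "Z \<subseteq> f ` {r<..} \<union> h ` {..<c}" "Z \<subseteq> outside Q" by blast
    interpret wall n p \<L> i m "lin i k" f h s r c t2 Ch \<Lambda> Z
    proof unfold_locales
      show "p m \<in> h ` {..c}" using h(2) c(2) by (metis atMost_iff image_eqI)
      show "h ` {c..t2} \<subseteq> edge m" unfolding h(5) using c(2) by auto
    qed (use i m_less lw(1) f sr fOut h c ct pi Ch_arc Ch_bdry fCh Ch_split \<Lambda> \<Lambda>f Z in \<open>auto simp: Q_def\<close>)
    have "\<not> vis i (nxt m)"
    proof
      assume v: "vis i (nxt m)"
      then have "Suc M \<noteq> J" using nv J(2) nm by auto
      then show False using Kmax[of "Suc M"] v Mbd nm by auto
    qed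
    then obtain v where v: "v < n" "p v \<in> Ch" "p v \<notin> f ` {s..r}" "ext i v (2 * m + 1)"
      using next_visible by metis
    \<comment> \<open>\<open>v\<close> lies on \<open>Ch\<close> but not on the wall, so it comes
      after \<open>k\<close>. As \<open>k\<close> is the last visible vertex before
      \<open>j\<close>, it also comes after \<open>j\<close>.\<close>
    obtain U where U: "U < n" "v = idx i U" using idx_surj[OF i v(1)] by blast
    have viv: "vis i v" using v(4) by (rule ext_vis)
    have "U \<noteq> 0" using U(2) idx_0[OF i] visD(3)[OF viv] by (cases U) auto
    moreover have "U \<noteq> K"
    proof
      assume "U = K"
      then have "p v = f t" using f(3) U(2) k_def by simp
      then show False using v(3) f(4) tr by auto
    qed
    moreover have "\<not> U < K"
    proof
      assume "U < K"
      then have "real U / real n < real K / real n" "0 < real U / real n"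
        using n0 \<open>U \<noteq> 0\<close> by (auto simp: divide_strict_right_mono)
      then show False using wCh[of "real U / real n"] wp[of U] U v(2) \<tau>01(3) by auto
    qed
    moreover have "U \<noteq> J" using viv nv U(2) J(2) by auto
    ultimately have "J < U" using Kmax[of U] viv U(2) by (cases "U < J") auto
    then have "sep (2 * i) (2 * j) (2 * v) (2 * m + 1)"
      unfolding U(2) m_def using Mbd(2) U(1) Mn(1) by (intro sepI) auto
    then show ?thesis using v(4) by blast
  qed
qed

end

section \<open>The case distinction\<close>

context visibility
begin

text \<open>The condition \<open>sep (2 * i) (2 * k) (2 * s) (2 * j)\<close> puts \<open>s\<close>
  on the side of \<open>i\<close> and \<open>k\<close> away from \<open>j\<close>; phrased this way,
  one statement serves both orientations of the walks.\<close>

lemma blk_cases: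
  assumes b: "blk i j k"
  shows "vis j k \<Longrightarrow> (\<forall>s<n. s = i \<or> sep (2 * i) (2 * k) (2 * s) (2 * j) \<longrightarrow> blk j s k) \<and>
      (\<forall>t. blk k t i \<longrightarrow> blk j t k)"
    and "\<not> vis j k \<Longrightarrow> \<exists>q. blk j k q \<and> blk i q k \<and>
      (\<forall>s<n. s = i \<or> s = k \<or> sep (2 * i) (2 * k) (2 * s) (2 * j) \<longrightarrow> blk j s q) \<and>
      (\<forall>t. blk k t i \<longrightarrow> blk j t q)"
proof -
  obtain x where x: "j < n" "\<not> vis i j" "ext i k x" "sep (2 * i) (2 * j) (2 * k) x"
    using b unfolding blk_def by blast
  obtain f :: "nat \<Rightarrow> real" where f: "inj f" "\<And>a b c d. sep a b c d \<longleftrightarrow> sep (f a) (f b) (f c) (f d)"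
    "\<And>v. f (2 * i) \<le> f v" "f (2 * i) < f (2 * k)" "f (2 * k) < f (2 * j)" "f (2 * j) < f x"
    using sep_linearize[OF x(4)] by metis
  interpret blocked_pair n vis ext i j k x f
    by unfold_locales (use x f in auto)
  have pocket: "P i \<le> P s \<and> P s < P k" if "s = i \<or> sep (2 * i) (2 * k) (2 * s) (2 * j)" for s
    using that order least[of "2 * s"] unfolding sep_f by (auto simp: sep_def)
  show "(\<forall>s<n. s = i \<or> sep (2 * i) (2 * k) (2 * s) (2 * j) \<longrightarrow> blk j s k) \<and>
      (\<forall>t. blk k t i \<longrightarrow> blk j t k)" if "vis j k"
    using case_visible[OF that] pocket by blast
  show "\<exists>q. blk j k q \<and> blk i q k \<and>
      (\<forall>s<n. s = i \<or> s = k \<or> sep (2 * i) (2 * k) (2 * s) (2 * j) \<longrightarrow> blk j s q) \<and>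
      (\<forall>t. blk k t i \<longrightarrow> blk j t q)" if nv: "\<not> vis j k"
  proof -
    obtain q where "blk j k q" "blk i q k"
      "\<And>s. P i \<le> P s \<Longrightarrow> P s \<le> P k \<Longrightarrow> s < n \<Longrightarrow> blk j s q" "\<And>t. blk k t i \<Longrightarrow> blk j t q"
      using case_invisible[OF nv] by metis
    moreover have "P i \<le> P s \<and> P s \<le> P k" if "s = i \<or> s = k \<or> sep (2 * i) (2 * k) (2 * s) (2 * j)" for s
      using that pocket[of s] order by auto
    ultimately show ?thesis by blast
  qed
qed

end

lemma sep_double: "sep (2 * a) (2 * b) (2 * c) (2 * d) \<longleftrightarrow> sep a b c (d :: nat)"
  unfolding sep_def by simp

lemma arc_sep:
  fixes i j k s :: nat
  assumes ne: "i \<noteq> j" "k \<noteq> i" "k \<noteq> j"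
  shows "\<lbrakk>if i < j then i \<le> k \<and> k \<le> j else i \<le> k \<or> k \<le> j; if i < k then i \<le> s \<and> s \<le> k else i \<le> s \<or> s \<le> k\<rbrakk>
      \<Longrightarrow> s = i \<or> s = k \<or> sep i k s j"
    and "\<lbrakk>if j < i then j \<le> k \<and> k \<le> i else j \<le> k \<or> k \<le> i; if k < i then k \<le> s \<and> s \<le> i else k \<le> s \<or> s \<le> i\<rbrakk>
      \<Longrightarrow> s = i \<or> s = k \<or> sep i k s j"
proof -
  assume a: "if i < j then i \<le> k \<and> k \<le> j else i \<le> k \<or> k \<le> j" "if i < k then i \<le> s \<and> s \<le> k else i \<le> s \<or> s \<le> k"
  consider "i < k" "k < j" | "j < i" "i < k" | "k < j" "j < i" using a(1) ne by (auto split: if_splits)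
  then show "s = i \<or> s = k \<or> sep i k s j" by cases (use a(2) in \<open>auto simp: sep_def\<close>)
next
  assume a: "if j < i then j \<le> k \<and> k \<le> i else j \<le> k \<or> k \<le> i" "if k < i then k \<le> s \<and> s \<le> i else k \<le> s \<or> s \<le> i"
  consider "j < k" "k < i" | "i < j" "j < k" | "k < i" "i < j" using a(1) ne by (auto split: if_splits)
  then show "s = i \<or> s = k \<or> sep i k s j" by cases (use a(2) in \<open>auto simp: sep_def\<close>)
qed

context ppoly
begin

text \<open>The walk ending at \<open>k - 1\<close> or starting at \<open>k + 1\<close> degenerates
  to the single vertex \<open>i\<close> if that neighbour of \<open>k\<close> is \<open>i\<close>;
  otherwise it is the full walk without \<open>k\<close>.\<close>

lemma pocket_walk:
  assumes "i < n" "j < n" "i \<noteq> j" "k \<noteq> i" "k \<noteq> j"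
  shows "\<lbrakk>k \<in> walk_verts n i j; s \<in> walk_verts n i k\<rbrakk> \<Longrightarrow> s < n \<and> (s = i \<or> s = k \<or> sep (2 * i) (2 * k) (2 * s) (2 * j))"
    and "\<lbrakk>k \<in> walk_verts n j i; s \<in> walk_verts n k i\<rbrakk> \<Longrightarrow> s < n \<and> (s = i \<or> s = k \<or> sep (2 * i) (2 * k) (2 * s) (2 * j))"
    and "\<lbrakk>k \<in> walk_verts n i j; s \<in> walk_verts n i ((k + n - 1) mod n)\<rbrakk> \<Longrightarrow>
      s < n \<and> (s = i \<or> sep (2 * i) (2 * k) (2 * s) (2 * j))"
    and "\<lbrakk>k \<in> walk_verts n j i; s \<in> walk_verts n ((k + 1) mod n) i\<rbrakk> \<Longrightarrow>
      s < n \<and> (s = i \<or> sep (2 * i) (2 * k) (2 * s) (2 * j))"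
proof -
  have single: "walk_verts n i i = {i}" unfolding walk_verts_def using assms(1) by auto
  have W: "k < n \<and> (if i < j then i \<le> k \<and> k \<le> j else i \<le> k \<or> k \<le> j)" if "k \<in> walk_verts n i j"
    using that walk_verts_iff[OF assms(1-3)] by blast
  have W': "k < n \<and> (if j < i then j \<le> k \<and> k \<le> i else j \<le> k \<or> k \<le> i)" if "k \<in> walk_verts n j i"
    using that walk_verts_iff[OF assms(2,1) assms(3)[symmetric]] by blast
  have kn: "k < n" if "k \<in> walk_verts n i j \<or> k \<in> walk_verts n j i"
    using that W W' by blast
  note ne = assms(3-5)
  show 1: "s < n \<and> (s = i \<or> s = k \<or> sep (2 * i) (2 * k) (2 * s) (2 * j))"
    if k: "k \<in> walk_verts n i j" "s \<in> walk_verts n i k"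
    unfolding sep_double using arc_sep(1)[OF ne] W[OF k(1)] k(2) walk_verts_iff[OF assms(1) _ ne(2)[symmetric]] by blast
  show 2: "s < n \<and> (s = i \<or> s = k \<or> sep (2 * i) (2 * k) (2 * s) (2 * j))" if k: "k \<in> walk_verts n j i" "s \<in> walk_verts n k i"
    unfolding sep_double using arc_sep(2)[OF ne] W'[OF k(1)] k(2) walk_verts_iff[OF _ assms(1) ne(2)] by blast
  show "s < n \<and> (s = i \<or> sep (2 * i) (2 * k) (2 * s) (2 * j))"
    if k: "k \<in> walk_verts n i j" and s: "s \<in> walk_verts n i ((k + n - 1) mod n)"
  proof (cases "(k + n - 1) mod n = i")
    case True
    then show ?thesis using s single assms(1) by auto
  next
    case False
    have km: "(k + n - 1) mod n = (if k = 0 then n - 1 else k - 1)"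
      using kn k assms(1) mod_less_twice[of "k + n - 1" n] by auto
    have l: "(k + n - 1) mod n < n" using assms(1) by simp
    have "s \<in> walk_verts n i k \<and> s \<noteq> k"
    proof -
      have "k < n" using kn k by blast
      define k' where "k' = (k + n - 1) mod n"
      have "k' \<noteq> i" using False k'_def by simp
      have "s < n \<and> (if i < k' then i \<le> s \<and> s \<le> k' else i \<le> s \<or> s \<le> k')"
        using s walk_verts_iff[OF assms(1) l False[symmetric]] unfolding k'_def by blast
      moreover have "k' = (if k = 0 then n - 1 else k - 1)" using km k'_def by simp
      ultimately show ?thesis using \<open>k' \<noteq> i\<close> \<open>k < n\<close> ne(2) assms(1) unfolding walk_verts_iff[OF assms(1) \<open>k < n\<close> ne(2)[symmetric]]
        by (cases "k = 0"; cases "i < k") (auto split: if_splits)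
    qed
    then show ?thesis using 1[OF k] by blast
  qed
  show "s < n \<and> (s = i \<or> sep (2 * i) (2 * k) (2 * s) (2 * j))"
    if k: "k \<in> walk_verts n j i" and s: "s \<in> walk_verts n ((k + 1) mod n) i"
  proof (cases "(k + 1) mod n = i")
    case True
    then show ?thesis using s single assms(1) by auto
  next
    case False
    have km: "(k + 1) mod n = (if k = n - 1 then 0 else k + 1)"
      using kn k assms(1) mod_less_twice[of "k + 1" n] by auto
    have l: "(k + 1) mod n < n" using assms(1) by simp
    have "s \<in> walk_verts n k i \<and> s \<noteq> k"
    proof -
      have "k < n" using kn k by blast
      define k' where "k' = (k + 1) mod n"
      have "k' \<noteq> i" using False k'_def by simp
      have "s < n \<and> (if k' < i then k' \<le> s \<and> s \<le> i else k' \<le> s \<or> s \<le> i)"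
        using s walk_verts_iff[OF l assms(1) False] unfolding k'_def by blast
      moreover have "k' = (if k = n - 1 then 0 else k + 1)" using km k'_def by simp
      ultimately show ?thesis using \<open>k' \<noteq> i\<close> \<open>k < n\<close> ne(2) assms(1) unfolding walk_verts_iff[OF \<open>k < n\<close> assms(1) ne(2)]
        by (cases "k = n - 1"; cases "k < i") (auto split: if_splits)
    qed
    then show ?thesis using 2[OF k] by blast
  qed
qed

sublocale visibility n vis ext
proof
  show "vis i k \<Longrightarrow> vis k i" for i k using vis_commute by blast
  show "vis i k \<Longrightarrow> i < n \<and> k < n \<and> i \<noteq> k" for i k using visD by blast
qed (fact ext_vis ext_odd pieces_at_vertex pieces_cross_once both_exits blocker_exists)+

text \<open>\<open>blocker\<close> is a definite description; \<open>blocker_exists\<close> and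
  \<open>blk_unique\<close> together identify its value.\<close>

lemma assigned_iff: "assigned n p \<L> i j k \<longleftrightarrow> blk i j k"
proof
  assume "assigned n p \<L> i j k"
  then have ij: "i < n" "j < n" "i \<noteq> j" "\<not> vis i j" "blocker n p \<L> i j = k"
    unfolding assigned_def invisible_pair_def by auto
  have "designated_blocker n p \<L> i j l \<longleftrightarrow> blk i j l" for l
    unfolding designated_blocker_iff[OF ij(1-3)] blk_def using ij by blast
  moreover obtain l where l: "blk i j l" using blocker_exists[OF ij(1-4)] ij unfolding blk_def by blast
  ultimately have "blocker n p \<L> i j = l" unfolding blocker_def using blk_unique by (intro the_equality) auto
  then show "blk i j k" using l ij(5) by simp
next
  assume b: "blk i j k"
  then obtain x where x: "j < n" "\<not> vis i j" "ext i k x" "sep (2 * i) (2 * j) (2 * k) x" unfolding blk_def by blast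
  have ij: "i < n" "i \<noteq> j" using visD(1)[OF ext_vis[OF x(3)]] x(4) by (auto simp: sep_def)
  have "designated_blocker n p \<L> i j l \<longleftrightarrow> blk i j l" for l
    unfolding designated_blocker_iff[OF ij(1) x(1) ij(2)] blk_def using x by blast
  then have "blocker n p \<L> i j = k" unfolding blocker_def using b blk_unique by (intro the_equality) auto
  then show "assigned n p \<L> i j k" unfolding assigned_def invisible_pair_def using ij x by blast
qed

lemma blk_neq: "blk i j k \<Longrightarrow> i < n \<and> j < n \<and> k < n \<and> i \<noteq> j \<and> k \<noteq> i \<and> k \<noteq> j"
  unfolding blk_def using visD ext_vis by (fastforce simp: sep_def)

end

theorem mainTheorem5:
  fixes n :: nat and p :: "nat \<Rightarrow> complex" and \<L> :: "complex set set" and i j k :: nat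
  assumes "pseudo_polygon n p \<L>"
    and "assigned n p \<L> i j k"
  shows
    "(k \<in> walk_verts n i j \<longrightarrow>
        (visible_pair n p \<L> j k \<and>
         (\<forall>s\<in>walk_verts n i ((k + n - 1) mod n). assigned n p \<L> j s k) \<and>
         (\<forall>t. assigned n p \<L> k t i \<longrightarrow> assigned n p \<L> j t k))
        \<noteq>
        (\<exists>q. assigned n p \<L> j k q \<and>
         assigned n p \<L> i q k \<and>
         (\<forall>s\<in>walk_verts n i k. assigned n p \<L> j s q) \<and>
         (\<forall>t. assigned n p \<L> k t i \<longrightarrow> assigned n p \<L> j t q)))
     \<and>
     (k \<in> walk_verts n j i \<longrightarrow>
        (visible_pair n p \<L> j k \<and>
         (\<forall>s\<in>walk_verts n ((k + 1) mod n) i. assigned n p \<L> j s k) \<and>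
         (\<forall>t. assigned n p \<L> k t i \<longrightarrow> assigned n p \<L> j t k))
        \<noteq>
        (\<exists>q. assigned n p \<L> j k q \<and>
         assigned n p \<L> i q k \<and>
         (\<forall>s\<in>walk_verts n k i. assigned n p \<L> j s q) \<and>
         (\<forall>t. assigned n p \<L> k t i \<longrightarrow> assigned n p \<L> j t q)))"
proof -
  interpret ppoly n p \<L> by unfold_locales (rule assms(1))
  have b: "blk i j k" using assms(2) assigned_iff by blast
  note ne = blk_neq[OF b]
  note pw = pocket_walk[of i j k]
  show ?thesis
  \<comment> \<open>The alternatives exclude each other: the first contains that \<open>j\<close>
    sees \<open>k\<close>, and a blocker for \<open>(j, k)\<close> requires that it does
    not.\<close>
  proof (cases "vis j k")
    case True
    have "\<not> blk j k q" for q using True unfolding blk_def by blast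
    then show ?thesis using blk_cases(1)[OF b True] pw ne True unfolding assigned_iff by blast
  next
    case False
    show ?thesis using blk_cases(2)[OF b False] pw ne False unfolding assigned_iff by blast
  qed
qed

end
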